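(* Let $p=(p_1,\ldots,p_n)$, where each $p_i=(p_{i,1},\ldots,p_{i,m_i})$ ($m_i\ge 1$) is a tuple of positive integers, and let $\Sigma_p=\{z\in\mathbb{C}^n:\sum_{i=1}^n\sum_{j=1}^{m_i}|z_i|^{2p_{i,j}}<1\}$. Let $S=(S_1,\ldots,S_n)$ be an $n$-tuple of commuting operators $S_i$ in $\mathcal{B}(\mathcal{H})$. The following statements are equivalent: (i) $S$ is a $\partial\Sigma_p$-isometry. (ii) (a) $\left(\prod_{i=1}^n[1-z_iw_i]^{k_i}\right)(S,S^* )\ge 0$ for all integers $k_i\ge 0$ $(1\le i\le n)$; and (b) $\left(1-\sum_{i=1}^n\sum_{j=1}^{m_i}z_i^{p_{i,j}}w_i^{p_{i,j}}\right)(S,S^* )=0$.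
   Context: $\mathcal{H}$ is a complex infinite-dimensional separable Hilbert space and $\mathcal{B}(\mathcal{H})$ is the algebra of bounded linear operators on $\mathcal{H}$. $\partial\Sigma_p=\{z\in\mathbb{C}^n:\sum_{i=1}^n\sum_{j=1}^{m_i}|z_i|^{2p_{i,j}}=1\}$. An $n$-tuple $S=(S_1,\ldots,S_n)$ of commuting operators in $\mathcal{B}(\mathcal{H})$ is subnormal if there exist a Hilbert space $\mathcal{K}\supset\mathcal{H}$ and an $n$-tuple $N=(N_1,\ldots,N_n)$ of commuting normal operators in $\mathcal{B}(\mathcal{K})$ with $N_i\mathcal{H}\subset\mathcal{H}$ and $N_i|_{\mathcal{H}}=S_i$ for $1\le i\le n$. A subnormal tuple has a minimal normal extension, unique up to unitary equivalence. A $\partial\Sigma_p$-isometry is a subnormal $n$-tuple $S$ such that the (joint) spectral measure of its minimal normal extension is supported on $\partial\Sigma_p$. Hereditary calculus: if $q(z,w)=\sum_{\alpha,\beta}a_{\alpha,\beta}z^\alpha w^\beta$ is a polynomial in $z=(z_1,\ldots,z_n)$ and $w=(w_1,\ldots,w_n)$ with real coefficients, then for any $n$-tuple $T$ of commuting operators in $\mathcal{B}(\mathcal{H})$, $(q(z,w))(T,T^* )$ denotes $\sum_{\alpha,\beta}a_{\alpha,\beta}T^{*\beta}T^\alpha$. *)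

theory Defs
  imports "HOL-Analysis.Analysis" "HOL-Library.Poly_Mapping"
begin

section \<open>Complex Hilbert spaces\<close>

text \<open>The inner product is linear in its first argument.\<close>

class complex_hilbert = banach +
  fixes scaleC :: "complex \<Rightarrow> 'a \<Rightarrow> 'a"  (infixr \<open>*\<^sub>C\<close> 75)
    and cinner :: "'a \<Rightarrow> 'a \<Rightarrow> complex"
  assumes scaleC_add_right: "c *\<^sub>C (x + y) = c *\<^sub>C x + c *\<^sub>C y"
    and scaleC_add_left: "(c + d) *\<^sub>C x = c *\<^sub>C x + d *\<^sub>C x"
    and scaleC_scaleC: "c *\<^sub>C (d *\<^sub>C x) = (c * d) *\<^sub>C x"
    and scaleC_of_real: "complex_of_real r *\<^sub>C x = r *\<^sub>R x"
    and cinner_add_left: "cinner (x + y) z = cinner x z + cinner y z"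
    and cinner_scaleC_left: "cinner (c *\<^sub>C x) y = c * cinner x y"
    and cinner_commute: "cinner x y = cnj (cinner y x)"
    and cinner_self: "cinner x x = complex_of_real ((norm x)\<^sup>2)"

global_interpretation complex_vector:
  vector_space "scaleC :: complex \<Rightarrow> 'a \<Rightarrow> 'a::complex_hilbert"
proof unfold_locales
  show "1 *\<^sub>C x = x" for x :: 'a
    using scaleC_of_real[of 1 x] by simp
qed (simp_all add: scaleC_add_right scaleC_add_left scaleC_scaleC)

definition infinite_dimensional :: "'a::complex_hilbert itself \<Rightarrow> bool" where
  "infinite_dimensional _ \<longleftrightarrow> \<not> (\<exists>B :: 'a set. finite B \<and> complex_vector.span B = UNIV)"

definition closed_csubspace :: "'a::complex_hilbert set \<Rightarrow> bool" where
  "closed_csubspace K \<longleftrightarrow> complex_vector.subspace K \<and> closed K"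

section \<open>Bounded operators\<close>

text \<open>
  Hilbert spaces occur as closed subspaces \<open>K\<close> of a type of class \<open>complex_hilbert\<close>, the whole
  type being \<open>K = UNIV\<close>.  An element of \<open>B(K)\<close> is represented by a function on the ambient type
  of which only the values on \<open>K\<close> are relevant.
\<close>

definition bounded_op_on :: "'a::complex_hilbert set \<Rightarrow> ('a \<Rightarrow> 'a) \<Rightarrow> bool" where
  "bounded_op_on K T \<longleftrightarrow>
     (\<forall>x\<in>K. T x \<in> K) \<and>
     (\<forall>x\<in>K. \<forall>y\<in>K. T (x + y) = T x + T y) \<and>
     (\<forall>c. \<forall>x\<in>K. T (c *\<^sub>C x) = c *\<^sub>C T x) \<and>
     (\<exists>C. \<forall>x\<in>K. norm (T x) \<le> C * norm x)"

definition adj_on :: "'a::complex_hilbert set \<Rightarrow> ('a \<Rightarrow> 'a) \<Rightarrow> 'a \<Rightarrow> 'a" where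
  "adj_on K T y = (THE z. z \<in> K \<and> (\<forall>x\<in>K. cinner (T x) y = cinner x z))"

definition normal_on :: "'a::complex_hilbert set \<Rightarrow> ('a \<Rightarrow> 'a) \<Rightarrow> bool" where
  "normal_on K T \<longleftrightarrow> bounded_op_on K T \<and> (\<forall>x\<in>K. T (adj_on K T x) = adj_on K T (T x))"

definition commuting_tuple_on :: "'a::complex_hilbert set \<Rightarrow> ('n \<Rightarrow> 'a \<Rightarrow> 'a) \<Rightarrow> bool" where
  "commuting_tuple_on K T \<longleftrightarrow>
     (\<forall>i. bounded_op_on K (T i)) \<and> (\<forall>i j. \<forall>x\<in>K. T i (T j x) = T j (T i x))"

definition positive_op :: "('a::complex_hilbert \<Rightarrow> 'a) \<Rightarrow> bool" where
  "positive_op A \<longleftrightarrow> bounded_op_on UNIV A \<and> (\<forall>x. cinner (A x) x \<in> \<real>\<^sub>\<ge>\<^sub>0)"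

section \<open>Hereditary calculus\<close>

text \<open>
  A polynomial in \<open>z\<close>, \<open>w\<close> with real coefficients assigns to (finitely many) pairs
  \<open>(\<alpha>, \<beta>)\<close> of multi-indices the coefficient of \<open>z\<^sup>\<alpha> w\<^sup>\<beta>\<close>; the ring structure is the one
  (convolution) of \<open>HOL-Library.Poly_Mapping\<close>.
\<close>

type_synonym 'n hpoly = "(('n \<Rightarrow>\<^sub>0 nat) \<times> ('n \<Rightarrow>\<^sub>0 nat)) \<Rightarrow>\<^sub>0 real"

definition zvar :: "'n \<Rightarrow> 'n hpoly" where
  "zvar i = Poly_Mapping.single (Poly_Mapping.single i 1, 0) 1"

definition wvar :: "'n \<Rightarrow> 'n hpoly" where
  "wvar i = Poly_Mapping.single (0, Poly_Mapping.single i 1) 1"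

text \<open>\<open>T\<^sup>\<alpha>\<close>; the factors may be composed in any order since this is only used for commuting \<open>T\<close>.\<close>

definition tuple_power :: "('n::finite \<Rightarrow> 'a \<Rightarrow> 'a) \<Rightarrow> ('n \<Rightarrow>\<^sub>0 nat) \<Rightarrow> 'a \<Rightarrow> 'a" where
  "tuple_power T \<alpha> =
     Finite_Set.fold (\<lambda>i g. (T i ^^ Poly_Mapping.lookup \<alpha> i) \<circ> g) id UNIV"

definition hereditary ::
  "'n::finite hpoly \<Rightarrow> ('n \<Rightarrow> 'a::complex_hilbert \<Rightarrow> 'a) \<Rightarrow> 'a \<Rightarrow> 'a" where
  "hereditary q T x =
     (\<Sum>(\<alpha>, \<beta>)\<in>Poly_Mapping.keys q. Poly_Mapping.lookup q (\<alpha>, \<beta>) *\<^sub>R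
        tuple_power (\<lambda>i. adj_on UNIV (T i)) \<beta> (tuple_power T \<alpha> x))"

section \<open>Subnormal tuples\<close>

text \<open>
  \<open>H\<close> is the type \<open>'a\<close>, the larger space \<open>K\<close> is a closed subspace of the type \<open>'k\<close>, and the
  inclusion of \<open>H\<close> into \<open>K\<close> is the linear isometry \<open>V\<close>.
\<close>

definition normal_extension ::
  "('n \<Rightarrow> 'a::complex_hilbert \<Rightarrow> 'a) \<Rightarrow> ('a \<Rightarrow> 'k::complex_hilbert) \<Rightarrow> 'k set \<Rightarrow>
   ('n \<Rightarrow> 'k \<Rightarrow> 'k) \<Rightarrow> bool" where
  "normal_extension S V K N \<longleftrightarrow>
     closed_csubspace K \<and>
     Vector_Spaces.linear scaleC scaleC V \<and> (\<forall>x y. cinner (V x) (V y) = cinner x y) \<and>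
     range V \<subseteq> K \<and>
     commuting_tuple_on K N \<and> (\<forall>i. normal_on K (N i)) \<and>
     (\<forall>i x. N i (V x) = V (S i x))"

text \<open>Minimality: no proper reducing subspace of \<open>K\<close> contains \<open>H\<close>.\<close>

definition minimal_normal_extension ::
  "('n \<Rightarrow> 'a::complex_hilbert \<Rightarrow> 'a) \<Rightarrow> ('a \<Rightarrow> 'k::complex_hilbert) \<Rightarrow> 'k set \<Rightarrow>
   ('n \<Rightarrow> 'k \<Rightarrow> 'k) \<Rightarrow> bool" where
  "minimal_normal_extension S V K N \<longleftrightarrow>
     normal_extension S V K N \<and>
     (\<forall>M. closed_csubspace M \<and> M \<subseteq> K \<and> range V \<subseteq> M \<and>
        (\<forall>i. \<forall>x\<in>M. N i x \<in> M \<and> adj_on K (N i) x \<in> M) \<longrightarrow> M = K)"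

definition subnormal ::
  "'k::complex_hilbert itself \<Rightarrow> ('n \<Rightarrow> 'a::complex_hilbert \<Rightarrow> 'a) \<Rightarrow> bool" where
  "subnormal _ S \<longleftrightarrow>
     commuting_tuple_on UNIV S \<and>
     (\<exists>(V :: 'a \<Rightarrow> 'k) K N. normal_extension S V K N)"

section \<open>Joint spectral measures\<close>

definition projection_valued_measure ::
  "'k::complex_hilbert set \<Rightarrow> ('x::topological_space set \<Rightarrow> 'k \<Rightarrow> 'k) \<Rightarrow> bool" where
  "projection_valued_measure K E \<longleftrightarrow>
     (\<forall>B\<in>sets borel. bounded_op_on K (E B) \<and> (\<forall>x\<in>K. E B (E B x) = E B x) \<and>
        (\<forall>x\<in>K. \<forall>y\<in>K. cinner (E B x) y = cinner x (E B y))) \<and>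
     (\<forall>x\<in>K. E {} x = 0 \<and> E UNIV x = x) \<and>
     (\<forall>A\<in>sets borel. \<forall>B\<in>sets borel. \<forall>x\<in>K. E (A \<inter> B) x = E A (E B x)) \<and>
     (\<forall>A :: nat \<Rightarrow> 'x set. range A \<subseteq> sets borel \<longrightarrow> disjoint_family A \<longrightarrow>
        (\<forall>x\<in>K. (\<lambda>k. E (A k) x) sums E (\<Union>k. A k) x))"

text \<open>The positive Borel measure \<open>B \<mapsto> \<langle>E(B)x, x\<rangle>\<close>.\<close>

definition scalar_measure ::
  "('x::topological_space set \<Rightarrow> 'k::complex_hilbert \<Rightarrow> 'k) \<Rightarrow> 'k \<Rightarrow> 'x measure" where
  "scalar_measure E x =
     measure_of UNIV (sets borel) (\<lambda>B. ennreal (Re (cinner (E B x) x)))"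

text \<open>
  \<open>N\<^sub>i = \<integral> z\<^sub>i dE(z)\<close> in the weak sense; by polarization the diagonal of the sesquilinear
  form suffices.  As a Bochner integral is \<open>0\<close> when it does not exist, integrability is required
  separately; holding for all \<open>x\<close>, it forces \<open>E\<close> to have bounded support.
\<close>

definition joint_spectral_measure ::
  "'k::complex_hilbert set \<Rightarrow> ('n::finite \<Rightarrow> 'k \<Rightarrow> 'k) \<Rightarrow>
   ((complex ^ 'n) set \<Rightarrow> 'k \<Rightarrow> 'k) \<Rightarrow> bool" where
  "joint_spectral_measure K N E \<longleftrightarrow>
     projection_valued_measure K E \<and>
     (\<forall>i. \<forall>x\<in>K. integrable (scalar_measure E x) (\<lambda>z. z $ i) \<and>
        cinner (N i x) x = (\<integral>z. z $ i \<partial>scalar_measure E x))"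

section \<open>Isometries associated with the boundary\<close>

definition boundary_Sigma :: "('n::finite \<Rightarrow> nat) \<Rightarrow> ('n \<Rightarrow> nat \<Rightarrow> nat) \<Rightarrow> (complex ^ 'n) set" where
  "boundary_Sigma m p = {z. (\<Sum>i\<in>UNIV. \<Sum>j=1..m i. cmod (z $ i) ^ (2 * p i j)) = 1}"

text \<open>
  \<open>boundary_Sigma m p\<close> is closed, so the support of \<open>E\<close> lies in it iff \<open>E\<close> vanishes on its
  complement.  The minimal normal extension is unique up to unitary equivalence and its spectral
  measure is unique, so it is immaterial which one is inspected.
\<close>

definition boundary_Sigma_isometry ::
  "'k::complex_hilbert itself \<Rightarrow> ('n::finite \<Rightarrow> nat) \<Rightarrow> ('n \<Rightarrow> nat \<Rightarrow> nat) \<Rightarrow>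
   ('n \<Rightarrow> 'a::complex_hilbert \<Rightarrow> 'a) \<Rightarrow> bool" where
  "boundary_Sigma_isometry k m p S \<longleftrightarrow>
     subnormal k S \<and>
     (\<exists>(V :: 'a \<Rightarrow> 'k) K N E.
        minimal_normal_extension S V K N \<and> joint_spectral_measure K N E \<and>
        (\<forall>x\<in>K. E (- boundary_Sigma m p) x = 0))"

end

theory Submission
  imports Defs "HOL-Probability.Probability" "HOL-Computational_Algebra.Polynomial"
    "HOL-Real_Asymp.Real_Asymp"
begin

text \<open>The spectral measure of the minimal normal extension is a projection-valued measure \<open>E\<close>, so the
  forward direction is integration of \<open>\<Prod>(1 - \<bar>z\<^sub>i\<bar>\<^sup>2)\<^sup>k\<close>, nonnegative on \<open>\<partial>\<Sigma>\<^sub>p\<close>, and of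
  \<open>1 - \<Sum>\<bar>z\<^sub>i\<bar>\<^sup>2\<^sup>p\<close>, zero there.

  Conversely, the inequalities say that every array \<open>\<parallel>S\<^sup>\<alpha>x\<parallel>\<^sup>2\<close> is a completely monotone moment array on
  the unit cube. Bernstein polynomials turn this into positivity of the Halmos--Bram kernel
  \<open>\<langle>S\<^sup>\<beta>x, S\<^sup>\<alpha>y\<rangle>\<close>. As the space is separable, its restriction to a dense sequence is realised by
  vectors in the given infinite-dimensional space through a Cholesky factorisation, and shifting \<open>\<alpha>\<close>
  and \<open>\<beta>\<close> gives commuting normal contractions \<open>N\<^sub>i\<close> extending \<open>S\<^sub>i\<close>. Their spectral measure is again
  obtained from a Hausdorff moment problem, in the \<open>2n\<close> variables \<open>(1 + Re z\<^sub>i)/2\<close> and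
  \<open>(1 + Im z\<^sub>i)/2\<close>. The several-variable moment problem is reduced to Helly's theorem on the line by a
  space-filling curve. Finally the equality extends from \<open>S\<close> to \<open>N\<close> on the minimal space, so
  \<open>\<integral>(1 - \<Sum>\<bar>z\<^sub>i\<bar>\<^sup>2\<^sup>p)\<^sup>2 d\<langle>E x, x\<rangle> = 0\<close> and \<open>E\<close> lives on \<open>\<partial>\<Sigma>\<^sub>p\<close>.\<close>

subsection \<open>Operators on complex Hilbert spaces\<close>

text \<open>The ambient type of the extension is fixed by the statement, so no quotient and
  completion can be formed for it; hence the kernel is restricted to countably many vectors, each
  realised as a finite combination of an orthonormal sequence. These vectors stand for N^{*\<alpha>}
  x, since a normal extension satisfies <N^{*\<alpha>} x, N^{*\<beta>} y> = <S^\<beta> x, S^\<alpha>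
  y>. Positivity of this kernel is the main obstacle: (a) controls functions of the moduli |z_i|
  only, whereas conj(z)^\<alpha> = |z|^(2\<alpha>) z^(-\<alpha>) involves a division that is
  meaningless where z_i vanishes. The operators act on the whole ambient type and are 0 on the
  complement of the closed span of the realised vectors, so spectral theory is done for total
  operators and restricted at the end. Complex measures appear only as functionals continuous under
  bounded pointwise convergence. The scalar measures are chosen for each x separately;
  sesquilinearity, self-adjointness and multiplicativity of E are all read off from the uniqueness
  of such a functional with given moments.\<close>

lemma cinner_add_right: "cinner x (y + z) = cinner x y + cinner x (z::'a::complex_hilbert)"
  by (metis cinner_add_left cinner_commute complex_cnj_add)

lemma cinner_scaleC_right: "cinner x (c *\<^sub>C y) = cnj c * cinner x (y::'a::complex_hilbert)"
  by (metis cinner_commute cinner_scaleC_left complex_cnj_mult)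

lemma scaleR_eq_scaleC: "r *\<^sub>R x = complex_of_real r *\<^sub>C (x::'a::complex_hilbert)"
  by (simp add: scaleC_of_real)

lemma norm_scaleC: "norm (c *\<^sub>C x) = cmod c * norm (x::'a::complex_hilbert)"
proof -
  have "complex_of_real ((norm (c *\<^sub>C x))\<^sup>2) = (c * cnj c) * of_real ((norm x)\<^sup>2)"
    unfolding cinner_self[symmetric] cinner_scaleC_left cinner_scaleC_right by simp
  also have "\<dots> = of_real ((cmod c * norm x)\<^sup>2)"
    unfolding complex_norm_square[symmetric] by (simp add: power_mult_distrib)
  finally have "(norm (c *\<^sub>C x))\<^sup>2 = (cmod c * norm x)\<^sup>2"
    by (simp only: of_real_eq_iff)
  then show ?thesis
    by (simp add: power2_eq_iff_nonneg)
qed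

lemma cinner_zero_left [simp]: "cinner 0 (x::'a::complex_hilbert) = 0"
  using cinner_add_left[of 0 0 x] by simp

lemma cinner_zero_right [simp]: "cinner (x::'a::complex_hilbert) 0 = 0"
  using cinner_add_right[of x 0 0] by simp

lemma cinner_minus_left [simp]: "cinner (- x) (y::'a::complex_hilbert) = - cinner x y"
  using cinner_add_left[of x "- x" y] by (simp add: add_eq_0_iff2)

lemma cinner_minus_right [simp]: "cinner x (- (y::'a::complex_hilbert)) = - cinner x y"
  using cinner_add_right[of x y "- y"] by (simp add: add_eq_0_iff2)

lemma cinner_diff_left: "cinner (x - y) (z::'a::complex_hilbert) = cinner x z - cinner y z"
  using cinner_add_left[of x "- y" z] by simp

lemma cinner_diff_right: "cinner x (y - (z::'a::complex_hilbert)) = cinner x y - cinner x z"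
  using cinner_add_right[of x y "- z"] by simp

lemma cinner_eq_0_commute: "cinner x y = 0 \<longleftrightarrow> cinner y (x::'a::complex_hilbert) = 0"
  by (subst cinner_commute) simp

lemma Re_cinner_self: "Re (cinner x x) = (norm (x::'a::complex_hilbert))\<^sup>2"
  by (simp add: cinner_self)

lemma norm_diff_cinner:
  "(norm (x - y))\<^sup>2 = (norm x)\<^sup>2 + (norm y)\<^sup>2 - 2 * Re (cinner x (y::'a::complex_hilbert))"
proof -
  have "Re (cinner y x) = Re (cinner x y)"
    by (metis cinner_commute complex_cnj(1) complex.sel(1) complex_surj)
  then show ?thesis
    unfolding Re_cinner_self[symmetric] by (simp add: cinner_diff_left cinner_diff_right)
qed

lemma norm_add_cinner:
  "(norm (x + y))\<^sup>2 = (norm x)\<^sup>2 + (norm y)\<^sup>2 + 2 * Re (cinner x (y::'a::complex_hilbert))"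
  using norm_diff_cinner[of x "- y"] by simp

text \<open>Pythagoras for the component of \<open>x\<close> orthogonal to \<open>y\<close>.
  Nonnegativity of the left side is the Cauchy-Schwarz inequality, and the loss on the right side
  excludes a closer point in the projection theorem.\<close>

lemma norm_diff_projection:
  fixes x y :: "'a::complex_hilbert"
  assumes "y \<noteq> 0"
  shows "(norm (x - (cinner x y / of_real ((norm y)\<^sup>2)) *\<^sub>C y))\<^sup>2 = (norm x)\<^sup>2 - (cmod (cinner x y))\<^sup>2 / (norm y)\<^sup>2"
proof -
  have "Re (cinner x ((cinner x y / of_real ((norm y)\<^sup>2)) *\<^sub>C y)) = (cmod (cinner x y))\<^sup>2 / (norm y)\<^sup>2"
  proof -
    have "cinner x ((cinner x y / of_real ((norm y)\<^sup>2)) *\<^sub>C y)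
        = (cinner x y * cnj (cinner x y)) / of_real ((norm y)\<^sup>2)"
      by (simp add: cinner_scaleC_right)
    also have "\<dots> = of_real ((cmod (cinner x y))\<^sup>2 / (norm y)\<^sup>2)"
      by (simp add: complex_norm_square[symmetric])
    finally show ?thesis by simp
  qed
  moreover have "(norm ((cinner x y / of_real ((norm y)\<^sup>2)) *\<^sub>C y))\<^sup>2 = (cmod (cinner x y))\<^sup>2 / (norm y)\<^sup>2"
    using assms by (simp add: norm_scaleC norm_divide power_mult_distrib power_divide)
      (simp add: power2_eq_square norm_mult)
  ultimately show ?thesis
    by (simp add: norm_diff_cinner)
qed

lemma cinner_Cauchy_Schwarz: "cmod (cinner x y) \<le> norm x * norm (y::'a::complex_hilbert)"
proof (cases "y = 0")
  case False
  then have "(cmod (cinner x y))\<^sup>2 / (norm y)\<^sup>2 \<le> (norm x)\<^sup>2"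
    using norm_diff_projection[OF False, of x] by (metis diff_ge_0_iff_ge zero_le_power2)
  then have "(cmod (cinner x y))\<^sup>2 \<le> (norm x * norm y)\<^sup>2"
    using False by (simp add: field_simps power_mult_distrib)
  then show ?thesis
    by (simp add: power2_le_iff_abs_le)
qed simp

lemma bounded_bilinear_cinner: "bounded_bilinear (cinner :: 'a::complex_hilbert \<Rightarrow> 'a \<Rightarrow> complex)"
proof
  show "\<exists>K. \<forall>a b::'a. cmod (cinner a b) \<le> norm a * norm b * K"
    by (rule exI[of _ 1]) (simp add: cinner_Cauchy_Schwarz)
qed (simp_all add: cinner_add_left cinner_add_right scaleR_eq_scaleC cinner_scaleC_left cinner_scaleC_right
    scaleR_conv_of_real)

lemma bounded_bilinear_scaleC: "bounded_bilinear (scaleC :: complex \<Rightarrow> 'a::complex_hilbert \<Rightarrow> 'a)"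
proof
  show "\<exists>K. \<forall>a (b::'a). norm (a *\<^sub>C b) \<le> norm a * norm b * K"
    by (rule exI[of _ 1]) (simp add: norm_scaleC)
qed (simp_all add: scaleC_add_left scaleC_add_right scaleR_eq_scaleC scaleC_scaleC
    scaleR_conv_of_real mult.commute)

lemmas cinner_sum_left = bounded_bilinear.sum_left[OF bounded_bilinear_cinner]
lemmas cinner_sum_right = bounded_bilinear.sum_right[OF bounded_bilinear_cinner]
lemmas tendsto_cinner = bounded_bilinear.tendsto[OF bounded_bilinear_cinner]
lemmas tendsto_scaleC = bounded_bilinear.tendsto[OF bounded_bilinear_scaleC]

lemma cinner_eqI:
  fixes x y :: "'a::complex_hilbert"
  assumes "\<And>z. cinner x z = cinner y z"
  shows "x = y"
  using assms[of "x - y"] cinner_self[of "x - y"] by (simp add: cinner_diff_left)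

lemma cinner_eqI':
  fixes x y :: "'a::complex_hilbert"
  assumes "\<And>z. cinner z x = cinner z y"
  shows "x = y"
  by (rule cinner_eqI, subst (1 2) cinner_commute) (simp add: assms)

lemma parallelogram_law:
  "(norm (x + y))\<^sup>2 + (norm (x - y))\<^sup>2 = 2 * (norm x)\<^sup>2 + 2 * (norm (y::'a::complex_hilbert))\<^sup>2"
  by (simp add: norm_add_cinner norm_diff_cinner)

section \<open>Orthogonal projection onto closed subspaces\<close>

lemma orthogonal_projection_exists:
  fixes M :: "'a::complex_hilbert set"
  assumes sub: "complex_vector.subspace M" and cl: "closed M"
  obtains u where "u \<in> M" "\<And>v. v \<in> M \<Longrightarrow> cinner (x - u) v = 0"
proof -
  have M0: "0 \<in> M" using sub by (simp add: complex_vector.subspace_0)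
  define d where "d = (INF m\<in>M. norm (x - m))"
  have bdd: "bdd_below ((\<lambda>m. norm (x - m)) ` M)" by (rule bdd_belowI[of _ 0]) auto
  have d_le: "d \<le> norm (x - m)" if "m \<in> M" for m
    unfolding d_def by (rule cINF_lower[OF bdd that])
  have d0: "0 \<le> d" unfolding d_def by (rule cINF_greatest) (use M0 in auto)
  have "\<exists>m\<in>M. norm (x - m) < d + 1 / real (Suc n)" for n
    using cINF_less_iff[OF _ bdd, of "d + 1 / real (Suc n)"] M0
    unfolding d_def[symmetric] by (auto simp: )
  then obtain m where mM: "\<And>n. m n \<in> M" and m: "\<And>n. norm (x - m n) < d + 1 / real (Suc n)"
    by metis
  have mid: "(a + b) /\<^sub>R 2 \<in> M" if "a \<in> M" "b \<in> M" for a b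
    unfolding scaleR_eq_scaleC using sub that by (simp add: complex_vector.subspace_add complex_vector.subspace_scale)
  \<comment> \<open>The midpoint of \<open>m i\<close> and \<open>m j\<close> lies in
    \<open>M\<close>, so its distance from \<open>x\<close> is at least \<open>d\<close>; the
    parallelogram law turns this into closeness of \<open>m i\<close> and
    \<open>m j\<close>.\<close>
  have para: "(norm (m i - m j))\<^sup>2 \<le> 2 * (norm (x - m i))\<^sup>2 + 2 * (norm (x - m j))\<^sup>2 - 4 * d\<^sup>2" for i j
  proof -
    have "(norm ((x - m i) + (x - m j)))\<^sup>2 = 4 * (norm (x - (m i + m j) /\<^sub>R 2))\<^sup>2"
    proof -
      have "(x - m i) + (x - m j) = 2 *\<^sub>R (x - (m i + m j) /\<^sub>R 2)"
        by (simp add: algebra_simps scaleR_2)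
      then show ?thesis by (simp only: norm_scaleR power_mult_distrib) simp
    qed
    moreover have "d\<^sup>2 \<le> (norm (x - (m i + m j) /\<^sub>R 2))\<^sup>2"
      by (rule power_mono[OF d_le[OF mid[OF mM mM]] d0])
    moreover have "norm ((x - m i) - (x - m j)) = norm (m i - m j)"
      by (simp add: norm_minus_commute)
    ultimately show ?thesis
      using parallelogram_law[of "x - m i" "x - m j"] by simp
  qed
  have "Cauchy m"
  proof (rule metric_CauchyI)
    fix e :: real assume e: "e > 0"
    have "(\<lambda>n. 4 * (d + 1 / real (Suc n))\<^sup>2 - 4 * d\<^sup>2) \<longlonglongrightarrow> 4 * (d + 0)\<^sup>2 - 4 * d\<^sup>2"
      by (intro tendsto_intros LIMSEQ_Suc lim_1_over_n)
    then have "\<forall>\<^sub>F n in sequentially. 4 * (d + 1 / real (Suc n))\<^sup>2 - 4 * d\<^sup>2 < e\<^sup>2"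
      by (rule order_tendstoD) (use e in simp)
    then obtain n0 where n0: "4 * (d + 1 / real (Suc n0))\<^sup>2 - 4 * d\<^sup>2 < e\<^sup>2"
      by (auto simp: eventually_sequentially)
    have "dist (m i) (m j) < e" if "i \<ge> n0" "j \<ge> n0" for i j
    proof -
      have *: "(norm (x - m i))\<^sup>2 \<le> (d + 1 / real (Suc n0))\<^sup>2" if "i \<ge> n0" for i
      proof (rule power_mono)
        have "norm (x - m i) \<le> d + 1 / real (Suc i)" using m[of i] by simp
        also have "1 / real (Suc i) \<le> 1 / real (Suc n0)" using that by (simp add: frac_le)
        finally show "norm (x - m i) \<le> d + 1 / real (Suc n0)" by simp
      qed simp
      have "(norm (m i - m j))\<^sup>2 < e\<^sup>2"
        using para[of i j] *[OF that(1)] *[OF that(2)] n0 by simp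
      then show ?thesis using e by (simp add: dist_norm power2_less_imp_less)
    qed
    then show "\<exists>M. \<forall>i\<ge>M. \<forall>j\<ge>M. dist (m i) (m j) < e" by blast
  qed
  then obtain u where u: "m \<longlonglongrightarrow> u"
    using Cauchy_convergent convergent_def by blast
  have uM: "u \<in> M" using closed_sequentially[OF cl] mM u by blast
  have "norm (x - u) \<le> d"
  proof (rule LIMSEQ_le)
    show "(\<lambda>n. norm (x - m n)) \<longlonglongrightarrow> norm (x - u)" by (intro tendsto_intros u)
    have "(\<lambda>n. d + 1 / real (Suc n)) \<longlonglongrightarrow> d + 0" by (intro tendsto_intros LIMSEQ_Suc lim_1_over_n)
    then show "(\<lambda>n. d + 1 / real (Suc n)) \<longlonglongrightarrow> d" by simp
    show "\<exists>N. \<forall>n\<ge>N. norm (x - m n) \<le> d + 1 / real (Suc n)" using m less_imp_le by blast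
  qed
  have "cinner (x - u) v = 0" if v: "v \<in> M" for v
  proof (cases "v = 0")
    case False
    \<comment> \<open>The coefficient of the projection of \<open>x - u\<close> on \<open>v\<close>:
      moving \<open>u\<close> inside \<open>M\<close> by \<open>c *\<^sub>C v\<close> would decrease
      the distance unless the inner product vanishes.\<close>
    define c where "c = cinner (x - u) v / of_real ((norm v)\<^sup>2)"
    have "u + c *\<^sub>C v \<in> M"
      using sub uM v by (simp add: complex_vector.subspace_add complex_vector.subspace_scale)
    then have "norm (x - u) \<le> norm (x - u - c *\<^sub>C v)"
      using d_le \<open>norm (x - u) \<le> d\<close> by (metis diff_diff_add order.trans)
    then have "(norm (x - u))\<^sup>2 \<le> (norm (x - u - c *\<^sub>C v))\<^sup>2" by (simp add: power_mono)
    then have "(cmod (cinner (x - u) v))\<^sup>2 / (norm v)\<^sup>2 \<le> 0"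
      unfolding c_def norm_diff_projection[OF False] by simp
    then show ?thesis using False by (simp add: divide_le_0_iff)
  qed simp
  with uM that show thesis by blast
qed

section \<open>Bounded complex-linear operators\<close>

definition bounded_clinear :: "('a::complex_hilbert \<Rightarrow> 'b::complex_hilbert) \<Rightarrow> bool" where
  "bounded_clinear T \<longleftrightarrow> bounded_linear T \<and> (\<forall>c x. T (c *\<^sub>C x) = c *\<^sub>C T x)"

lemma bounded_clinearI:
  assumes "\<And>x y. T (x + y) = T x + T y" "\<And>c x. T (c *\<^sub>C x) = c *\<^sub>C T x" "\<And>x. norm (T x) \<le> C * norm x"
  shows "bounded_clinear T"
  unfolding bounded_clinear_def
  by (auto intro!: bounded_linear_intro[where K = C] simp: assms scaleR_eq_scaleC mult.commute)

lemma bounded_clinear_add: "bounded_clinear T \<Longrightarrow> T (x + y) = T x + T y"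
  by (simp add: bounded_clinear_def linear_simps)

lemma bounded_clinear_diff: "bounded_clinear T \<Longrightarrow> T (x - y) = T x - T y"
  by (simp add: bounded_clinear_def linear_simps)

lemma bounded_clinear_scaleC: "bounded_clinear T \<Longrightarrow> T (c *\<^sub>C x) = c *\<^sub>C T x"
  by (simp add: bounded_clinear_def)

lemma bounded_clinear_zero: "bounded_clinear T \<Longrightarrow> T 0 = 0"
  by (simp add: bounded_clinear_def linear_simps)

lemma bounded_clinear_sum: "bounded_clinear T \<Longrightarrow> T (\<Sum>i\<in>I. f i) = (\<Sum>i\<in>I. T (f i))"
  by (simp add: bounded_clinear_def bounded_linear.linear linear_sum)

lemma bounded_clinear_bounded: "bounded_clinear T \<Longrightarrow> \<exists>C\<ge>0. \<forall>x. norm (T x) \<le> C * norm x"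
  unfolding bounded_clinear_def using bounded_linear.nonneg_bounded[of T] by (auto simp: mult.commute)

lemma bounded_clinear_iff_bounded_op_on: "bounded_op_on UNIV T \<longleftrightarrow> bounded_clinear T"
proof
  assume "bounded_op_on UNIV T"
  then obtain C where "\<And>x. norm (T x) \<le> C * norm x" "\<And>x y. T (x + y) = T x + T y" "\<And>c x. T (c *\<^sub>C x) = c *\<^sub>C T x"
    unfolding bounded_op_on_def by auto
  then show "bounded_clinear T" by (intro bounded_clinearI) auto
next
  assume "bounded_clinear T"
  then show "bounded_op_on UNIV T"
    unfolding bounded_op_on_def using bounded_clinear_bounded[of T]
    by (auto simp: bounded_clinear_add bounded_clinear_scaleC)
qed

lemma bounded_clinear_compose:
  assumes "bounded_clinear S" "bounded_clinear T"
  shows "bounded_clinear (\<lambda>x. S (T x))"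
  using assms by (auto simp: bounded_clinear_def intro: bounded_linear_compose)

lemma bounded_clinear_id: "bounded_clinear (\<lambda>x. x)"
  by (auto simp: bounded_clinear_def)

lemma bounded_clinear_0: "bounded_clinear (\<lambda>x. 0)"
  by (auto simp: bounded_clinear_def)

lemma bounded_clinear_plus:
  "bounded_clinear S \<Longrightarrow> bounded_clinear T \<Longrightarrow> bounded_clinear (\<lambda>x. S x + T x)"
  by (auto simp: bounded_clinear_def scaleC_add_right intro: bounded_linear_add)

lemma bounded_clinear_minus:
  "bounded_clinear S \<Longrightarrow> bounded_clinear T \<Longrightarrow> bounded_clinear (\<lambda>x. S x - T x)"
  by (auto simp: bounded_clinear_def complex_vector.scale_right_diff_distrib intro: bounded_linear_sub)

lemma bounded_clinear_scaleC_right: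
  "bounded_clinear T \<Longrightarrow> bounded_clinear (\<lambda>x. c *\<^sub>C T x)"
  using bounded_linear_compose[OF bounded_bilinear.bounded_linear_right[OF bounded_bilinear_scaleC, of c], of T]
  by (auto simp: bounded_clinear_def scaleC_scaleC mult.commute)

lemma bounded_clinear_scaleR_right:
  "bounded_clinear T \<Longrightarrow> bounded_clinear (\<lambda>x. c *\<^sub>R T x)"
  by (simp add: scaleR_eq_scaleC bounded_clinear_scaleC_right)

lemma bounded_clinear_setsum:
  "(\<And>i. i \<in> I \<Longrightarrow> bounded_clinear (T i)) \<Longrightarrow> bounded_clinear (\<lambda>x. \<Sum>i\<in>I. T i x)"
  by (induction I rule: infinite_finite_induct) (auto intro: bounded_clinear_plus bounded_clinear_0)

lemma bounded_clinear_funpow: "bounded_clinear (T :: 'a::complex_hilbert \<Rightarrow> 'a) \<Longrightarrow> bounded_clinear (T ^^ n)"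
proof (induction n)
  case 0
  then show ?case by (simp only: funpow.simps id_def bounded_clinear_id)
next
  case (Suc n)
  then show ?case using bounded_clinear_compose[of T "T ^^ n"] by (simp only: funpow.simps o_def)
qed

lemma bounded_clinear_comp:
  assumes "bounded_clinear S" "bounded_clinear T"
  shows "bounded_clinear (S \<circ> T)"
  using bounded_clinear_compose[OF assms] by (simp add: o_def)

section \<open>Riesz representation, operators from forms, adjoints\<close>

lemma Riesz_representation:
  fixes f :: "'a::complex_hilbert \<Rightarrow> complex"
  assumes add: "\<And>x y. f (x + y) = f x + f y" and scale: "\<And>c x. f (c *\<^sub>C x) = c * f x"
    and bound: "\<And>x. cmod (f x) \<le> C * norm x"
  obtains z where "\<And>x. f x = cinner x z"
proof -
  have bl: "bounded_linear f"
    by (rule bounded_linear_intro[where K = C])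
      (auto simp: add scale scaleR_eq_scaleC bound[unfolded mult.commute[of C]] scaleR_conv_of_real)
  define M where "M = {x. f x = 0}"
  have "closed M"
    unfolding M_def
    using continuous_closed_preimage_constant[OF linear_continuous_on[OF bl] closed_UNIV, of 0] by simp
  have f0: "f 0 = 0" using add[of 0 0] by simp
  have subM: "complex_vector.subspace M"
    unfolding M_def by (rule complex_vector.subspaceI) (auto simp: add scale f0)
  obtain z where z: "\<And>x. f x = cinner x z"
  proof (cases "M = UNIV")
    case True
    then have "\<And>x. f x = cinner x 0" by (auto simp: M_def)
    then show thesis using that by blast
  next
    case False
    then obtain x0 where x0: "f x0 \<noteq> 0" by (auto simp: M_def)
    obtain u where u: "u \<in> M" "\<And>v. v \<in> M \<Longrightarrow> cinner (x0 - u) v = 0"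
      using orthogonal_projection_exists[OF subM \<open>closed M\<close>] by blast
    define w where "w = x0 - u"
    have fw: "f w = f x0" using u(1) add[of w u] by (simp add: w_def M_def)
    have wn: "w \<noteq> 0" using fw x0 f0 by auto
    \<comment> \<open>Subtracting \<open>(f x / f w) *\<^sub>C w\<close> puts \<open>x\<close> into
      the kernel \<open>M\<close>, to which \<open>w\<close> is orthogonal; this determines
      \<open>cinner x w\<close>.\<close>
    have "f x = cinner x (cnj (f w / of_real ((norm w)\<^sup>2)) *\<^sub>C w)" for x
    proof -
      have "f (x + (- (f x / f w)) *\<^sub>C w) = 0"
        unfolding add scale using fw x0 by simp
      then have "cinner w (x + (- (f x / f w)) *\<^sub>C w) = 0"
        using u(2)[of "x + (- (f x / f w)) *\<^sub>C w"] by (simp add: w_def M_def)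
      then have "cinner (x + (- (f x / f w)) *\<^sub>C w) w = 0"
        by (simp only: cinner_eq_0_commute)
      then have "cinner x w = f x / f w * of_real ((norm w)\<^sup>2)"
        unfolding cinner_add_left cinner_scaleC_left cinner_self by (simp add: algebra_simps)
      then show ?thesis
        unfolding cinner_scaleC_right using wn fw x0 by (simp add: field_simps)
    qed
    then show thesis using that by blast
  qed
  then show thesis using that by blast
qed

text \<open>Riesz for each fixed \<open>x\<close>. The conjugate form is represented because
  \<open>s x\<close> is conjugate-linear while the representation theorem is about linear
  functionals; the values of \<open>T\<close> are determined by their inner products, which makes
  \<open>T\<close> linear.\<close>

lemma sesquilinear_operator:
  fixes s :: "'a::complex_hilbert \<Rightarrow> 'a \<Rightarrow> complex"
  assumes add_left: "\<And>x x' y. s (x + x') y = s x y + s x' y"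
    and add_right: "\<And>x y y'. s x (y + y') = s x y + s x y'"
    and scale_left: "\<And>c x y. s (c *\<^sub>C x) y = c * s x y"
    and scale_right: "\<And>c x y. s x (c *\<^sub>C y) = cnj c * s x y"
    and bound: "\<And>x y. cmod (s x y) \<le> C * norm x * norm y"
  obtains T where "bounded_clinear T" "\<And>x y. s x y = cinner (T x) y"
proof -
  have "\<exists>z. \<forall>y. s x y = cinner z y" for x
  proof -
    obtain z where z: "\<And>y. cnj (s x y) = cinner y z"
      by (rule Riesz_representation[of "\<lambda>y. cnj (s x y)" "C * norm x"])
        (auto simp: add_right scale_right bound)
    have "s x y = cinner z y" for y
      unfolding cinner_commute[of z y] z[of y, symmetric] by simp
    then show ?thesis by blast
  qed
  then obtain T where T: "\<And>x y. s x y = cinner (T x) y" by metis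
  have "bounded_clinear T"
  proof (rule bounded_clinearI)
    show "T (x + x') = T x + T x'" for x x'
      by (rule cinner_eqI) (simp add: cinner_add_left T[symmetric] add_left)
    show "T (c *\<^sub>C x) = c *\<^sub>C T x" for c x
      by (rule cinner_eqI) (simp add: cinner_scaleC_left T[symmetric] scale_left)
    show "norm (T x) \<le> \<bar>C\<bar> * norm x" for x
    proof -
      have "norm (T x) * norm (T x) \<le> C * norm x * norm (T x)"
        using bound[of x "T x"] by (simp add: T cinner_self norm_power power2_eq_square norm_mult)
      also have "\<dots> \<le> \<bar>C\<bar> * norm x * norm (T x)"
        by (intro mult_right_mono) auto
      finally show ?thesis
        by (cases "T x = 0") auto
    qed
  qed
  with T that show thesis by blast
qed

lemma adjoint_exists:
  fixes T :: "'a::complex_hilbert \<Rightarrow> 'a"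
  assumes T: "bounded_clinear T"
  obtains T' where "bounded_clinear T'" "\<And>x y. cinner (T x) y = cinner x (T' y)"
proof -
  obtain C where C: "C \<ge> 0" "\<And>x. norm (T x) \<le> C * norm x"
    using bounded_clinear_bounded[OF T] by auto
  have "cmod (cinner x (T y)) \<le> C * norm x * norm y" for x y
  proof -
    have "cmod (cinner x (T y)) \<le> norm x * norm (T y)" by (rule cinner_Cauchy_Schwarz)
    also have "\<dots> \<le> norm x * (C * norm y)" by (intro mult_left_mono C) simp
    finally show ?thesis by (simp add: mult_ac)
  qed
  then obtain T' where T': "bounded_clinear T'" "\<And>x y. cinner x (T y) = cinner (T' x) y"
    by (rule sesquilinear_operator[of "\<lambda>x y. cinner x (T y)", rotated 4])
      (auto simp: cinner_add_left cinner_add_right cinner_scaleC_left cinner_scaleC_right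
        bounded_clinear_add[OF T] bounded_clinear_scaleC[OF T])
  moreover have "cinner (T x) y = cinner x (T' y)" for x y
    using T'(2)[of y x] cinner_commute[of "T x" y] cinner_commute[of x "T' y"] by simp
  ultimately show thesis using that by blast
qed

text \<open>Evaluates the definite description in \<open>adj_on\<close>. Uniqueness is tested
  against \<open>z' - z\<close>, which lies in \<open>K\<close> because \<open>K\<close> is a
  subspace.\<close>

lemma adj_on_eqI:
  fixes K :: "'a::complex_hilbert set"
  assumes K: "complex_vector.subspace K" and z: "z \<in> K" and eq: "\<And>x. x \<in> K \<Longrightarrow> cinner (T x) y = cinner x z"
  shows "adj_on K T y = z"
  unfolding adj_on_def
proof (rule the_equality)
  fix z' assume z': "z' \<in> K \<and> (\<forall>x\<in>K. cinner (T x) y = cinner x z')"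
  have "z' - z \<in> K" using K z z' by (simp add: complex_vector.subspace_diff)
  then have "cinner (z' - z) z' = cinner (z' - z) z" using eq z' by metis
  then have "cinner (z' - z) (z' - z) = 0" by (simp add: cinner_diff_right)
  then show "z' = z" by (simp add: cinner_self)
qed (use z eq in auto)

lemma adj_on_UNIV:
  fixes T :: "'a::complex_hilbert \<Rightarrow> 'a"
  assumes "bounded_clinear T"
  shows "bounded_clinear (adj_on UNIV T)" "cinner (T x) y = cinner x (adj_on UNIV T y)"
proof -
  obtain T' where T': "bounded_clinear T'" "\<And>x y. cinner (T x) y = cinner x (T' y)"
    using adjoint_exists[OF assms] by blast
  have "adj_on UNIV T = T'"
    by (rule ext, rule adj_on_eqI) (auto simp: T')
  then show "bounded_clinear (adj_on UNIV T)" "cinner (T x) y = cinner x (adj_on UNIV T y)"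
    using T' by auto
qed

text \<open>Extension by continuity to the closed span and by zero to its orthogonal complement, for
  an operator given by its graph \<open>G\<close>.\<close>

lemma bounded_clinear_extension:
  fixes G :: "('a::complex_hilbert \<times> 'b::complex_hilbert) set"
  assumes zero: "(0, 0) \<in> G"
    and add: "\<And>v w v' w'. (v, w) \<in> G \<Longrightarrow> (v', w') \<in> G \<Longrightarrow> (v + v', w + w') \<in> G"
    and scale: "\<And>c v w. (v, w) \<in> G \<Longrightarrow> (c *\<^sub>C v, c *\<^sub>C w) \<in> G"
    and bound: "\<And>v w. (v, w) \<in> G \<Longrightarrow> norm w \<le> C * norm v" and C: "C \<ge> 0"
  obtains T where "bounded_clinear T" "\<And>v w. (v, w) \<in> G \<Longrightarrow> T v = w"
    "\<And>x. norm (T x) \<le> C * norm x" "\<And>x. (\<And>v w. (v, w) \<in> G \<Longrightarrow> cinner x v = 0) \<Longrightarrow> T x = 0"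
proof -
  \<comment> \<open>The bound passes to the closure of the graph and makes it single-valued with
    closed domain, so extension by continuity is taking this closure.\<close>
  define H where "H = closure G"
  have H_seq: "p \<in> H \<longleftrightarrow> (\<exists>f. (\<forall>n. f n \<in> G) \<and> f \<longlonglongrightarrow> p)" for p
    unfolding H_def closure_sequential ..
  have GH: "p \<in> H" if "p \<in> G" for p
    using that closure_subset by (auto simp: H_def)
  have H_add: "(v + v', w + w') \<in> H" if H1: "(v, w) \<in> H" and H2: "(v', w') \<in> H" for v w v' w'
  proof -
    obtain f where f: "\<And>n. f n \<in> G" "f \<longlonglongrightarrow> (v, w)" using H_seq H1 by auto
    obtain g where g: "\<And>n. g n \<in> G" "g \<longlonglongrightarrow> (v', w')" using H_seq H2 by auto
    have "(\<lambda>n. f n + g n) \<longlonglongrightarrow> (v, w) + (v', w')" by (intro tendsto_intros f g)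
    moreover have "f n + g n \<in> G" for n
      using f(1)[of n] g(1)[of n] add by (cases "f n"; cases "g n") auto
    ultimately show ?thesis unfolding H_seq by (intro exI[of _ "\<lambda>n. f n + g n"]) auto
  qed
  have H_scale: "(c *\<^sub>C v, c *\<^sub>C w) \<in> H" if H1: "(v, w) \<in> H" for c v w
  proof -
    obtain f where f: "\<And>n. f n \<in> G" "f \<longlonglongrightarrow> (v, w)" using H_seq H1 by auto
    have "(\<lambda>n. (c *\<^sub>C fst (f n), c *\<^sub>C snd (f n))) \<longlonglongrightarrow> (c *\<^sub>C v, c *\<^sub>C w)"
      using tendsto_fst[OF f(2)] tendsto_snd[OF f(2)] by (intro tendsto_Pair tendsto_scaleC tendsto_const) auto
    moreover have "(c *\<^sub>C fst (f n), c *\<^sub>C snd (f n)) \<in> G" for n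
      using f(1)[of n] scale by (cases "f n") auto
    ultimately show ?thesis
      unfolding H_seq by (intro exI[of _ "\<lambda>n. (c *\<^sub>C fst (f n), c *\<^sub>C snd (f n))"]) auto
  qed
  have H_diff: "(v - v', w - w') \<in> H" if "(v, w) \<in> H" "(v', w') \<in> H" for v w v' w'
    using H_add[OF that(1) H_scale[OF that(2), of "-1"]] by simp
  have H_bound: "norm w \<le> C * norm v" if H1: "(v, w) \<in> H" for v w
  proof -
    obtain f where f: "\<And>n. f n \<in> G" "f \<longlonglongrightarrow> (v, w)" using H_seq H1 by auto
    have "(\<lambda>n. norm (snd (f n))) \<longlonglongrightarrow> norm w"
      using tendsto_snd[OF f(2)] by (intro tendsto_norm) auto
    moreover have "(\<lambda>n. C * norm (fst (f n))) \<longlonglongrightarrow> C * norm v"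
      using tendsto_fst[OF f(2)] by (intro tendsto_intros tendsto_norm) auto
    moreover have "norm (snd (f n)) \<le> C * norm (fst (f n))" for n
      using f(1)[of n] bound by (cases "f n") auto
    ultimately show ?thesis by (intro LIMSEQ_le[of "\<lambda>n. norm (snd (f n))" _ "\<lambda>n. C * norm (fst (f n))"]) blast+
  qed
  define K where "K = fst ` H"
  have K0: "0 \<in> K" unfolding K_def using GH[OF zero] by force
  have subK: "complex_vector.subspace K"
  proof (rule complex_vector.subspaceI[OF K0])
    show "x + y \<in> K" if K1: "x \<in> K" "y \<in> K" for x y
    proof -
      obtain w w' where "(x, w) \<in> H" "(y, w') \<in> H" using K1 unfolding K_def by auto
      from H_add[OF this] show ?thesis unfolding K_def by force
    qed
    show "c *\<^sub>C x \<in> K" if K1: "x \<in> K" for x c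
    proof -
      obtain w where "(x, w) \<in> H" using K1 unfolding K_def by auto
      from H_scale[OF this, of c] show ?thesis unfolding K_def by force
    qed
  qed
  have "closed K"
    unfolding closed_sequential_limits
  proof (intro allI impI)
    fix f y assume "(\<forall>n. f n \<in> K) \<and> f \<longlonglongrightarrow> y"
    then have fK: "\<And>n. f n \<in> K" and fy: "f \<longlonglongrightarrow> y" by auto
    have "\<exists>w. (f n, w) \<in> H" for n using fK[of n] unfolding K_def by auto
    then obtain g where g: "\<And>n. (f n, g n) \<in> H" using choice[of "\<lambda>n w. (f n, w) \<in> H"] by blast
    have "Cauchy g"
    proof (rule metric_CauchyI)
      fix e :: real assume e: "e > 0"
      have "Cauchy f" by (rule LIMSEQ_imp_Cauchy[OF fy])
      moreover have "e / (C + 1) > 0" using e C by simp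
      ultimately obtain M where M: "\<And>m n. m \<ge> M \<Longrightarrow> n \<ge> M \<Longrightarrow> dist (f m) (f n) < e / (C + 1)"
        using metric_CauchyD[of f "e / (C + 1)"] by blast
      have "dist (g m) (g n) < e" if "m \<ge> M" "n \<ge> M" for m n
      proof -
        have "dist (g m) (g n) \<le> C * dist (f m) (f n)"
          using H_bound[OF H_diff[OF g g]] by (simp add: dist_norm)
        also have "\<dots> \<le> (C + 1) * dist (f m) (f n)" by (simp add: distrib_right)
        also have "\<dots> < (C + 1) * (e / (C + 1))"
          using M[OF that] C by (intro mult_strict_left_mono) auto
        finally show ?thesis using C by simp
      qed
      then show "\<exists>M. \<forall>m\<ge>M. \<forall>n\<ge>M. dist (g m) (g n) < e" by blast
    qed
    then obtain w where "g \<longlonglongrightarrow> w" using Cauchy_convergent convergent_def by blast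
    then have "(\<lambda>n. (f n, g n)) \<longlonglongrightarrow> (y, w)" using fy by (intro tendsto_Pair)
    moreover have "closed H" by (simp add: H_def)
    ultimately have "(y, w) \<in> H" using closed_sequentially[of H "\<lambda>n. (f n, g n)"] g by simp
    then show "y \<in> K" unfolding K_def by force
  qed
  \<comment> \<open>\<open>w\<close> is the value at the orthogonal projection \<open>u\<close> of
    \<open>x\<close> onto \<open>K\<close>; vectors orthogonal to \<open>K\<close> are thereby
    related to 0.\<close>
  define R where "R x w \<longleftrightarrow> (\<exists>u. (u, w) \<in> H \<and> (\<forall>v\<in>K. cinner (x - u) v = 0))" for x w
  have R_ex: "\<exists>w. R x w" for x
  proof -
    obtain u where u: "u \<in> K" "\<And>v. v \<in> K \<Longrightarrow> cinner (x - u) v = 0"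
      using orthogonal_projection_exists[OF subK \<open>closed K\<close>] by blast
    then show ?thesis unfolding R_def K_def by force
  qed
  have R_bound: "norm w \<le> C * norm x" if "R x w" for x w
  proof -
    obtain u where u: "(u, w) \<in> H" "\<And>v. v \<in> K \<Longrightarrow> cinner (x - u) v = 0"
      using \<open>R x w\<close> unfolding R_def by blast
    have "u \<in> K" using u(1) unfolding K_def by force
    then have "(norm x)\<^sup>2 = (norm (x - u))\<^sup>2 + (norm u)\<^sup>2"
      using norm_add_cinner[of "x - u" u] u(2)[of u] by simp
    then have "norm u \<le> norm x"
      by (metis le_add_same_cancel2 norm_ge_zero power2_le_imp_le zero_le_power2)
    then show ?thesis
      using H_bound[OF u(1)] mult_left_mono[OF _ C] by fastforce
  qed
  have R_add: "R (x + x') (w + w')" if "R x w" "R x' w'" for x x' w w'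
  proof -
    obtain u where u: "(u, w) \<in> H" "\<And>v. v \<in> K \<Longrightarrow> cinner (x - u) v = 0"
      using \<open>R x w\<close> unfolding R_def by blast
    obtain u' where u': "(u', w') \<in> H" "\<And>v. v \<in> K \<Longrightarrow> cinner (x' - u') v = 0"
      using \<open>R x' w'\<close> unfolding R_def by blast
    have "cinner (x + x' - (u + u')) v = 0" if "v \<in> K" for v
      using u(2)[OF that] u'(2)[OF that] by (simp add: cinner_diff_left cinner_add_left)
    then show ?thesis unfolding R_def using H_add[OF u(1) u'(1)] by blast
  qed
  have R_scale: "R (c *\<^sub>C x) (c *\<^sub>C w)" if "R x w" for c x w
  proof -
    obtain u where u: "(u, w) \<in> H" "\<And>v. v \<in> K \<Longrightarrow> cinner (x - u) v = 0"
      using \<open>R x w\<close> unfolding R_def by blast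
    have "cinner (c *\<^sub>C x - c *\<^sub>C u) v = 0" if "v \<in> K" for v
      using u(2)[OF that] by (simp add: cinner_diff_left cinner_scaleC_left)
    then show ?thesis unfolding R_def using H_scale[OF u(1)] by blast
  qed
  \<comment> \<open>\<open>x - x = 0\<close> is related to \<open>w - w'\<close>, and the bound at 0
    forces this difference to vanish.\<close>
  have R_unique: "w = w'" if "R x w" "R x w'" for x w w'
    using R_bound[OF R_add[OF that(1) R_scale[OF that(2), of "-1"]]] by simp
  define T where "T x = (SOME w. R x w)" for x
  have RT: "R x (T x)" for x unfolding T_def by (rule someI_ex[OF R_ex])
  have T_eq: "T x = w" if "R x w" for x w using R_unique[OF RT that] .
  show thesis
  proof (rule that)
    show "norm (T x) \<le> C * norm x" for x using R_bound[OF RT] .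
    then show "bounded_clinear T"
      by (intro bounded_clinearI T_eq R_add R_scale RT) auto
    show "T v = w" if "(v, w) \<in> G" for v w
      by (rule T_eq) (use GH[OF that] in \<open>auto simp: R_def\<close>)
    show "T x = 0" if "\<And>v w. (v, w) \<in> G \<Longrightarrow> cinner x v = 0" for x
    proof (rule T_eq)
      have "cinner x v = 0" if H1: "(v, w) \<in> H" for v w
      proof -
        obtain f where f: "\<And>n. f n \<in> G" "f \<longlonglongrightarrow> (v, w)" using H_seq H1 by auto
        have "(\<lambda>n. cinner x (fst (f n))) \<longlonglongrightarrow> cinner x v"
          using tendsto_fst[OF f(2)] by (intro tendsto_cinner tendsto_const) auto
        moreover have "cinner x (fst (f n)) = 0" for n
          using f(1)[of n] \<open>\<And>v w. (v, w) \<in> G \<Longrightarrow> cinner x v = 0\<close> by (cases "f n") auto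
        ultimately show ?thesis by (simp add: LIMSEQ_const_iff)
      qed
      then show "R x 0" unfolding R_def K_def using GH[OF zero] by (intro exI[of _ 0]) auto
    qed
  qed
qed

subsection \<open>Moment arrays and Bernstein polynomials\<close>

text \<open>The functional \<open>t\<^sup>\<alpha> \<mapsto> a \<alpha>\<close> applied to \<open>\<Prod>\<^sub>i P\<^sub>i(t\<^sub>i)\<close>.\<close>

definition mom :: "(('d::finite \<Rightarrow> nat) \<Rightarrow> complex) \<Rightarrow> ('d \<Rightarrow> real poly) \<Rightarrow> complex" where
  "mom a P = (\<Sum>j\<in>PiE UNIV (\<lambda>i. {..degree (P i)}). of_real (\<Prod>i\<in>UNIV. coeff (P i) (j i)) * a j)"

lemma finite_box [simp]: "finite (PiE (UNIV :: 'd::finite set) (\<lambda>i. {..D i :: nat}))"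
  by (rule finite_PiE) auto

text \<open>Coefficients beyond the degree vanish, so the box of exponents may be enlarged;
  polynomials of different degrees then share one range of summation.\<close>

lemma mom_degree_le:
  assumes "\<And>i. degree (P i) \<le> D i"
  shows "mom a P = (\<Sum>j\<in>PiE UNIV (\<lambda>i. {..D i}). of_real (\<Prod>i\<in>UNIV. coeff (P i) (j i)) * a j)"
  unfolding mom_def
proof (rule sum.mono_neutral_left)
  show "PiE UNIV (\<lambda>i. {..degree (P i)}) \<subseteq> PiE UNIV (\<lambda>i. {..D i})"
    using assms by (intro PiE_mono) auto
  show "\<forall>j\<in>PiE UNIV (\<lambda>i. {..D i}) - PiE UNIV (\<lambda>i. {..degree (P i)}).
      of_real (\<Prod>i\<in>UNIV. coeff (P i) (j i)) * a j = 0"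
  proof
    fix j assume "j \<in> PiE UNIV (\<lambda>i. {..D i}) - PiE UNIV (\<lambda>i. {..degree (P i)})"
    then obtain i where "\<not> j i \<le> degree (P i)" by (auto simp: PiE_def Pi_def)
    then have "coeff (P i) (j i) = 0" by (simp add: coeff_eq_0)
    then have "(\<Prod>i\<in>UNIV. coeff (P i) (j i)) = 0" by (meson UNIV_I finite_class.finite_UNIV prod_zero)
    then show "of_real (\<Prod>i\<in>UNIV. coeff (P i) (j i)) * a j = 0" by simp
  qed
qed simp

text \<open>Multilinearity in the one-variable factors: a product over the coordinates of sums
  expands into a sum over choice functions.\<close>

lemma mom_sum:
  assumes fin: "\<And>i. finite (B i)"
  shows "mom a (\<lambda>i. \<Sum>k\<in>B i. Q i k) = (\<Sum>k\<in>PiE UNIV B. mom a (\<lambda>i. Q i (k i)))"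
proof -
  define D where "D i = Max (insert 0 ((\<lambda>k. degree (Q i k)) ` B i))" for i
  have D: "degree (Q i k) \<le> D i" if "k \<in> B i" for i k
    unfolding D_def using that fin by (intro Max_ge) auto
  have "mom a (\<lambda>i. \<Sum>k\<in>B i. Q i k) =
      (\<Sum>j\<in>PiE UNIV (\<lambda>i. {..D i}). of_real (\<Prod>i\<in>UNIV. \<Sum>k\<in>B i. coeff (Q i k) (j i)) * a j)"
    by (subst mom_degree_le[where D = D]) (auto intro: degree_sum_le D fin simp: coeff_sum)
  also have "\<dots> = (\<Sum>j\<in>PiE UNIV (\<lambda>i. {..D i}). \<Sum>k\<in>PiE UNIV B. of_real (\<Prod>i\<in>UNIV. coeff (Q i (k i)) (j i)) * a j)"
    by (subst prod_sum_PiE) (auto simp: fin sum_distrib_right)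
  also have "\<dots> = (\<Sum>k\<in>PiE UNIV B. mom a (\<lambda>i. Q i (k i)))"
    by (subst sum.swap) (intro sum.cong refl mom_degree_le[symmetric] D, auto)
  finally show ?thesis .
qed

lemma mom_monom: "mom a (\<lambda>i. monom 1 (\<alpha> i)) = a \<alpha>"
proof -
  have "mom a (\<lambda>i. monom 1 (\<alpha> i)) =
      (\<Sum>j\<in>PiE UNIV (\<lambda>i. {..\<alpha> i}). of_real (\<Prod>i\<in>UNIV. coeff (monom (1::real) (\<alpha> i)) (j i)) * a j)"
    by (rule mom_degree_le) (simp add: degree_monom_le)
  also have "\<dots> = (\<Sum>j\<in>{\<alpha>}. of_real (\<Prod>i\<in>UNIV. coeff (monom (1::real) (\<alpha> i)) (j i)) * a j)"
  proof (rule sum.mono_neutral_right)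
    show "\<forall>j\<in>PiE UNIV (\<lambda>i. {..\<alpha> i}) - {\<alpha>}. of_real (\<Prod>i\<in>UNIV. coeff (monom (1::real) (\<alpha> i)) (j i)) * a j = 0"
    proof
      fix j assume "j \<in> PiE UNIV (\<lambda>i. {..\<alpha> i}) - {\<alpha>}"
      then have "j \<noteq> \<alpha>" by simp
      then obtain i where "\<alpha> i \<noteq> j i" by (metis ext)
      then have "coeff (monom (1::real) (\<alpha> i)) (j i) = 0" by simp
      then have "(\<Prod>i\<in>UNIV. coeff (monom (1::real) (\<alpha> i)) (j i)) = 0"
        by (meson UNIV_I finite_class.finite_UNIV prod_zero)
      then show "of_real (\<Prod>i\<in>UNIV. coeff (monom (1::real) (\<alpha> i)) (j i)) * a j = 0" by simp
    qed
  qed auto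
  finally show ?thesis by simp
qed

lemma mom_smult: "mom a (\<lambda>i. smult (c i) (P i)) = of_real (\<Prod>i\<in>UNIV. c i) * mom a P"
proof -
  have "mom a (\<lambda>i. smult (c i) (P i)) =
      (\<Sum>j\<in>PiE UNIV (\<lambda>i. {..degree (P i)}). of_real (\<Prod>i\<in>UNIV. coeff (smult (c i) (P i)) (j i)) * a j)"
    by (rule mom_degree_le) (rule degree_smult_le)
  then show ?thesis by (simp add: mom_def prod.distrib sum_distrib_left mult.assoc)
qed

text \<open>Multiplication of the polynomial by a monomial is a shift of the array. On the operator
  side this shift becomes an application of powers of the tuple.\<close>

lemma mom_shift: "mom a (\<lambda>i. monom 1 (\<delta> i) * P i) = mom (\<lambda>j. a (\<lambda>i. \<delta> i + j i)) P"
proof -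
  have "(\<lambda>i. monom 1 (\<delta> i) * P i) = (\<lambda>i. \<Sum>j\<le>degree (P i). smult (coeff (P i) j) (monom 1 (\<delta> i + j)))"
  proof
    fix i
    have "monom 1 (\<delta> i) * P i = monom 1 (\<delta> i) * (\<Sum>j\<le>degree (P i). monom (coeff (P i) j) j)"
      by (simp add: poly_as_sum_of_monoms)
    then show "monom 1 (\<delta> i) * P i = (\<Sum>j\<le>degree (P i). smult (coeff (P i) j) (monom 1 (\<delta> i + j)))"
      by (simp add: sum_distrib_left mult_monom smult_monom)
  qed
  then show ?thesis
    by (simp only: mom_sum finite_atMost mom_smult mom_monom) (simp add: mom_def)
qed

lemma mom_linear: "mom (\<lambda>j. \<Sum>k\<in>F. c k * a k j) P = (\<Sum>k\<in>F. c k * mom (a k) P)"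
proof -
  have "mom (\<lambda>j. \<Sum>k\<in>F. c k * a k j) P =
      (\<Sum>j\<in>PiE UNIV (\<lambda>i. {..degree (P i)}). \<Sum>k\<in>F. c k * (of_real (\<Prod>i\<in>UNIV. coeff (P i) (j i)) * a k j))"
    unfolding mom_def by (simp only: sum_distrib_left mult.left_commute)
  also have "\<dots> = (\<Sum>k\<in>F. c k * mom (a k) P)"
    unfolding mom_def by (subst sum.swap) (simp add: sum_distrib_left)
  finally show ?thesis .
qed

section \<open>Bernstein polynomials as discrete approximations of a moment functional\<close>

definition bernp :: "nat \<Rightarrow> nat \<Rightarrow> real poly" where
  "bernp N k = smult (of_nat (N choose k)) (monom 1 k * [:1, -1:] ^ (N - k))"

text \<open>Follows from (N choose k)(k choose a) = (N choose a)(N-a choose k-a) and the binomial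
  theorem. The case \<open>a = 0\<close> is the partition of unity.\<close>

lemma sum_bernp:
  assumes "a \<le> N"
  shows "(\<Sum>k\<le>N. smult (real (k choose a) / real (N choose a)) (bernp N k)) = monom 1 a"
proof -
  have "poly (\<Sum>k\<le>N. smult (real (k choose a) / real (N choose a)) (bernp N k)) x = poly (monom 1 a) x" for x :: real
  proof -
    have pos: "real (N choose a) \<noteq> 0" using assms by simp
    have "poly (\<Sum>k\<le>N. smult (real (k choose a) / real (N choose a)) (bernp N k)) x
        = (\<Sum>k\<le>N. real (k choose a) / real (N choose a) * (real (N choose k) * (x ^ k * (1 - x) ^ (N - k))))"
      by (simp add: poly_sum bernp_def poly_monom mult.assoc)
    also have "\<dots> = (\<Sum>k\<in>{a..N}. real (k choose a) / real (N choose a) * (real (N choose k) * (x ^ k * (1 - x) ^ (N - k))))"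
      by (rule sum.mono_neutral_right) auto
    also have "\<dots> = (\<Sum>k\<in>{a..N}. real ((N - a) choose (k - a)) * (x ^ k * (1 - x) ^ (N - k)))"
    proof (rule sum.cong[OF refl])
      fix k assume "k \<in> {a..N}"
      then have "(N choose k) * (k choose a) = (N choose a) * ((N - a) choose (k - a))"
        by (intro choose_mult) auto
      then have "real (N choose k) * real (k choose a) = real (N choose a) * real ((N - a) choose (k - a))"
        by (metis of_nat_mult)
      then show "real (k choose a) / real (N choose a) * (real (N choose k) * (x ^ k * (1 - x) ^ (N - k)))
          = real ((N - a) choose (k - a)) * (x ^ k * (1 - x) ^ (N - k))"
        using pos by (simp add: field_simps)
    qed
    also have "\<dots> = (\<Sum>j\<le>N - a. real ((N - a) choose j) * (x ^ (j + a) * (1 - x) ^ (N - a - j)))"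
      using assms
      by (intro sum.reindex_bij_witness[of _ "\<lambda>j. j + a" "\<lambda>k. k - a"]) auto
    also have "\<dots> = x ^ a * (\<Sum>j\<le>N - a. real ((N - a) choose j) * x ^ j * (1 - x) ^ (N - a - j))"
      by (simp add: sum_distrib_left power_add mult_ac)
    also have "\<dots> = x ^ a"
      using binomial_ring[of x "1 - x" "N - a"] by simp
    finally show ?thesis by (simp add: poly_monom)
  qed
  then show ?thesis by (simp add: poly_eq_poly_eq_iff[symmetric] fun_eq_iff)
qed

lemma choose_ratio_eq_prod:
  assumes "a \<le> N"
  shows "real (k choose a) / real (N choose a) = (\<Prod>j<a. (real k - real j) / (real N - real j))"
proof -
  have "real (m choose a) = (\<Prod>j<a. real m - real j) / fact a" for m
    by (simp add: binomial_gbinomial gbinomial_prod_rev atLeast0LessThan)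
  then show ?thesis by (simp add: prod_dividef)
qed

text \<open>Both quantities are products of \<open>a\<close> factors of modulus at most 1, so their
  difference is at most the sum of the differences of factors, each at most a/(N-a). The condition
  \<open>2 * a < N\<close> keeps (k-j)/(N-j) of modulus at most 1 even for k < j, where it is
  negative.\<close>

lemma power_choose_ratio:
  assumes "2 * a < N" "k \<le> N"
  shows "\<bar>(real k / real N) ^ a - real (k choose a) / real (N choose a)\<bar> \<le> real a * (real a / (real N - real a))"
    and "\<bar>real (k choose a) / real (N choose a)\<bar> \<le> 1"
proof -
  have le1: "\<bar>(real k - real j) / (real N - real j)\<bar> \<le> 1" if "j < a" for j
    using assms that by (auto simp: abs_if field_simps split: if_splits)
  have eq: "real (k choose a) / real (N choose a) = (\<Prod>j<a. (real k - real j) / (real N - real j))"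
    by (rule choose_ratio_eq_prod) (use assms in simp)
  show "\<bar>real (k choose a) / real (N choose a)\<bar> \<le> 1"
    unfolding eq abs_prod by (rule prod_le_1) (use le1 in auto)
  have "\<bar>(\<Prod>j<a. real k / real N) - (\<Prod>j<a. (real k - real j) / (real N - real j))\<bar>
      \<le> (\<Sum>j<a. \<bar>real k / real N - (real k - real j) / (real N - real j)\<bar>)"
    using norm_prod_diff[of "{..<a}" "\<lambda>j. real k / real N" "\<lambda>j. (real k - real j) / (real N - real j)"]
      assms le1 by (auto simp: divide_le_eq_1)
  also have "\<dots> \<le> (\<Sum>j<a. real a / (real N - real a))"
  proof (rule sum_mono)
    fix j assume "j \<in> {..<a}"
    then have j: "j < a" by simp
    have N: "real N > 0" "real N - real j > 0" "real N - real a > 0" using assms j by auto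
    have "real k / real N - (real k - real j) / (real N - real j) = (real j * (real N - real k) / (real N * (real N - real j)))"
      using N by (simp add: field_simps)
    then have "\<bar>real k / real N - (real k - real j) / (real N - real j)\<bar> = real j * (real N - real k) / (real N * (real N - real j))"
      using N assms by simp
    also have "\<dots> \<le> real j * real N / (real N * (real N - real j))"
      using N by (intro divide_right_mono mult_left_mono) auto
    also have "\<dots> = real j / (real N - real j)" using N by simp
    also have "\<dots> \<le> real a / (real N - real a)"
      using N j by (intro frac_le) auto
    finally show "\<bar>real k / real N - (real k - real j) / (real N - real j)\<bar> \<le> real a / (real N - real a)" .
  qed
  finally show "\<bar>(real k / real N) ^ a - real (k choose a) / real (N choose a)\<bar> \<le> real a * (real a / (real N - real a))"
    by (simp add: eq)
qed

text \<open>Monomials are compared with \<open>\<Prod>\<^sub>i (k\<^sub>i choose \<alpha>\<^sub>i) / (N choose \<alpha>\<^sub>i)\<close>, for which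
  the Bernstein sum is exact.\<close>

lemma bernstein_limit_monom:
  fixes a :: "('d::finite \<Rightarrow> nat) \<Rightarrow> complex"
  assumes bound: "\<And>N. (\<Sum>k\<in>PiE UNIV (\<lambda>i. {..N}). cmod (mom a (\<lambda>i. bernp N (k i)))) \<le> C"
  shows "(\<lambda>N. \<Sum>k\<in>PiE UNIV (\<lambda>i. {..N}). of_real (\<Prod>i\<in>UNIV. (real (k i) / real N) ^ \<alpha> i) * mom a (\<lambda>i. bernp N (k i)))
      \<longlonglongrightarrow> a \<alpha>"
proof -
  define W where "W N k = mom a (\<lambda>i. bernp N (k i))" for N k
  define e where "e N = (\<Sum>i\<in>UNIV. real (\<alpha> i) * (real (\<alpha> i) / (real N - real (\<alpha> i))))" for N
  define S where "S N = (\<Sum>k\<in>PiE UNIV (\<lambda>i. {..N}). of_real (\<Prod>i\<in>UNIV. (real (k i) / real N) ^ \<alpha> i) * W N k)" for N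
  define m where "m = Max (range \<alpha>)"
  have m: "\<alpha> i \<le> m" for i unfolding m_def by simp
  have C: "0 \<le> C" using order_trans[OF sum_nonneg bound] by simp
  have diff: "norm (S N - a \<alpha>) \<le> e N * C" if N: "N > 2 * m" for N
  proof -
    define E where "E k = (\<Prod>i\<in>UNIV. real (k i choose \<alpha> i) / real (N choose \<alpha> i))" for k
    have \<alpha>N: "\<alpha> i \<le> N" "2 * \<alpha> i < N" for i using m[of i] N by auto
    have "a \<alpha> = mom a (\<lambda>i. \<Sum>k\<le>N. smult (real (k choose \<alpha> i) / real (N choose \<alpha> i)) (bernp N k))"
      using \<alpha>N by (simp add: sum_bernp mom_monom)
    also have "\<dots> = (\<Sum>k\<in>PiE UNIV (\<lambda>i. {..N}). of_real (E k) * W N k)"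
      by (simp add: mom_sum mom_smult E_def W_def)
    finally have a: "a \<alpha> = (\<Sum>k\<in>PiE UNIV (\<lambda>i. {..N}). of_real (E k) * W N k)" .
    have "norm (S N - a \<alpha>) = norm (\<Sum>k\<in>PiE UNIV (\<lambda>i. {..N}). of_real ((\<Prod>i\<in>UNIV. (real (k i) / real N) ^ \<alpha> i) - E k) * W N k)"
      unfolding a S_def by (simp add: sum_subtractf[symmetric] left_diff_distrib)
    also have "\<dots> \<le> (\<Sum>k\<in>PiE UNIV (\<lambda>i. {..N}). e N * norm (W N k))"
    proof (rule order_trans[OF norm_sum], rule sum_mono)
      fix k :: "'d \<Rightarrow> nat" assume k: "k \<in> PiE UNIV (\<lambda>i. {..N})"
      then have kN: "k i \<le> N" for i by (auto simp: PiE_def Pi_def)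
      have "\<bar>(\<Prod>i\<in>UNIV. (real (k i) / real N) ^ \<alpha> i) - E k\<bar>
          \<le> (\<Sum>i\<in>UNIV. \<bar>(real (k i) / real N) ^ \<alpha> i - real (k i choose \<alpha> i) / real (N choose \<alpha> i)\<bar>)"
        unfolding E_def real_norm_def[symmetric]
      proof (rule norm_prod_diff)
        fix i
        have "real (k i) / real N \<le> 1" using kN[of i] N by (simp add: divide_le_eq_1)
        then show "norm ((real (k i) / real N) ^ \<alpha> i) \<le> 1" by (simp add: power_le_one)
        show "norm (real (k i choose \<alpha> i) / real (N choose \<alpha> i)) \<le> 1"
          using power_choose_ratio(2)[OF \<alpha>N(2) kN, of i i] by simp
      qed
      also have "\<dots> \<le> e N"
        unfolding e_def by (intro sum_mono power_choose_ratio(1) \<alpha>N kN)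
      finally show "norm (of_real ((\<Prod>i\<in>UNIV. (real (k i) / real N) ^ \<alpha> i) - E k) * W N k) \<le> e N * norm (W N k)"
        unfolding norm_mult norm_of_real by (rule mult_right_mono) simp
    qed
    also have "\<dots> \<le> e N * C"
      unfolding sum_distrib_left[symmetric] W_def
    proof (rule mult_left_mono[OF bound])
      show "0 \<le> e N" unfolding e_def
      proof (intro sum_nonneg mult_nonneg_nonneg divide_nonneg_nonneg)
        show "0 \<le> real N - real (\<alpha> i)" for i using \<alpha>N(1)[of i] by simp
      qed auto
    qed
    finally show ?thesis .
  qed
  have "e \<longlonglongrightarrow> (\<Sum>i\<in>UNIV. real (\<alpha> i) * 0)"
    unfolding e_def
  proof (intro tendsto_sum tendsto_mult tendsto_const)
    show "(\<lambda>N. real (\<alpha> i) / (real N - real (\<alpha> i))) \<longlonglongrightarrow> 0" for i by real_asymp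
  qed
  then have "(\<lambda>N. e N * C) \<longlonglongrightarrow> 0" using tendsto_mult_right[of e 0 _ C] by simp
  moreover have "\<forall>\<^sub>F N in sequentially. norm (S N - a \<alpha>) \<le> e N * C"
    by (rule eventually_mono[OF eventually_gt_at_top[of "2 * m"]]) (rule diff)
  ultimately have "(\<lambda>N. S N - a \<alpha>) \<longlonglongrightarrow> 0"
    by (rule Lim_null_comparison[rotated])
  then show ?thesis unfolding S_def W_def by (simp add: LIM_zero_iff)
qed

text \<open>The numbers \<open>mom a (\<lambda>i. bernp N (k i))\<close> act as masses at the grid
  points k/N, with total variation bounded uniformly in \<open>N\<close>; expanding the
  \<open>P i\<close> reduces the claim to monomials.\<close>

lemma bernstein_limit:
  fixes a :: "('d::finite \<Rightarrow> nat) \<Rightarrow> complex"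
  assumes bound: "\<And>N. (\<Sum>k\<in>PiE UNIV (\<lambda>i. {..N}). cmod (mom a (\<lambda>i. bernp N (k i)))) \<le> C"
  shows "(\<lambda>N. \<Sum>k\<in>PiE UNIV (\<lambda>i. {..N}). of_real (\<Prod>i\<in>UNIV. poly (P i) (real (k i) / real N)) * mom a (\<lambda>i. bernp N (k i)))
      \<longlonglongrightarrow> mom a P"
proof -
  have "(\<Sum>k\<in>PiE UNIV (\<lambda>i. {..N}). of_real (\<Prod>i\<in>UNIV. poly (P i) (real (k i) / real N)) * mom a (\<lambda>i. bernp N (k i)))
      = (\<Sum>j\<in>PiE UNIV (\<lambda>i. {..degree (P i)}). of_real (\<Prod>i\<in>UNIV. coeff (P i) (j i)) *
          (\<Sum>k\<in>PiE UNIV (\<lambda>i. {..N}). of_real (\<Prod>i\<in>UNIV. (real (k i) / real N) ^ j i) * mom a (\<lambda>i. bernp N (k i))))" for N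
  proof -
    have "(\<Prod>i\<in>UNIV. poly (P i) (real (k i) / real N)) =
       (\<Sum>j\<in>PiE UNIV (\<lambda>i. {..degree (P i)}). (\<Prod>i\<in>UNIV. coeff (P i) (j i)) * (\<Prod>i\<in>UNIV. (real (k i) / real N) ^ j i))" for k
      unfolding poly_altdef by (subst prod_sum_PiE) (auto simp: prod.distrib)
    then show ?thesis
      by (simp add: sum_distrib_left sum_distrib_right) (subst sum.swap, simp add: mult_ac)
  qed
  then show ?thesis
    unfolding mom_def[of a P]
    by (simp only:) (intro tendsto_sum tendsto_mult tendsto_const bernstein_limit_monom[OF bound])
qed

text \<open>Since the Bernstein polynomials sum to 1, the total mass on the grid is the zeroth
  moment for every \<open>N\<close>.\<close>

lemma sum_mom_bernp: "(\<Sum>k\<in>PiE UNIV (\<lambda>i. {..N}). mom a (\<lambda>i. bernp N (k i))) = a (\<lambda>_. 0)"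
proof -
  have "a (\<lambda>_. 0) = mom a (\<lambda>i. \<Sum>k\<le>N. bernp N k)"
    using sum_bernp[of 0 N] mom_monom[of a "\<lambda>_. 0"] by simp
  then show ?thesis by (simp add: mom_sum)
qed

subsection \<open>A space-filling curve\<close>

text \<open>Schoenberg's function: continuous, of period 2, equal to 0 on [0, 1/3] and to 1 on
  [2/3, 1]. The clipped cosine has these plateaus because cos(pi/3) = 1/2 and cos(2 pi/3) =
  -1/2.\<close>

definition spread :: "real \<Rightarrow> real" where
  "spread x = max 0 (min 1 (1 / 2 - cos (pi * x)))"

lemma spread_bounds: "0 \<le> spread x" "spread x \<le> 1"
  by (auto simp: spread_def)

lemma continuous_on_spread: "continuous_on A (\<lambda>t. spread (c * t))"
  unfolding spread_def by (intro continuous_intros)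

lemma spread_add_even: "spread (2 * of_int n + x) = spread x"
proof -
  have "cos (pi * (2 * of_int n + x)) = cos (pi * x + 2 * pi * of_int n)" by (simp add: algebra_simps)
  also have "\<dots> = cos (pi * x)" by (rule cos_eq_periodic_intro[of _ _ n]) (simp add: algebra_simps)
  finally show ?thesis by (simp add: spread_def)
qed

lemma spread_0: assumes "0 \<le> x" "x \<le> 1 / 3" shows "spread x = 0"
proof -
  have "cos (pi / 3) \<le> cos (pi * x)" using assms by (intro cos_monotone_0_pi_le) auto
  then show ?thesis by (simp add: spread_def cos_60)
qed

lemma spread_1: assumes "2 / 3 \<le> x" "x \<le> 1" shows "spread x = 1"
proof -
  have "cos (pi * x) \<le> cos (2 * pi / 3)" using assms by (intro cos_monotone_0_pi_le) auto
  also have "\<dots> = - (1 / 2)" by (simp add: cos_120)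
  finally show ?thesis by (simp add: spread_def)
qed

text \<open>For 0-1 sequences \<open>b\<close> this is a point of the Cantor set, with ternary
  digits 0 and 2. Each tail of the digit sequence again gives a point outside the open middle third,
  the range in which \<open>spread\<close> interpolates.\<close>

definition ternary :: "(nat \<Rightarrow> nat) \<Rightarrow> real" where
  "ternary b = suminf (\<lambda>m. 2 * real (b m) / 3 ^ Suc m)"

lemma
  assumes "\<And>m. b m \<le> 1"
  shows summable_ternary: "summable (\<lambda>m. 2 * real (b m) / 3 ^ Suc m)"
    and ternary_bounds: "0 \<le> ternary b" "ternary b \<le> 1"
    and ternary_Suc: "3 * ternary b = 2 * real (b 0) + ternary (\<lambda>m. b (Suc m))"
proof -
  have geo: "(\<lambda>m. 2 / 3 ^ Suc m :: real) sums 1"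
    using sums_mult[OF geometric_sums[of "1 / 3 :: real"], of "2 / 3"] by (simp add: power_divide field_simps)
  have le: "2 * real (c m) / 3 ^ Suc m \<le> 2 / 3 ^ Suc m" if "\<And>m. c m \<le> 1" for c :: "nat \<Rightarrow> nat" and m
    using that[of m] by (intro divide_right_mono) auto
  have sm: "summable (\<lambda>m. 2 * real (c m) / 3 ^ Suc m)" if c: "\<And>m. c m \<le> 1" for c :: "nat \<Rightarrow> nat"
    by (rule summable_comparison_test'[OF sums_summable[OF geo], of 0]) (use le[OF c] in simp)
  show s: "summable (\<lambda>m. 2 * real (b m) / 3 ^ Suc m)" by (rule sm) (rule assms)
  show "0 \<le> ternary b" unfolding ternary_def by (rule suminf_nonneg[OF s]) simp
  show "ternary b \<le> 1"
    unfolding ternary_def using suminf_le[OF le[of b, OF assms] s sums_summable[OF geo]] sums_unique[OF geo] by simp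
  have "ternary b = 2 * real (b 0) / 3 + (suminf (\<lambda>m. 2 * real (b (Suc m)) / 3 ^ Suc (Suc m)))"
    unfolding ternary_def using suminf_split_head[OF s] by simp
  also have "(suminf (\<lambda>m. 2 * real (b (Suc m)) / 3 ^ Suc (Suc m))) = ternary (\<lambda>m. b (Suc m)) / 3"
    unfolding ternary_def
    using suminf_divide[OF sm[of "\<lambda>m. b (Suc m)"], of 3] assms by (simp add: field_simps)
  finally show "3 * ternary b = 2 * real (b 0) + ternary (\<lambda>m. b (Suc m))" by simp
qed

text \<open>Multiplication by 3^M moves the first \<open>M\<close> digits to the left of the point;
  these digits are 0 or 2, so they form an even integer, which the period 2 removes. The remainder
  lies in [0, 1/3] or [2/3, 1] according to its leading digit \<open>b M\<close>.\<close>

lemma spread_ternary: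
  assumes b: "\<And>m. b m \<le> 1"
  shows "spread (3 ^ M * ternary b) = real (b M)"
proof -
  have "\<exists>n::int. 3 ^ M * ternary b = 2 * of_int n + ternary (\<lambda>m. b (M + m))"
  proof (induction M)
    case 0
    show ?case by (rule exI[of _ 0]) simp
  next
    case (Suc M)
    then obtain n :: int where n: "3 ^ M * ternary b = 2 * of_int n + ternary (\<lambda>m. b (M + m))" by blast
    have "3 ^ Suc M * ternary b = 3 * (3 ^ M * ternary b)" by simp
    also have "\<dots> = 2 * (3 * of_int n) + 3 * ternary (\<lambda>m. b (M + m))" unfolding n by simp
    also have "\<dots> = 2 * of_int (3 * n + int (b M)) + ternary (\<lambda>m. b (Suc M + m))"
      using ternary_Suc[of "\<lambda>m. b (M + m)"] b by simp
    finally show ?case by blast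
  qed
  then have "spread (3 ^ M * ternary b) = spread (ternary (\<lambda>m. b (M + m)))"
    by (auto simp: spread_add_even)
  also have "\<dots> = real (b M)"
  proof -
    have *: "3 * ternary (\<lambda>m. b (M + m)) = 2 * real (b M) + ternary (\<lambda>m. b (M + Suc m))"
      using ternary_Suc[of "\<lambda>m. b (M + m)"] b by simp
    have **: "0 \<le> ternary (\<lambda>m. b (M + Suc m))" "ternary (\<lambda>m. b (M + Suc m)) \<le> 1"
      using ternary_bounds[of "\<lambda>m. b (M + Suc m)"] b by auto
    have "b M = 0 \<or> b M = 1" using b[of M] by linarith
    then show ?thesis
      using spread_0[of "ternary (\<lambda>m. b (M + m))"] spread_1[of "ternary (\<lambda>m. b (M + m))"] * ** by auto
  qed
  finally show ?thesis .
qed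

lemma binary_expansion:
  fixes y :: real
  assumes "0 \<le> y" "y \<le> 1"
  obtains b :: "nat \<Rightarrow> nat" where "\<And>k. b k \<le> 1" "(\<lambda>k. real (b k) / 2 ^ Suc k) sums y"
proof (cases "y = 1")
  case True
  \<comment> \<open>The floor digits used for the other values start from \<lfloor>y\<rfloor> = 0,
    which fails for \<open>y = 1\<close>; there all digits are 1.\<close>
  have "(\<lambda>k. real 1 / 2 ^ Suc k) sums y"
    using power_half_series True by (simp add: power_divide)
  then show thesis using that[of "\<lambda>_. 1"] by simp
next
  case False
  define b where "b k = nat (\<lfloor>2 ^ Suc k * y\<rfloor> - 2 * \<lfloor>2 ^ k * y\<rfloor>)" for k
  have ge: "2 * \<lfloor>2 ^ k * y\<rfloor> \<le> \<lfloor>2 ^ Suc k * y\<rfloor>" "\<lfloor>2 ^ Suc k * y\<rfloor> \<le> 2 * \<lfloor>2 ^ k * y\<rfloor> + 1" for k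
  proof -
    have "2 ^ Suc k * y = 2 * (2 ^ k * y)" by simp
    then show "2 * \<lfloor>2 ^ k * y\<rfloor> \<le> \<lfloor>2 ^ Suc k * y\<rfloor>" "\<lfloor>2 ^ Suc k * y\<rfloor> \<le> 2 * \<lfloor>2 ^ k * y\<rfloor> + 1"
      by linarith+
  qed
  have b1: "b k \<le> 1" for k using ge[of k] by (simp add: b_def)
  have part: "(\<Sum>k<n. real (b k) / 2 ^ Suc k) = of_int \<lfloor>2 ^ n * y\<rfloor> / 2 ^ n" for n
  proof (induction n)
    case 0
    have "\<lfloor>y\<rfloor> = 0" using assms False by linarith
    then show ?case by simp
  next
    case (Suc n)
    have "real (b n) = of_int \<lfloor>2 ^ Suc n * y\<rfloor> - 2 * of_int \<lfloor>2 ^ n * y\<rfloor>"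
      using ge(1)[of n] unfolding b_def by simp
    then show ?case using Suc by (simp add: field_simps)
  qed
  have "(\<lambda>n. of_int \<lfloor>2 ^ n * y\<rfloor> / 2 ^ n) \<longlonglongrightarrow> y"
  proof (rule tendsto_sandwich)
    have "(\<lambda>n. (1 / 2) ^ n) \<longlonglongrightarrow> (0::real)" by (rule LIMSEQ_power_zero) simp
    from tendsto_diff[OF tendsto_const this, of y]
    show "(\<lambda>n. y - (1 / 2) ^ n) \<longlonglongrightarrow> y" by simp
    show "\<forall>\<^sub>F n in sequentially. y - (1 / 2) ^ n \<le> of_int \<lfloor>2 ^ n * y\<rfloor> / 2 ^ n"
    proof (intro always_eventually allI)
      fix n
      have "2 ^ n * y - 1 \<le> of_int \<lfloor>2 ^ n * y\<rfloor>" by linarith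
      then have "(2 ^ n * y - 1) / 2 ^ n \<le> of_int \<lfloor>2 ^ n * y\<rfloor> / 2 ^ n" by (rule divide_right_mono) simp
      then show "y - (1 / 2) ^ n \<le> of_int \<lfloor>2 ^ n * y\<rfloor> / 2 ^ n" by (simp add: diff_divide_distrib power_divide)
    qed
    show "\<forall>\<^sub>F n in sequentially. of_int \<lfloor>2 ^ n * y\<rfloor> / 2 ^ n \<le> y"
    proof (intro always_eventually allI)
      fix n
      have "of_int \<lfloor>2 ^ n * y\<rfloor> \<le> 2 ^ n * y" by linarith
      then show "of_int \<lfloor>2 ^ n * y\<rfloor> / 2 ^ n \<le> y" by (simp add: field_simps)
    qed
  qed simp
  then have "(\<lambda>k. real (b k) / 2 ^ Suc k) sums y" unfolding sums_def part .
  then show thesis using that b1 by blast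
qed

text \<open>Schoenberg's curve: the digits of the \<open>i\<close>-th coordinate are read off at the positions
  congruent to the number of \<open>i\<close> modulo the dimension.\<close>

lemma space_filling_curve:
  obtains c :: "real \<Rightarrow> real ^ 'd::finite"
  where "continuous_on UNIV c" "\<And>t. c t \<in> cbox 0 1"
    "\<And>q. q \<in> cbox 0 1 \<Longrightarrow> \<exists>t. 0 \<le> t \<and> t \<le> 1 \<and> c t = q"
proof -
  define d where "d = CARD('d)"
  have d: "d > 0" by (simp add: d_def)
  obtain e :: "'d \<Rightarrow> nat" where e: "bij_betw e UNIV {0..<d}"
    using ex_bij_betw_finite_nat[of "UNIV :: 'd set"] unfolding d_def by auto
  define f where "f i k t = spread (3 ^ (d * k + e i) * t) / 2 ^ Suc k" for i k t
  define c where "c t = (\<chi> i. suminf (\<lambda>k. f i k t))" for t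
  have geo: "(\<lambda>k. 1 / 2 ^ Suc k :: real) sums 1"
    using power_half_series by (simp add: power_divide)
  have f0: "0 \<le> f i k t" and f1: "f i k t \<le> 1 / 2 ^ Suc k" for i k t
    unfolding f_def using spread_bounds by (auto intro: divide_right_mono)
  have sm: "summable (\<lambda>k. f i k t)" for i t
    by (rule summable_comparison_test'[OF sums_summable[OF geo], of 0]) (use f0 f1 in \<open>simp add: abs_of_nonneg del: power_Suc\<close>)
  show thesis
  proof (rule that)
    show "continuous_on UNIV c"
      unfolding c_def
    proof (rule continuous_on_vec_lambda)
      fix i
      have "uniform_limit UNIV (\<lambda>n t. \<Sum>k<n. f i k t) (\<lambda>t. suminf (\<lambda>k. f i k t)) sequentially"
        by (rule Weierstrass_m_test[OF _ sums_summable[OF geo]]) (use f0 f1 in \<open>simp add: abs_of_nonneg del: power_Suc\<close>)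
      then show "continuous_on UNIV (\<lambda>t. suminf (\<lambda>k. f i k t))"
        by (rule uniform_limit_theorem[rotated])
          (auto simp: f_def intro!: always_eventually continuous_on_sum continuous_on_divide continuous_on_spread)
    qed
    show "c t \<in> cbox 0 1" for t
      using suminf_nonneg[OF sm f0] suminf_le[OF _ sm sums_summable[OF geo]] f1 sums_unique[OF geo]
      by (auto simp: mem_box_cart c_def)
    show "\<exists>t. 0 \<le> t \<and> t \<le> 1 \<and> c t = q" if "q \<in> cbox 0 1" for q :: "real ^ 'd"
    proof -
      have "\<exists>b :: nat \<Rightarrow> nat. (\<forall>k. b k \<le> 1) \<and> (\<lambda>k. real (b k) / 2 ^ Suc k) sums (q $ i)" for i
        using \<open>q \<in> cbox 0 1\<close> binary_expansion[of "q $ i"] by (metis mem_box_cart(2) one_index zero_index)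
      then obtain b :: "'d \<Rightarrow> nat \<Rightarrow> nat" where b: "\<And>i k. b i k \<le> 1" "\<And>i. (\<lambda>k. real (b i k) / 2 ^ Suc k) sums (q $ i)"
        by metis
      \<comment> \<open>Interleaves the digits of all coordinates: position
        \<open>d * k + e i\<close> carries the \<open>k\<close>-th binary digit of coordinate
        \<open>i\<close>.\<close>
      define B where "B m = b (inv e (m mod d)) (m div d)" for m
      have B1: "B m \<le> 1" for m unfolding B_def by (rule b)
      have Be: "B (d * k + e i) = b i k" for i k
      proof -
        have "e i < d" using e by (auto simp: bij_betw_def)
        moreover have "inv e (e i) = i" using e by (intro inv_f_f) (auto simp: bij_betw_def)
        ultimately show ?thesis by (simp add: B_def)
      qed
      have "f i k (ternary B) = real (b i k) / 2 ^ Suc k" for i k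
        unfolding f_def spread_ternary[OF B1] Be ..
      then have "c (ternary B) = q"
        by (simp add: c_def vec_eq_iff sums_unique[OF b(2)])
      then show ?thesis using ternary_bounds[of B] B1 by (intro exI[of _ "ternary B"]) simp
    qed
  qed
qed

subsection \<open>The Hausdorff moment problem in several variables\<close>

text \<open>The Bernstein values are nonnegative masses on the grid with constant total
  \<open>W\<close>. Each normalised grid measure is carried to [0,1] by a right inverse of the
  curve, a subsequence converges weakly there, and the image of the limit under the curve, rescaled
  by \<open>W\<close>, has the moments given by \<open>bernstein_limit_monom\<close>.\<close>

lemma hausdorff_moment:
  fixes a :: "('d::finite \<Rightarrow> nat) \<Rightarrow> complex"
  assumes pos: "\<And>N k. (\<And>i. k i \<le> N) \<Longrightarrow> mom a (\<lambda>i. bernp N (k i)) \<in> \<real>\<^sub>\<ge>\<^sub>0"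
  obtains M :: "(real ^ 'd) measure" where "sets M = sets borel" "finite_measure M" "AE t in M. t \<in> cbox 0 1"
    "\<And>\<alpha>. complex_of_real (\<integral>t. (\<Prod>i\<in>UNIV. (t $ i) ^ \<alpha> i) \<partial>M) = a \<alpha>"
proof -
  define w where "w N k = Re (mom a (\<lambda>i. bernp N (k i)))" for N k
  have w: "mom a (\<lambda>i. bernp N (k i)) = of_real (w N k)" "w N k \<ge> 0" if "k \<in> PiE UNIV (\<lambda>i. {..N})" for N k
    using pos[of k N] that by (auto simp: w_def complex_nonneg_Reals_iff complex_eq_iff PiE_def Pi_def)
  define W where "W = Re (a (\<lambda>_. 0))"
  have sum_w: "(\<Sum>k\<in>PiE UNIV (\<lambda>i. {..N}). w N k) = W" for N
    unfolding W_def sum_mom_bernp[of a N, symmetric] by (simp add: w_def)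
  have bound: "(\<Sum>k\<in>PiE UNIV (\<lambda>i. {..N}). cmod (mom a (\<lambda>i. bernp N (k i)))) \<le> W" for N
  proof -
    have "(\<Sum>k\<in>PiE UNIV (\<lambda>i. {..N}). cmod (mom a (\<lambda>i. bernp N (k i)))) = (\<Sum>k\<in>PiE UNIV (\<lambda>i. {..N}). w N k)"
      by (intro sum.cong refl) (simp add: w)
    then show ?thesis by (simp add: sum_w)
  qed
  have lim: "(\<lambda>N. \<Sum>k\<in>PiE UNIV (\<lambda>i. {..N}). (\<Prod>i\<in>UNIV. (real (k i) / real N) ^ \<alpha> i) * w N k) \<longlonglongrightarrow> Re (a \<alpha>)"
    and limIm: "Im (a \<alpha>) = 0" for \<alpha>
  proof -
    have eq: "(\<Sum>k\<in>PiE UNIV (\<lambda>i. {..N}). of_real (\<Prod>i\<in>UNIV. (real (k i) / real N) ^ \<alpha> i) * mom a (\<lambda>i. bernp N (k i)))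
        = complex_of_real (\<Sum>k\<in>PiE UNIV (\<lambda>i. {..N}). (\<Prod>i\<in>UNIV. (real (k i) / real N) ^ \<alpha> i) * w N k)" for N
      unfolding of_real_sum of_real_mult by (intro sum.cong refl) (simp add: w)
    note * = bernstein_limit_monom[OF bound, of \<alpha>, unfolded eq]
    from tendsto_Re[OF *] show "(\<lambda>N. \<Sum>k\<in>PiE UNIV (\<lambda>i. {..N}). (\<Prod>i\<in>UNIV. (real (k i) / real N) ^ \<alpha> i) * w N k) \<longlonglongrightarrow> Re (a \<alpha>)"
      by (simp only: Re_complex_of_real)
    from tendsto_Im[OF *] show "Im (a \<alpha>) = 0" by (simp only: Im_complex_of_real LIMSEQ_const_iff)
  qed
  have W0: "W \<ge> 0" using sum_w[of 0] sum_nonneg[of "PiE UNIV (\<lambda>i. {..0})" "w 0"] w(2) by auto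
  show thesis
  \<comment> \<open>Division by \<open>W\<close> is what produces probability measures, so the zero
    functional is treated apart.\<close>
  proof (cases "W = 0")
    case True
    have w0: "w N k = 0" if "k \<in> PiE UNIV (\<lambda>i. {..N})" for N k
      using sum_w[of N] w(2) that True sum_nonneg_eq_0_iff[of "PiE UNIV (\<lambda>i. {..N})" "w N"] by auto
    have "a \<alpha> = 0" for \<alpha>
    proof -
      have "(\<Sum>k\<in>PiE UNIV (\<lambda>i. {..N}). (\<Prod>i\<in>UNIV. (real (k i) / real N) ^ \<alpha> i) * w N k) = 0" for N
        by (rule sum.neutral) (simp add: w0)
      then have "Re (a \<alpha>) = 0" using lim[of \<alpha>] by (simp add: LIMSEQ_const_iff)
      with limIm show ?thesis by (simp add: complex_eq_iff)
    qed
    then show thesis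
      by (intro that[of "null_measure borel"]) (auto intro!: finite_measureI simp: AE_iff_null null_sets_def)
  next
    case False
    then have W: "W > 0" using W0 by simp
    obtain c :: "real \<Rightarrow> real ^ 'd" where c: "continuous_on UNIV c" "\<And>t. c t \<in> cbox 0 1"
      "\<And>q. q \<in> cbox 0 1 \<Longrightarrow> \<exists>t. 0 \<le> t \<and> t \<le> 1 \<and> c t = q"
      using space_filling_curve by blast
    \<comment> \<open>A section picked by choice, without any regularity: it is applied only to
      finite point measures, on which every function is measurable.\<close>
    define l where "l q = (SOME t. 0 \<le> t \<and> t \<le> 1 \<and> c t = q)" for q
    have l: "0 \<le> l q" "l q \<le> 1" "c (l q) = q" if "q \<in> cbox 0 1" for q
      using someI_ex[OF c(3)[OF that]] unfolding l_def by auto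
    define box where "box N = PiE (UNIV :: 'd set) (\<lambda>i. {..N :: nat})" for N
    define pt where "pt N k = l (\<chi> i. real (k i) / real N)" for N and k :: "'d \<Rightarrow> nat"
    have cube: "(\<chi> i. real (k i) / real N) \<in> cbox 0 1" if "k \<in> box N" for N k
    proof -
      have "real (k i) / real N \<le> 1" for i
        using that by (cases "N = 0") (auto simp: box_def PiE_def Pi_def divide_le_eq_1)
      then show ?thesis by (auto simp: mem_box_cart)
    qed
    define P where "P N = point_measure (box N) (\<lambda>k. ennreal (w N k / W))" for N
    have P: "prob_space (P N)" for N
    proof
      have "emeasure (P N) (space (P N)) = (\<Sum>k\<in>box N. ennreal (w N k / W))"
        unfolding P_def by (subst emeasure_point_measure_finite) (auto simp: space_point_measure box_def)
      also have "\<dots> = ennreal ((\<Sum>k\<in>box N. w N k) / W)"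
        using w W by (subst sum_ennreal) (auto simp: box_def sum_divide_distrib)
      finally show "emeasure (P N) (space (P N)) = 1" using W by (simp add: box_def sum_w)
    qed
    have [measurable]: "g \<in> measurable (P N) borel" for N and g :: "_ \<Rightarrow> real"
      by (simp add: P_def measurable_point_measure_eq1)
    define \<mu> where "\<mu> N = distr (P N) borel (pt N)" for N
    have \<mu>: "real_distribution (\<mu> N)" for N
      unfolding \<mu>_def by (rule prob_space.real_distribution_distr[OF P]) simp
    have "tight \<mu>"
      unfolding tight_def
    proof (intro conjI allI impI)
      fix \<epsilon> :: real assume \<epsilon>: "\<epsilon> > 0"
      \<comment> \<open>All mass sits in [0,1], which this half-open interval contains.\<close>
      have "measure (\<mu> N) {-1<..2} = 1" for N
      proof -
        have "pt N -` {-1<..2} \<inter> space (P N) = space (P N)"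
          using l cube by (fastforce simp: pt_def P_def space_point_measure)
        then have "measure (\<mu> N) {-1<..2} = measure (P N) (space (P N))"
          unfolding \<mu>_def by (subst measure_distr) auto
        then show ?thesis using prob_space.prob_space[OF P] by simp
      qed
      then show "\<exists>a b. a < b \<and> (\<forall>n. 1 - \<epsilon> < measure (\<mu> n) {a<..b})"
        using \<epsilon> by (intro exI[of _ "-1"] exI[of _ 2]) simp
    qed (rule \<mu>)
    then obtain r \<nu> where r: "strict_mono r" and \<nu>: "real_distribution \<nu>" and conv: "weak_conv_m (\<mu> \<circ> id \<circ> r) \<nu>"
      using tight_imp_convergent_subsubsequence[of \<mu> id] by (auto simp: strict_mono_id)
    interpret \<nu>: real_distribution \<nu> by (rule \<nu>)
    have c_meas [measurable]: "c \<in> borel_measurable borel"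
      by (rule borel_measurable_continuous_onI[OF c(1)])
    have mon_meas: "(\<lambda>t :: real ^ 'd. \<Prod>i\<in>UNIV. (t $ i) ^ \<alpha> i) \<in> borel_measurable borel" for \<alpha>
      by (intro borel_measurable_continuous_onI continuous_intros)
    have mon: "(\<integral>t. (\<Prod>i\<in>UNIV. (c t $ i) ^ \<alpha> i) \<partial>\<nu>) = Re (a \<alpha>) / W" for \<alpha>
    proof -
      \<comment> \<open>A monomial composed with the curve: bounded and continuous on the line, so
        weak convergence applies, and at the chosen preimages it takes the values of the monomial on
        the grid.\<close>
      define f where "f t = (\<Prod>i\<in>UNIV. (c t $ i) ^ \<alpha> i)" for t
      have fc: "continuous_on UNIV f" unfolding f_def by (intro continuous_intros c)
      have cb: "0 \<le> c t $ i" "c t $ i \<le> 1" for t i using c(2)[of t] by (auto simp: mem_box_cart)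
      have fb: "norm (f t) \<le> 1" for t
        unfolding f_def real_norm_def abs_prod by (rule prod_le_1) (use cb in \<open>auto simp: power_le_one\<close>)
      have "(\<lambda>n. integral\<^sup>L ((\<mu> \<circ> id \<circ> r) n) f) \<longlonglongrightarrow> integral\<^sup>L \<nu> f"
        by (rule weak_conv_imp_integral_bdd_continuous_conv[OF _ \<nu> conv])
          (use \<mu> fb fc in \<open>auto simp: continuous_on_eq_continuous_at\<close>)
      moreover have "integral\<^sup>L ((\<mu> \<circ> id \<circ> r) n) f =
          (\<Sum>k\<in>box (r n). (\<Prod>i\<in>UNIV. (real (k i) / real (r n)) ^ \<alpha> i) * w (r n) k) / W" for n
      proof -
        have "integral\<^sup>L (\<mu> N) f = (\<Sum>k\<in>box N. (\<Prod>i\<in>UNIV. (real (k i) / real N) ^ \<alpha> i) * w N k) / W" for N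
        proof -
          have "integral\<^sup>L (\<mu> N) f = integral\<^sup>L (P N) (\<lambda>k. f (pt N k))"
            unfolding \<mu>_def using borel_measurable_continuous_onI[OF fc] by (intro integral_distr) auto
          also have "\<dots> = (\<Sum>k\<in>box N. (w N k / W) *\<^sub>R f (pt N k))"
            unfolding P_def using w W by (intro lebesgue_integral_point_measure_finite) (auto simp: box_def)
          also have "\<dots> = (\<Sum>k\<in>box N. (\<Prod>i\<in>UNIV. (real (k i) / real N) ^ \<alpha> i) * w N k / W)"
            by (intro sum.cong refl) (simp add: f_def pt_def l cube)
          finally show ?thesis by (simp add: sum_divide_distrib)
        qed
        then show ?thesis by simp
      qed
      moreover have "(\<lambda>n. (\<Sum>k\<in>box (r n). (\<Prod>i\<in>UNIV. (real (k i) / real (r n)) ^ \<alpha> i) * w (r n) k) / W) \<longlonglongrightarrow> Re (a \<alpha>) / W"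
        using LIMSEQ_subseq_LIMSEQ[OF lim[of \<alpha>] r] W
        by (intro tendsto_divide tendsto_const) (auto simp: box_def o_def)
      ultimately have "integral\<^sup>L \<nu> f = Re (a \<alpha>) / W" by (simp add: LIMSEQ_unique)
      then show ?thesis unfolding f_def .
    qed
    define M where "M = density (distr \<nu> borel c) (\<lambda>_. ennreal W)"
    show thesis
    proof (rule that)
      show "sets M = sets borel" by (simp add: M_def)
      show "finite_measure M"
      proof
        have "emeasure (distr \<nu> borel c) UNIV = 1"
          by (subst emeasure_distr) (auto simp: \<nu>.emeasure_space_1[simplified])
        then have "emeasure M (space M) = ennreal W"
          unfolding M_def by (simp add: emeasure_density)
        then show "emeasure M (space M) \<noteq> \<infinity>" by simp
      qed
      show "AE t in M. t \<in> cbox 0 1"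
        unfolding M_def by (subst AE_density) (auto simp: AE_distr_iff c(2))
      show "complex_of_real (\<integral>t. (\<Prod>i\<in>UNIV. (t $ i) ^ \<alpha> i) \<partial>M) = a \<alpha>" for \<alpha>
      proof -
        have "(\<integral>t. (\<Prod>i\<in>UNIV. (t $ i) ^ \<alpha> i) \<partial>M) = (\<integral>t. W * (\<Prod>i\<in>UNIV. (t $ i) ^ \<alpha> i) \<partial>distr \<nu> borel c)"
          unfolding M_def using mon_meas W0 by (subst integral_density) auto
        also have "\<dots> = W * (\<integral>t. (\<Prod>i\<in>UNIV. (c t $ i) ^ \<alpha> i) \<partial>\<nu>)"
          using mon_meas by (subst integral_distr) auto
        also have "\<dots> = Re (a \<alpha>)" using W by (simp add: mon)
        finally show ?thesis using limIm by (simp add: complex_eq_iff)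
      qed
    qed
  qed
qed

subsection \<open>Powers of commuting tuples\<close>

text \<open>\<open>tuple_power\<close> over a set \<open>A\<close> of coordinates and with plain
  functions as exponents, which opens the way to induction on the coordinates and to arithmetic of
  exponents.\<close>

definition fpow :: "'n set \<Rightarrow> ('n \<Rightarrow> 'a \<Rightarrow> 'a) \<Rightarrow> ('n \<Rightarrow> nat) \<Rightarrow> 'a \<Rightarrow> 'a" where
  "fpow A T \<alpha> = Finite_Set.fold (\<lambda>i g. (T i ^^ \<alpha> i) \<circ> g) id A"

abbreviation mpow :: "('n::finite \<Rightarrow> 'a \<Rightarrow> 'a) \<Rightarrow> ('n \<Rightarrow> nat) \<Rightarrow> 'a \<Rightarrow> 'a" where
  "mpow \<equiv> fpow UNIV"

lemma tuple_power_eq: "tuple_power T \<alpha> = mpow T (Poly_Mapping.lookup \<alpha>)"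
  by (simp add: tuple_power_def fpow_def)

lemma funpow_commute:
  assumes "\<And>x. f (g x) = g (f x)"
  shows "(f ^^ m) ((g ^^ n) x) = (g ^^ n) ((f ^^ m) x)"
proof -
  have 1: "f ((g ^^ n) x) = (g ^^ n) (f x)" for x
    by (induction n) (auto simp: assms)
  show ?thesis by (induction m) (auto simp: 1)
qed

locale commuting =
  fixes T :: "'n::finite \<Rightarrow> 'a \<Rightarrow> 'a"
  assumes commute: "T i (T j x) = T j (T i x)"
begin

lemma fpow_empty [simp]: "fpow {} T \<alpha> = id"
  by (simp add: fpow_def)

lemma fpow_insert:
  assumes "finite A" "i \<notin> A"
  shows "fpow (insert i A) T \<alpha> x = (T i ^^ \<alpha> i) (fpow A T \<alpha> x)"
proof -
  interpret comp_fun_commute "\<lambda>i g. (T i ^^ \<alpha> i) \<circ> g"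
    by standard (auto simp: fun_eq_iff intro: funpow_commute commute)
  show ?thesis using assms by (simp add: fpow_def)
qed

lemma commute_funpow: "(T i ^^ m) ((T j ^^ n) x) = (T j ^^ n) ((T i ^^ m) x)"
  by (rule funpow_commute) (rule commute)

lemma fpow_funpow: "finite A \<Longrightarrow> fpow A T \<alpha> ((T i ^^ m) x) = (T i ^^ m) (fpow A T \<alpha> x)"
  by (induction A arbitrary: x rule: finite_induct) (auto simp: fpow_insert commute_funpow)

lemma fpow_add:
  "finite A \<Longrightarrow> fpow A T (\<lambda>i. \<alpha> i + \<beta> i) x = fpow A T \<alpha> (fpow A T \<beta> x)"
  by (induction A arbitrary: x rule: finite_induct) (auto simp: fpow_insert fpow_funpow funpow_add intro: commute_funpow)

lemma mpow_add: "mpow T (\<lambda>i. \<alpha> i + \<beta> i) x = mpow T \<alpha> (mpow T \<beta> x)"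
  by (rule fpow_add) simp

lemma mpow_commute: "mpow T \<alpha> (mpow T \<beta> x) = mpow T \<beta> (mpow T \<alpha> x)"
  unfolding mpow_add[symmetric] by (simp add: add.commute)

lemma fpow_zero: "finite A \<Longrightarrow> (\<And>i. i \<in> A \<Longrightarrow> \<alpha> i = 0) \<Longrightarrow> fpow A T \<alpha> x = x"
  by (induction A rule: finite_induct) (auto simp: fpow_insert)

lemma mpow_zero [simp]: "mpow T (\<lambda>_. 0) x = x"
  by (rule fpow_zero) auto

lemma mpow_single: "mpow T (\<lambda>j. if j = i then m else 0) x = (T i ^^ m) x"
proof -
  have "UNIV = insert i (UNIV - {i})" by auto
  then have "mpow T (\<lambda>j. if j = i then m else 0) x
      = fpow (insert i (UNIV - {i})) T (\<lambda>j. if j = i then m else 0) x" by simp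
  also have "\<dots> = (T i ^^ m) x"
    using fpow_zero[of "UNIV - {i}" "\<lambda>j. if j = i then m else 0" x] by (subst fpow_insert) auto
  finally show ?thesis .
qed

end

lemma bounded_clinear_fpow:
  assumes "commuting T" "\<And>i. bounded_clinear (T i)" "finite A"
  shows "bounded_clinear (fpow A T \<alpha> :: 'a::complex_hilbert \<Rightarrow> 'a)"
  using assms(3)
proof (induction A rule: finite_induct)
  case empty
  then show ?case by (simp add: commuting.fpow_empty[OF assms(1)] id_def bounded_clinear_id)
next
  case (insert i A)
  have "fpow (insert i A) T \<alpha> = (\<lambda>x. (T i ^^ \<alpha> i) (fpow A T \<alpha> x))"
    using commuting.fpow_insert[OF assms(1)] insert by (simp add: fun_eq_iff)
  then show ?case
    using bounded_clinear_compose[OF bounded_clinear_funpow[OF assms(2)] insert.IH] by simp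
qed

lemma cinner_fpow_adj:
  fixes T T' :: "'n::finite \<Rightarrow> 'a::complex_hilbert \<Rightarrow> 'a"
  assumes "commuting T" "commuting T'" and adj: "\<And>i x y. cinner (T' i x) y = cinner x (T i y)" and "finite A"
  shows "cinner (fpow A T' \<alpha> x) y = cinner x (fpow A T \<alpha> y)"
  using assms(4)
proof (induction A arbitrary: x y rule: finite_induct)
  case empty
  then show ?case by (simp add: commuting.fpow_empty[OF assms(1)] commuting.fpow_empty[OF assms(2)])
next
  case (insert i A)
  have pow: "cinner ((T' i ^^ m) x) y = cinner x ((T i ^^ m) y)" for m x y
    by (induction m arbitrary: x y) (auto simp: adj funpow_swap1)
  show ?case
    using insert by (simp add: commuting.fpow_insert[OF assms(1)] commuting.fpow_insert[OF assms(2)] pow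
        commuting.fpow_funpow[OF assms(1)])
qed

lemma adj_commute:
  fixes S :: "'n \<Rightarrow> 'a::complex_hilbert \<Rightarrow> 'a"
  assumes "\<And>i. bounded_clinear (S i)" "\<And>i j x. S i (S j x) = S j (S i x)"
  shows "adj_on UNIV (S i) (adj_on UNIV (S j) x) = adj_on UNIV (S j) (adj_on UNIV (S i) x)"
  by (rule cinner_eqI') (simp add: adj_on_UNIV(2)[OF assms(1), symmetric] assms(2)[of i j])

subsection \<open>The hereditary calculus as a sesquilinear form\<close>

text \<open>The form \<open>cinner (hereditary q S x) y\<close> with the powers of the adjoints
  moved to the second argument: no adjoint remains, and additivity in \<open>q\<close> only takes a
  common set of keys.\<close>

definition hform :: "('n::finite \<Rightarrow> 'a::complex_hilbert \<Rightarrow> 'a) \<Rightarrow> 'n hpoly \<Rightarrow> 'a \<Rightarrow> 'a \<Rightarrow> complex" where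
  "hform S q x y = (\<Sum>ab\<in>Poly_Mapping.keys q. of_real (Poly_Mapping.lookup q ab) *
     cinner (mpow S (Poly_Mapping.lookup (fst ab)) x) (mpow S (Poly_Mapping.lookup (snd ab)) y))"

lemma hform_superset:
  assumes "finite A" "Poly_Mapping.keys q \<subseteq> A"
  shows "hform S q x y = (\<Sum>ab\<in>A. of_real (Poly_Mapping.lookup q ab) *
     cinner (mpow S (Poly_Mapping.lookup (fst ab)) x) (mpow S (Poly_Mapping.lookup (snd ab)) y))"
  unfolding hform_def using assms by (intro sum.mono_neutral_left) (auto simp: in_keys_iff)

lemma hform_add: "hform S (q + r) x y = hform S q x y + hform S r x y"
proof -
  define A where "A = Poly_Mapping.keys q \<union> Poly_Mapping.keys r"
  have "Poly_Mapping.keys (q + r) \<subseteq> A" unfolding A_def by (rule Poly_Mapping.keys_add)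
  then show ?thesis
    by (simp add: hform_superset[of A] A_def lookup_add distrib_right sum.distrib)
qed

lemma hform_diff: "hform S (q - r) x y = hform S q x y - hform S r x y"
  using hform_add[of S "q - r" r x y] by simp

lemma hform_sum: "hform S (\<Sum>i\<in>I. q i) x y = (\<Sum>i\<in>I. hform S (q i) x y)"
  by (induction I rule: infinite_finite_induct) (auto simp: hform_add, simp_all add: hform_def)

lemma hform_single:
  "hform S (Poly_Mapping.single (\<alpha>, \<beta>) c) x y =
     of_real c * cinner (mpow S (Poly_Mapping.lookup \<alpha>) x) (mpow S (Poly_Mapping.lookup \<beta>) y)"
  by (subst hform_superset[of "{(\<alpha>, \<beta>)}"]) auto

context
  fixes S :: "'n::finite \<Rightarrow> 'a::complex_hilbert \<Rightarrow> 'a"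
  assumes bounded: "\<And>i. bounded_clinear (S i)" and comm: "\<And>i j x. S i (S j x) = S j (S i x)"
begin

lemma commuting_S: "commuting S"
  by standard (rule comm)

lemma commuting_adj: "commuting (\<lambda>i. adj_on UNIV (S i))"
  by standard (rule adj_commute[OF bounded comm])

lemma cinner_hereditary: "cinner (hereditary q S x) y = hform S q x y"
proof -
  have adj: "cinner (adj_on UNIV (S i) x) y = cinner x (S i y)" for i x y
    unfolding cinner_commute[of "adj_on UNIV (S i) x" y] adj_on_UNIV(2)[OF bounded, symmetric]
    by (rule cinner_commute[symmetric])
  have "cinner (mpow (\<lambda>i. adj_on UNIV (S i)) \<beta> u) y = cinner u (mpow S \<beta> y)" for \<beta> u
    by (rule cinner_fpow_adj[OF commuting_S commuting_adj adj finite_class.finite_UNIV])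
  then show ?thesis
    by (simp add: hereditary_def hform_def cinner_sum_left case_prod_beta scaleR_eq_scaleC
        cinner_scaleC_left tuple_power_eq)
qed

lemma bounded_clinear_hereditary: "bounded_clinear (hereditary q S)"
proof -
  have "hereditary q S = (\<lambda>x. \<Sum>ab\<in>Poly_Mapping.keys q. Poly_Mapping.lookup q ab *\<^sub>R
        tuple_power (\<lambda>i. adj_on UNIV (S i)) (snd ab) (tuple_power S (fst ab) x))"
    by (simp add: hereditary_def fun_eq_iff case_prod_beta)
  moreover have "bounded_clinear (\<lambda>x. c *\<^sub>R tuple_power (\<lambda>i. adj_on UNIV (S i)) \<beta> (tuple_power S \<alpha> x))" for c \<alpha> \<beta>
    unfolding tuple_power_eq
    by (intro bounded_clinear_scaleR_right
        bounded_clinear_compose[OF bounded_clinear_fpow[OF commuting_adj adj_on_UNIV(1)[OF bounded]]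
          bounded_clinear_fpow[OF commuting_S bounded]] finite_class.finite_UNIV)
  ultimately show ?thesis
    by (simp only: bounded_clinear_setsum)
qed

lemma positive_op_hereditary: "positive_op (hereditary q S) \<longleftrightarrow> (\<forall>x. hform S q x x \<in> \<real>\<^sub>\<ge>\<^sub>0)"
  unfolding positive_op_def bounded_clinear_iff_bounded_op_on
  by (simp add: bounded_clinear_hereditary cinner_hereditary)

lemma hereditary_eq_0_iff: "hereditary q S = (\<lambda>x. 0) \<longleftrightarrow> (\<forall>x y. hform S q x y = 0)"
proof
  assume "\<forall>x y. hform S q x y = 0"
  then show "hereditary q S = (\<lambda>x. 0)"
    by (intro ext cinner_eqI) (simp add: cinner_hereditary)
qed (simp add: cinner_hereditary[symmetric])

text \<open>\<open>v j\<close> behaves like j times \<open>v 1\<close>. The exponent map is kept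
  abstract because it stands for the exponents of z_i, of w_i and of the product z_i w_i.\<close>

lemma power_single:
  fixes v :: "nat \<Rightarrow> 'b::comm_monoid_add"
  assumes "v 0 = 0" "\<And>j. v (Suc j) = v 1 + v j"
  shows "Poly_Mapping.single (v 1) (a::real) ^ j = Poly_Mapping.single (v j) (a ^ j)"
proof (induction j)
  case 0
  show ?case by (simp add: assms(1))
next
  case (Suc j)
  have "Poly_Mapping.single (v 1) a ^ Suc j = Poly_Mapping.single (v 1) a * Poly_Mapping.single (v j) (a ^ j)"
    by (simp only: power_Suc Suc)
  also have "\<dots> = Poly_Mapping.single (v (Suc j)) (a ^ Suc j)"
    unfolding mult_single assms(2)[of j] by simp
  finally show ?case .
qed

lemma single_Suc: "Poly_Mapping.single i (Suc j) = Poly_Mapping.single i 1 + Poly_Mapping.single i j"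
  unfolding single_add[symmetric] by simp

lemma zvar_wvar_power:
  fixes i :: 'n
  shows "zvar i ^ m * wvar i ^ m = Poly_Mapping.single (Poly_Mapping.single i m, Poly_Mapping.single i m) (1::real)"
proof -
  have "zvar i ^ m = Poly_Mapping.single (Poly_Mapping.single i m, 0) (1::real)"
    proof -
    have "Poly_Mapping.single ((\<lambda>m. (Poly_Mapping.single i m, 0) :: ('n \<Rightarrow>\<^sub>0 nat) \<times> ('n \<Rightarrow>\<^sub>0 nat)) 1) (1::real) ^ m = Poly_Mapping.single ((\<lambda>m. (Poly_Mapping.single i m, 0) :: ('n \<Rightarrow>\<^sub>0 nat) \<times> ('n \<Rightarrow>\<^sub>0 nat)) m) (1 ^ m)"
      by (rule power_single) (simp_all only: add_Pair single_Suc add_0_left single_zero zero_prod_def)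
    then show ?thesis by (simp only: zvar_def power_one)
  qed
  moreover have "wvar i ^ m = Poly_Mapping.single (0, Poly_Mapping.single i m) (1::real)"
    proof -
    have "Poly_Mapping.single ((\<lambda>m. (0, Poly_Mapping.single i m) :: ('n \<Rightarrow>\<^sub>0 nat) \<times> ('n \<Rightarrow>\<^sub>0 nat)) 1) (1::real) ^ m = Poly_Mapping.single ((\<lambda>m. (0, Poly_Mapping.single i m) :: ('n \<Rightarrow>\<^sub>0 nat) \<times> ('n \<Rightarrow>\<^sub>0 nat)) m) (1 ^ m)"
      by (rule power_single) (simp_all only: add_Pair single_Suc add_0_left single_zero zero_prod_def)
    then show ?thesis by (simp only: wvar_def power_one)
  qed
  ultimately show ?thesis by (simp add: mult_single)
qed

lemma lookup_single_fun: "Poly_Mapping.lookup (Poly_Mapping.single i m) = (\<lambda>j. if j = i then m else 0)"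
  by (auto simp: lookup_single fun_eq_iff when_def)

lemma hform_one: "hform S 1 x y = cinner x y"
  using hform_single[of S 0 0 1 x y] by (simp add: zero_prod_def[symmetric] commuting.mpow_zero[OF commuting_S] lookup_zero[abs_def])

lemma hform_boundary:
  "hform S (1 - (\<Sum>i\<in>UNIV. \<Sum>j=1..m i. zvar i ^ p i j * wvar i ^ p i j)) x y =
     cinner x y - (\<Sum>i\<in>UNIV. \<Sum>j=1..m i. cinner ((S i ^^ p i j) x) ((S i ^^ p i j) y))"
  by (simp add: hform_diff hform_one hform_sum zvar_wvar_power hform_single lookup_single_fun
      commuting.mpow_single[OF commuting_S])

text \<open>If \<open>S\<close> is multiplication by z, these are moments in the variables t_i =
  |z_i|^2; equal exponents on both sides are the reason why only the moduli enter.\<close>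

definition pw :: "'a \<Rightarrow> 'a \<Rightarrow> ('n \<Rightarrow> nat) \<Rightarrow> complex" where
  "pw x y \<alpha> = cinner (mpow S \<alpha> x) (mpow S \<alpha> y)"

lemma one_minus_power: "[:1, -1:] ^ k = (\<Sum>j\<le>k. smult ((-1) ^ j * real (k choose j)) (monom 1 j))"
proof -
  have "[:1, -1:] ^ k = (monom (-1) 1 + 1 :: real poly) ^ k"
    by (simp add: monom_altdef one_pCons)
  also have "\<dots> = (\<Sum>j\<le>k. of_nat (k choose j) * monom (-1) 1 ^ j * 1 ^ (k - j))"
    by (rule binomial_ring)
  also have "\<dots> = (\<Sum>j\<le>k. smult ((-1) ^ j * real (k choose j)) (monom 1 j))"
    by (intro sum.cong refl) (simp add: monom_power of_nat_poly smult_monom mult_monom)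
  finally show ?thesis .
qed

text \<open>Every monomial of the product has the same exponent in z and in w, so the product is a
  polynomial in the t_i = z_i w_i. This turns (a) into complete monotonicity of the moment
  arrays.\<close>

lemma hform_prod:
  "hform S (\<Prod>i\<in>UNIV. (1 - zvar i * wvar i) ^ k i) x y = mom (pw x y) (\<lambda>i. [:1, -1:] ^ k i)"
proof -
  define m where "m i j = (Poly_Mapping.single i j, Poly_Mapping.single i j :: 'n \<Rightarrow>\<^sub>0 nat)" for i :: 'n and j :: nat
  define c where "c k j = (-1) ^ j * real (k choose j)" for k j :: nat
  have m_mult: "Poly_Mapping.single (m i 1) (a::real) ^ j = Poly_Mapping.single (m i j) (a ^ j)" for i j a
    by (rule power_single) (simp_all only: m_def add_Pair single_Suc single_zero zero_prod_def)
  have of_nat_mult: "of_nat n * Poly_Mapping.single v (a::real) = Poly_Mapping.single v (of_nat n * a)"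
    for n and v :: "('n \<Rightarrow>\<^sub>0 nat) \<times> ('n \<Rightarrow>\<^sub>0 nat)" and a
    by (simp add: single_of_nat[symmetric] mult_single del: single_of_nat)
  have "(1 - zvar i * wvar i) ^ k = (\<Sum>j\<le>k. Poly_Mapping.single (m i j) (c k j))" for i :: 'n and k
  proof -
    have "(1 - zvar i * wvar i) = Poly_Mapping.single (m i 1) (-1::real) + 1"
      using zvar_wvar_power[of i 1] by (simp add: m_def single_uminus)
    then have "(1 - zvar i * wvar i) ^ k = (Poly_Mapping.single (m i 1) (-1::real) + 1) ^ k" by (rule arg_cong)
    also have "\<dots> = (\<Sum>j\<le>k. of_nat (k choose j) * Poly_Mapping.single (m i 1) (-1::real) ^ j * 1 ^ (k - j))"
      by (rule binomial_ring)
    also have "\<dots> = (\<Sum>j\<le>k. Poly_Mapping.single (m i j) (c k j))"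
      by (simp only: m_mult of_nat_mult power_one mult_1_right mult_1_left c_def mult.commute)
    finally show ?thesis .
  qed
  then have "(\<Prod>i\<in>UNIV. (1 - zvar i * wvar i) ^ k i) = (\<Prod>i\<in>UNIV. \<Sum>j\<le>k i. Poly_Mapping.single (m i j) (c (k i) j))"
    by simp
  also have "\<dots> = (\<Sum>j\<in>PiE UNIV (\<lambda>i. {..k i}). \<Prod>i\<in>UNIV. Poly_Mapping.single (m i (j i)) (c (k i) (j i)))"
    by (rule prod_sum_PiE) auto
  finally have eq: "(\<Prod>i\<in>UNIV. (1 - zvar i * wvar i) ^ k i) =
      (\<Sum>j\<in>PiE UNIV (\<lambda>i. {..k i}). \<Prod>i\<in>UNIV. Poly_Mapping.single (m i (j i)) (c (k i) (j i)))" .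
  have prod_single: "(\<Prod>i\<in>A. Poly_Mapping.single (v i) (a i)) = Poly_Mapping.single (\<Sum>i\<in>A. v i) (\<Prod>i\<in>A. a i)"
    if "finite A" for A and v :: "'n \<Rightarrow> ('n \<Rightarrow>\<^sub>0 nat) \<times> ('n \<Rightarrow>\<^sub>0 nat)" and a :: "'n \<Rightarrow> real"
    using that by (induction A rule: finite_induct) (auto simp: mult_single)
  have lk: "Poly_Mapping.lookup (\<Sum>i\<in>UNIV. Poly_Mapping.single i (j i)) = j" for j :: "'n \<Rightarrow> nat"
    by (auto simp: fun_eq_iff lookup_sum lookup_single when_def)
  have sum_m: "(\<Sum>i\<in>UNIV. m i (j i)) = (\<Sum>i\<in>UNIV. Poly_Mapping.single i (j i), \<Sum>i\<in>UNIV. Poly_Mapping.single i (j i))" for j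
    by (simp add: prod_eq_iff fst_sum snd_sum m_def)
  have "hform S (\<Prod>i\<in>UNIV. (1 - zvar i * wvar i) ^ k i) x y =
      (\<Sum>j\<in>PiE UNIV (\<lambda>i. {..k i}). of_real (\<Prod>i\<in>UNIV. c (k i) (j i)) * pw x y j)"
    unfolding eq hform_sum prod_single[OF finite_class.finite_UNIV] sum_m hform_single lk pw_def ..
  also have "\<dots> = mom (pw x y) (\<lambda>i. [:1, -1:] ^ k i)"
    unfolding one_minus_power mom_sum[OF finite_atMost] mom_smult mom_monom c_def ..
  finally show ?thesis .
qed

end

subsection \<open>Positivity of the Halmos--Bram kernel\<close>

text \<open>The form may be degenerate. Positivity is tested at \<open>x - c *\<^sub>C y\<close>
  with \<open>c\<close> a real multiple \<open>s\<close> of \<open>B x y\<close>. For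
  \<open>Re (B y y) > 0\<close> the best \<open>s\<close> is its reciprocal; for a null vector
  \<open>y\<close> a large \<open>s\<close> violates positivity unless
  \<open>B x y = 0\<close>.\<close>

lemma psd_form_Cauchy_Schwarz:
  fixes B :: "'a::complex_hilbert \<Rightarrow> 'a \<Rightarrow> complex"
  assumes diff: "\<And>x y z. B (x - y) z = B x z - B y z" and scale: "\<And>c x y. B (c *\<^sub>C x) y = c * B x y"
    and herm: "\<And>x y. B y x = cnj (B x y)" and pos: "\<And>x. B x x \<in> \<real>\<^sub>\<ge>\<^sub>0"
  shows "(cmod (B x y))\<^sup>2 \<le> Re (B x x) * Re (B y y)"
proof -
  have scale': "B x (c *\<^sub>C y) = cnj c * B x y" for c x y
    using herm[of x "c *\<^sub>C y"] herm[of x y] scale[of c y x] by simp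
  have diff': "B x (y - z) = B x y - B x z" for x y z
    using herm[of x "y - z"] herm[of x y] herm[of x z] diff[of y z x] by simp
  have Re_pos: "Re (B x x) \<ge> 0" for x using pos[of x] by (simp add: complex_nonneg_Reals_iff)
  have key: "0 \<le> Re (B x x) - 2 * s * (cmod (B x y))\<^sup>2 + s\<^sup>2 * (cmod (B x y))\<^sup>2 * Re (B y y)" for s :: real
  proof -
    define c where "c = of_real s * B x y"
    have cc: "cnj (B x y) * B x y = of_real ((cmod (B x y))\<^sup>2)" by (metis complex_norm_square mult.commute)
    have "B (x - c *\<^sub>C y) (x - c *\<^sub>C y) = B x x - cnj c * B x y - c * cnj (B x y) + c * cnj c * B y y"
      by (simp add: diff diff' scale scale' herm[of x y] algebra_simps)
    also have "\<dots> = B x x - of_real (2 * s * (cmod (B x y))\<^sup>2) + of_real (s\<^sup>2 * (cmod (B x y))\<^sup>2) * B y y"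
    proof -
      have "cnj c * B x y = of_real (s * (cmod (B x y))\<^sup>2)" "c * cnj (B x y) = of_real (s * (cmod (B x y))\<^sup>2)"
        "c * cnj c = of_real (s\<^sup>2 * (cmod (B x y))\<^sup>2)"
        using cc by (simp_all add: c_def power2_eq_square mult_ac)
      then show ?thesis by simp
    qed
    finally show ?thesis using Re_pos[of "x - c *\<^sub>C y"] by simp
  qed
  show ?thesis
  proof (cases "Re (B y y) = 0 \<or> B x y = 0")
    case False
    then have "Re (B y y) > 0" using Re_pos[of y] by simp
    with key[of "1 / Re (B y y)"] show ?thesis by (simp add: field_simps power2_eq_square)
  next
    case True
    show ?thesis
    proof (cases "B x y = 0")
      case False
      then have *: "(cmod (B x y))\<^sup>2 > 0" and "Re (B y y) = 0" using True by auto
      \<comment> \<open>With this \<open>s\<close> the bound reads 0 \<le> - Re (B x x) - 2, a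
        contradiction.\<close>
      with key[of "(Re (B x x) + 1) / (cmod (B x y))\<^sup>2"] Re_pos[of x] show ?thesis by simp
    qed (use Re_pos[of x] Re_pos[of y] in simp)
  qed
qed

lemma sum_nonneg_Reals: "(\<And>i. i \<in> I \<Longrightarrow> f i \<in> \<real>\<^sub>\<ge>\<^sub>0) \<Longrightarrow> (\<Sum>i\<in>I. f i) \<in> (\<real>\<^sub>\<ge>\<^sub>0 :: complex set)"
  by (induction I rule: infinite_finite_induct) auto

lemma sum_swap_pair: "(\<Sum>k\<in>F. \<Sum>l\<in>G. \<Sum>i\<in>B. f k l i) = (\<Sum>i\<in>B. \<Sum>k\<in>F. \<Sum>l\<in>G. f k l i)"
proof -
  have "(\<Sum>k\<in>F. \<Sum>l\<in>G. \<Sum>i\<in>B. f k l i) = (\<Sum>k\<in>F. \<Sum>i\<in>B. \<Sum>l\<in>G. f k l i)"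
    by (intro sum.cong refl sum.swap)
  also have "\<dots> = (\<Sum>i\<in>B. \<Sum>k\<in>F. \<Sum>l\<in>G. f k l i)"
    by (rule sum.swap)
  finally show ?thesis .
qed

lemma mom_cnj: "mom (\<lambda>\<alpha>. cnj (a \<alpha>)) P = cnj (mom a P)"
  by (simp add: mom_def)

text \<open>A factor t makes a cutoff concentrated near t = 0 uniformly small. With q = (1-t)^K,
  Bernoulli gives 1 - (1-q)^m \<le> m q, and (K+1) t (1-t)^K is at most the sum of the t (1-t)^j
  over j \<le> K, hence at most 1.\<close>

lemma poly_cutoff_bound:
  fixes t :: real
  assumes t: "0 \<le> t" "t \<le> 1"
  shows "t * (1 - (1 - (1 - t) ^ K) ^ m) \<le> real m / (real K + 1)"
proof -
  have q: "0 \<le> (1 - t) ^ K" "(1 - t) ^ K \<le> 1" using t by (auto simp: power_le_one)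
  have "1 + real m * (- ((1 - t) ^ K)) \<le> (1 + (- ((1 - t) ^ K))) ^ m"
    by (rule Bernoulli_inequality) (use q in simp)
  then have "1 - (1 - (1 - t) ^ K) ^ m \<le> real m * (1 - t) ^ K" by simp
  then have 1: "t * (1 - (1 - (1 - t) ^ K) ^ m) \<le> t * (real m * (1 - t) ^ K)"
    by (rule mult_left_mono) (rule t)
  have "(real K + 1) * (t * (1 - t) ^ K) = (\<Sum>j<Suc K. t * (1 - t) ^ K)" by simp
  also have "\<dots> \<le> (\<Sum>j<Suc K. t * (1 - t) ^ j)"
    by (intro sum_mono mult_left_mono power_decreasing) (use t in auto)
  also have "\<dots> = 1 - (1 - t) ^ Suc K"
    using one_diff_power_eq[of "1 - t" "Suc K"] by (simp only: sum_distrib_left[symmetric]) simp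
  also have "\<dots> \<le> 1" using t by simp
  finally have "t * (1 - t) ^ K \<le> 1 / (real K + 1)" by (simp add: field_simps)
  then have "real m * (t * (1 - t) ^ K) \<le> real m * (1 / (real K + 1))" by (rule mult_left_mono) simp
  with 1 show ?thesis by (simp add: mult_ac)
qed

section \<open>The moment functional of a tuple satisfying (a), and its positivity\<close>

locale completely_hypercontractive =
  fixes S :: "'n::finite \<Rightarrow> 'a::complex_hilbert \<Rightarrow> 'a"
  assumes bounded: "bounded_clinear (S i)" and comm: "S i (S j x) = S j (S i x)"
    and pos: "mom (\<lambda>\<alpha>. cinner (mpow S \<alpha> x) (mpow S \<alpha> x)) (\<lambda>i. [:1, -1:] ^ k i) \<in> \<real>\<^sub>\<ge>\<^sub>0"
begin

sublocale commuting S by standard (rule comm)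

lemma bounded_mpow: "bounded_clinear (mpow S \<alpha>)"
  by (rule bounded_clinear_fpow) (auto intro: bounded commuting_axioms)

text \<open>To be read as the integral of the product of the P_i(|z_i|^2) against d<E x, y>, where E
  is the spectral measure of the extension still to be built.\<close>

definition L :: "'a \<Rightarrow> 'a \<Rightarrow> ('n \<Rightarrow> real poly) \<Rightarrow> complex" where
  "L x y P = mom (\<lambda>\<alpha>. cinner (mpow S \<alpha> x) (mpow S \<alpha> y)) P"

lemma L_cong_linear:
  "L (\<Sum>k\<in>F. c k *\<^sub>C x k) (\<Sum>l\<in>F'. d l *\<^sub>C y l) P = (\<Sum>k\<in>F. \<Sum>l\<in>F'. c k * cnj (d l) * L (x k) (y l) P)"
proof -
  have "cinner (mpow S \<alpha> (\<Sum>k\<in>F. c k *\<^sub>C x k)) (mpow S \<alpha> (\<Sum>l\<in>F'. d l *\<^sub>C y l)) =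
      (\<Sum>kl\<in>F \<times> F'. c (fst kl) * cnj (d (snd kl)) * cinner (mpow S \<alpha> (x (fst kl))) (mpow S \<alpha> (y (snd kl))))" for \<alpha>
  proof -
    have "cinner (mpow S \<alpha> (\<Sum>k\<in>F. c k *\<^sub>C x k)) (mpow S \<alpha> (\<Sum>l\<in>F'. d l *\<^sub>C y l)) =
        (\<Sum>k\<in>F. \<Sum>l\<in>F'. c k * cnj (d l) * cinner (mpow S \<alpha> (x k)) (mpow S \<alpha> (y l)))"
      unfolding bounded_clinear_sum[OF bounded_mpow] cinner_sum_left bounded_clinear_scaleC[OF bounded_mpow]
      unfolding cinner_sum_right cinner_scaleC_left cinner_scaleC_right by (simp only: mult_ac)
    then show ?thesis by (simp add: sum.cartesian_product case_prod_beta)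
  qed
  then have "L (\<Sum>k\<in>F. c k *\<^sub>C x k) (\<Sum>l\<in>F'. d l *\<^sub>C y l) P =
      (\<Sum>kl\<in>F \<times> F'. c (fst kl) * cnj (d (snd kl)) * L (x (fst kl)) (y (snd kl)) P)"
    unfolding L_def by (simp only: mom_linear)
  then show ?thesis by (simp add: sum.cartesian_product case_prod_beta)
qed

lemma L_scale: "L (c *\<^sub>C x) y P = c * L x y P"
  using L_cong_linear[of "\<lambda>_. c" "\<lambda>_. x" "{0::nat}" "\<lambda>_. 1" "\<lambda>_. y" "{0::nat}" P] by simp

lemma L_diff: "L (x - x') y P = L x y P - L x' y P"
  using L_cong_linear[of "\<lambda>k. if k then 1 else -1" "\<lambda>k. if k then x else x'" UNIV "\<lambda>_. 1" "\<lambda>_. y" "{0::nat}" P]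
  by (simp add: UNIV_bool)

lemma L_herm: "L y x P = cnj (L x y P)"
proof -
  have "(\<lambda>\<alpha>. cinner (mpow S \<alpha> y) (mpow S \<alpha> x)) = (\<lambda>\<alpha>. cnj (cinner (mpow S \<alpha> x) (mpow S \<alpha> y)))"
    by (rule ext) (rule cinner_commute)
  then show ?thesis unfolding L_def by (simp only: mom_cnj)
qed

text \<open>S^\<delta> acts as multiplication by z^\<delta>, so its application to both arguments
  multiplies the integrand by |z|^(2\<delta>).\<close>

lemma L_mpow: "L (mpow S \<delta> x) (mpow S \<delta> y) P = L x y (\<lambda>i. monom 1 (\<delta> i) * P i)"
  unfolding L_def mom_shift by (simp add: mpow_commute[of _ \<delta>] mpow_add)

lemma L_one: "L x y (\<lambda>_. 1) = cinner x y"
  using mom_monom[of "\<lambda>\<alpha>. cinner (mpow S \<alpha> x) (mpow S \<alpha> y)" "\<lambda>_. 0"] by (simp add: L_def)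

text \<open>The assumption \<open>pos\<close> supplies only factors (1-t)^l; the missing factor t^k
  comes from evaluating it at S^k x.\<close>

lemma L_bernp_pos: "L x x (\<lambda>i. bernp N (k i)) \<in> \<real>\<^sub>\<ge>\<^sub>0"
proof -
  have "L x x (\<lambda>i. bernp N (k i)) = of_real (\<Prod>i\<in>UNIV. real (N choose k i)) * L (mpow S k x) (mpow S k x) (\<lambda>i. [:1, -1:] ^ (N - k i))"
    unfolding L_mpow unfolding L_def bernp_def mom_smult ..
  moreover have "complex_of_real (\<Prod>i\<in>UNIV. real (N choose k i)) \<in> \<real>\<^sub>\<ge>\<^sub>0"
    unfolding nonneg_Reals_of_real_iff by (rule prod_nonneg) simp
  ultimately show ?thesis
    using pos[of "mpow S k x" "\<lambda>i. N - k i"] unfolding L_def by simp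
qed

text \<open>Total variation off the diagonal: Cauchy-Schwarz for each Bernstein form and the
  inequality of arithmetic and geometric means reduce it to the diagonal, where the masses are
  nonnegative and sum to the squared norm. This is the bound that \<open>bernstein_limit\<close>
  asks for.\<close>

lemma L_bernp_sum: "(\<Sum>k\<in>PiE UNIV (\<lambda>i. {..N}). cmod (L x y (\<lambda>i. bernp N (k i)))) \<le> ((norm x)\<^sup>2 + (norm y)\<^sup>2) / 2"
proof -
  have "cmod (L x y (\<lambda>i. bernp N (k i))) \<le> (Re (L x x (\<lambda>i. bernp N (k i))) + Re (L y y (\<lambda>i. bernp N (k i)))) / 2" for k
  proof -
    let ?B = "\<lambda>x y. L x y (\<lambda>i. bernp N (k i))"
    have "(cmod (?B x y))\<^sup>2 \<le> Re (?B x x) * Re (?B y y)"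
      by (rule psd_form_Cauchy_Schwarz) (auto simp: L_diff L_scale L_bernp_pos intro: L_herm)
    also have "\<dots> \<le> ((Re (?B x x) + Re (?B y y)) / 2)\<^sup>2"
      using zero_le_power2[of "Re (?B x x) - Re (?B y y)"] by (simp add: power2_eq_square field_simps)
    finally have "(cmod (?B x y))\<^sup>2 \<le> ((Re (?B x x) + Re (?B y y)) / 2)\<^sup>2" .
    moreover have "0 \<le> (Re (?B x x) + Re (?B y y)) / 2"
      using L_bernp_pos[of x N k] L_bernp_pos[of y N k] by (simp add: complex_nonneg_Reals_iff)
    ultimately show ?thesis by (rule power2_le_imp_le)
  qed
  then have "(\<Sum>k\<in>PiE UNIV (\<lambda>i. {..N}). cmod (L x y (\<lambda>i. bernp N (k i)))) \<le>
      (\<Sum>k\<in>PiE UNIV (\<lambda>i. {..N}). (Re (L x x (\<lambda>i. bernp N (k i))) + Re (L y y (\<lambda>i. bernp N (k i)))) / 2)"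
    by (rule sum_mono)
  also have "\<dots> = (Re (\<Sum>k\<in>PiE UNIV (\<lambda>i. {..N}). L x x (\<lambda>i. bernp N (k i))) + Re (\<Sum>k\<in>PiE UNIV (\<lambda>i. {..N}). L y y (\<lambda>i. bernp N (k i)))) / 2"
    by (simp add: sum.distrib sum_divide_distrib[symmetric])
  also have "\<dots> = ((norm x)\<^sup>2 + (norm y)\<^sup>2) / 2"
    unfolding L_def sum_mom_bernp by (simp add: Re_cinner_self)
  finally show ?thesis .
qed

lemma L_limit:
  "(\<lambda>N. \<Sum>k\<in>PiE UNIV (\<lambda>i. {..N}). of_real (\<Prod>i\<in>UNIV. poly (P i) (real (k i) / real N)) * L x y (\<lambda>i. bernp N (k i)))
     \<longlonglongrightarrow> L x y P"
  using bernstein_limit[OF L_bernp_sum[unfolded L_def]] unfolding L_def .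

lemma box_unit: "k \<in> PiE UNIV (\<lambda>i. {..N}) \<Longrightarrow> 0 \<le> real (k i) / real N \<and> real (k i) / real N \<le> 1"
  by (cases "N = 0") (auto simp: PiE_def Pi_def divide_le_eq_1)

text \<open>At each grid point the polynomials take numerical values: those of the
  \<open>g k\<close> are absorbed into the linear combination of the \<open>y k\<close>, those of
  \<open>h\<close> are nonnegative weights. The double sum is thus a limit of nonnegative
  combinations of diagonal Bernstein forms.\<close>

lemma L_matrix_pos:
  assumes h: "\<And>i t. 0 \<le> t \<Longrightarrow> t \<le> 1 \<Longrightarrow> 0 \<le> poly (h i) t"
  shows "(\<Sum>k\<in>F. \<Sum>l\<in>F. L (y k) (y l) (\<lambda>i. g k i * g l i * h i)) \<in> \<real>\<^sub>\<ge>\<^sub>0"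
proof -
  let ?G = "\<lambda>k N \<kappa>. \<Prod>i\<in>UNIV. poly (g k i) (real (\<kappa> i) / real N)"
  let ?T = "\<lambda>N. \<Sum>k\<in>F. \<Sum>l\<in>F. \<Sum>\<kappa>\<in>PiE UNIV (\<lambda>i. {..N}). of_real (\<Prod>i\<in>UNIV. poly (g k i * g l i * h i) (real (\<kappa> i) / real N)) *
      L (y k) (y l) (\<lambda>i. bernp N (\<kappa> i))"
  have "?T \<longlonglongrightarrow> (\<Sum>k\<in>F. \<Sum>l\<in>F. L (y k) (y l) (\<lambda>i. g k i * g l i * h i))"
    by (intro tendsto_sum L_limit)
  moreover have "?T N \<in> \<real>\<^sub>\<ge>\<^sub>0" for N
  proof -
    have "?T N = (\<Sum>\<kappa>\<in>PiE UNIV (\<lambda>i. {..N}). \<Sum>k\<in>F. \<Sum>l\<in>F.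
        of_real (\<Prod>i\<in>UNIV. poly (h i) (real (\<kappa> i) / real N)) *
        (of_real (?G k N \<kappa>) * cnj (of_real (?G l N \<kappa>)) * L (y k) (y l) (\<lambda>i. bernp N (\<kappa> i))))"
      by (rule trans[OF sum_swap_pair], intro sum.cong refl) (simp add: prod.distrib mult_ac)
    also have "\<dots> = (\<Sum>\<kappa>\<in>PiE UNIV (\<lambda>i. {..N}). of_real (\<Prod>i\<in>UNIV. poly (h i) (real (\<kappa> i) / real N)) *
        L (\<Sum>k\<in>F. of_real (?G k N \<kappa>) *\<^sub>C y k) (\<Sum>k\<in>F. of_real (?G k N \<kappa>) *\<^sub>C y k) (\<lambda>i. bernp N (\<kappa> i)))"
      unfolding L_cong_linear sum_distrib_left ..
    also have "\<dots> \<in> \<real>\<^sub>\<ge>\<^sub>0"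
    proof (rule sum_nonneg_Reals)
      fix \<kappa> :: "'n \<Rightarrow> nat" assume "\<kappa> \<in> PiE UNIV (\<lambda>i. {..N})"
      then have "poly (h i) (real (\<kappa> i) / real N) \<ge> 0" for i
        using box_unit[of \<kappa> N i] by (intro h) auto
      then have "(\<Prod>i\<in>UNIV. poly (h i) (real (\<kappa> i) / real N)) \<ge> 0"
        by (simp add: prod_nonneg)
      then show "of_real (\<Prod>i\<in>UNIV. poly (h i) (real (\<kappa> i) / real N)) *
          L (\<Sum>k\<in>F. of_real (?G k N \<kappa>) *\<^sub>C y k) (\<Sum>k\<in>F. of_real (?G k N \<kappa>) *\<^sub>C y k) (\<lambda>i. bernp N (\<kappa> i)) \<in> \<real>\<^sub>\<ge>\<^sub>0"
        by (intro nonneg_Reals_mult_I L_bernp_pos) (simp only: nonneg_Reals_of_real_iff)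
    qed
    finally show ?thesis .
  qed
  ultimately show ?thesis
    by (rule closed_sequentially[OF closed_nonneg_Reals_complex, rotated])
qed

lemma L_pos:
  assumes "\<And>i t. 0 \<le> t \<Longrightarrow> t \<le> 1 \<Longrightarrow> 0 \<le> poly (P i) t"
  shows "L x x P \<in> \<real>\<^sub>\<ge>\<^sub>0"
  using L_matrix_pos[of P "\<lambda>_. x" "\<lambda>_ _. 1" "{0::nat}", OF assms] by simp

text \<open>The diagonal Bernstein weights are nonnegative with sum \<open>(norm x)\<^sup>2\<close>,
  so pointwise bounds on the factors survive in the limit.\<close>

lemma L_le:
  assumes P: "\<And>i t. 0 \<le> t \<Longrightarrow> t \<le> 1 \<Longrightarrow> 0 \<le> poly (P i) t \<and> poly (P i) t \<le> c i"
  shows "Re (L x x P) \<le> (\<Prod>i\<in>UNIV. c i) * (norm x)\<^sup>2"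
proof -
  have "(\<lambda>N. Re (\<Sum>k\<in>PiE UNIV (\<lambda>i. {..N}). of_real (\<Prod>i\<in>UNIV. poly (P i) (real (k i) / real N)) * L x x (\<lambda>i. bernp N (k i))))
     \<longlonglongrightarrow> Re (L x x P)"
    by (rule tendsto_Re[OF L_limit])
  moreover have "Re (\<Sum>k\<in>PiE UNIV (\<lambda>i. {..N}). of_real (\<Prod>i\<in>UNIV. poly (P i) (real (k i) / real N)) * L x x (\<lambda>i. bernp N (k i)))
      \<le> (\<Prod>i\<in>UNIV. c i) * (norm x)\<^sup>2" for N
  proof -
    have "Re (\<Sum>k\<in>PiE UNIV (\<lambda>i. {..N}). of_real (\<Prod>i\<in>UNIV. poly (P i) (real (k i) / real N)) * L x x (\<lambda>i. bernp N (k i)))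
        = (\<Sum>k\<in>PiE UNIV (\<lambda>i. {..N}). (\<Prod>i\<in>UNIV. poly (P i) (real (k i) / real N)) * Re (L x x (\<lambda>i. bernp N (k i))))"
      by (simp only: Re_sum Re_complex_of_real Im_complex_of_real times_complex.sel) simp
    also have "\<dots> \<le> (\<Sum>k\<in>PiE UNIV (\<lambda>i. {..N}). (\<Prod>i\<in>UNIV. c i) * Re (L x x (\<lambda>i. bernp N (k i))))"
    proof (intro sum_mono mult_right_mono prod_mono conjI)
      fix k :: "'n \<Rightarrow> nat" and i assume "k \<in> PiE UNIV (\<lambda>i. {..N})"
      then show "0 \<le> poly (P i) (real (k i) / real N)" "poly (P i) (real (k i) / real N) \<le> c i"
        using box_unit[of k N i] P[of "real (k i) / real N" i] by auto
    next
      fix k :: "'n \<Rightarrow> nat"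
      show "0 \<le> Re (L x x (\<lambda>i. bernp N (k i)))"
        using L_bernp_pos[of x N k] by (simp add: complex_nonneg_Reals_iff)
    qed
    also have "\<dots> = (\<Prod>i\<in>UNIV. c i) * Re (\<Sum>k\<in>PiE UNIV (\<lambda>i. {..N}). L x x (\<lambda>i. bernp N (k i)))"
      by (simp add: sum_distrib_left)
    also have "\<dots> = (\<Prod>i\<in>UNIV. c i) * (norm x)\<^sup>2"
      unfolding L_def sum_mom_bernp by (simp add: Re_cinner_self)
    finally show ?thesis .
  qed
  ultimately show ?thesis by (intro LIMSEQ_le_const2) blast+
qed

text \<open>The factors \<open>\<bar>z\<^sub>i\<bar>\<^sup>2\<close> may vanish, so the unit is split as a sum, over the sets of
  coordinates, of products of \<open>e\<^sub>K = (1 - (1 - X)\<^sup>K)\<^sup>2\<^sup>M\<close>, which is divisible by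
  \<open>X\<^sup>2\<^sup>M\<close> and tends to the indicator of \<open>X > 0\<close>, and of \<open>1 - e\<^sub>K\<close>.\<close>

lemma kernel_pos:
  assumes fin: "finite F" and h: "\<And>i t. 0 \<le> t \<Longrightarrow> t \<le> 1 \<Longrightarrow> 0 \<le> poly (h i) t \<and> poly (h i) t \<le> 1"
  shows "0 \<le> Re (\<Sum>k\<in>F. \<Sum>l\<in>F. L (mpow S (\<alpha> l) (x k)) (mpow S (\<alpha> k) (x l)) h)"
proof -
  \<comment> \<open>A common bound for all exponents in play; the cutoff carries the power 2 * M
    because the exponents of two vectors are split off from it at once.\<close>
  define M where "M = (\<Sum>k\<in>F. \<Sum>i\<in>UNIV. \<alpha> k i)"
  have M: "\<alpha> k i \<le> M" if "k \<in> F" for k i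
  proof -
    have "\<alpha> k i \<le> (\<Sum>i\<in>UNIV. \<alpha> k i)" by (rule member_le_sum) auto
    also have "\<dots> \<le> M" unfolding M_def using that fin by (intro member_le_sum) auto
    finally show ?thesis .
  qed
  define e :: "nat \<Rightarrow> real poly" where "e K = (1 - [:1, -1:] ^ K) ^ (2 * M)" for K
  \<comment> \<open>From 1 - (1-X)^K = X * (sum of (1-X)^j over j < K): \<open>e K\<close> is X^(2M)
    times the square of \<open>s K\<close>, with one factor \<open>s K\<close> for each argument of
    the form.\<close>
  define s :: "nat \<Rightarrow> real poly" where "s K = (\<Sum>j<K. [:1, -1:] ^ j) ^ M" for K
  have e_eq: "e K = monom 1 (2 * M) * (s K * s K)" for K
  proof -
    have "1 - [:1, -1:] ^ K = (1 - [:1, -1:] :: real poly) * (\<Sum>j<K. [:1, -1:] ^ j)"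
      by (rule one_diff_power_eq)
    also have "(1 - [:1, -1:] :: real poly) = monom 1 1" by (simp add: monom_altdef one_pCons)
    finally show ?thesis
      by (simp add: e_def s_def power_mult_distrib monom_power mult_2 power_add mult_monom)
  qed
  have poly_e: "poly (e K) t = (1 - (1 - t) ^ K) ^ (2 * M)" for K t
    by (simp add: e_def)
  have e01: "0 \<le> poly (e K) t \<and> poly (e K) t \<le> 1" if "0 \<le> t" "t \<le> 1" for K t
    using that unfolding poly_e by (auto intro!: power_le_one simp: power_le_one)
  \<comment> \<open>\<open>b\<close> marks the coordinates that carry \<open>e K\<close>; the others
    carry \<open>1 - e K\<close>, concentrated near t = 0.\<close>
  define Q where "Q K b i = (if b i then e K else 1 - e K) * h i" for K b i
  have Q_fun: "Q K b = (\<lambda>i. (if b i then e K else 1 - e K) * h i)" for K b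
    by (simp add: Q_def fun_eq_iff)
  have Q01: "0 \<le> poly (Q K b i) t \<and> poly (Q K b i) t \<le> 1" if "0 \<le> t" "t \<le> 1" for K b i t
    using e01[OF that, of K] h[OF that, of i] by (auto simp: Q_def intro!: mult_le_one)
  have split: "L u v h = (\<Sum>b\<in>PiE UNIV (\<lambda>_. UNIV). L u v (Q K b))" for u v K
  proof -
    have "h = (\<lambda>i. \<Sum>b\<in>UNIV. (if b then e K else 1 - e K) * h i)"
      by (auto simp: UNIV_bool algebra_simps)
    then have "L u v h = L u v (\<lambda>i. \<Sum>b\<in>UNIV. (if b then e K else 1 - e K) * h i)" by (rule arg_cong)
    then show ?thesis
      unfolding L_def by (simp only: mom_sum finite_class.finite_UNIV Q_fun)
  qed
  \<comment> \<open>A factor S_i in the first argument meets \<open>1 - e K\<close> in coordinate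
    \<open>i\<close>. Cauchy-Schwarz turns it into t_i * (1 - e K), which is O(1/K) by
    \<open>poly_cutoff_bound\<close>.\<close>
  have small: "(\<lambda>K. L (mpow S \<delta> u) v (Q K b)) \<longlonglongrightarrow> 0" if bi: "\<not> b i" and \<delta>i: "\<delta> i \<noteq> 0" for u v b \<delta> i
  proof -
    define \<delta>' where "\<delta>' j = (if j = i then \<delta> i - 1 else \<delta> j)" for j
    define \<epsilon> where "\<epsilon> j = (if j = i then 1 else 0 :: nat)" for j
    have "\<delta> = (\<lambda>j. \<epsilon> j + \<delta>' j)" using \<delta>i by (auto simp: \<epsilon>_def \<delta>'_def)
    then have \<delta>: "mpow S \<delta> u = mpow S \<epsilon> (mpow S \<delta>' u)" using mpow_add[of \<epsilon> \<delta>' u] by simp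
    define w where "w = mpow S \<delta>' u"
    have bound: "(cmod (L (mpow S \<delta> u) v (Q K b)))\<^sup>2 \<le> real (2 * M) * (norm w)\<^sup>2 * (norm v)\<^sup>2 * (1 / (real K + 1))" for K
    proof -
      have "(cmod (L (mpow S \<delta> u) v (Q K b)))\<^sup>2 \<le> Re (L (mpow S \<delta> u) (mpow S \<delta> u) (Q K b)) * Re (L v v (Q K b))"
        by (rule psd_form_Cauchy_Schwarz[of "\<lambda>x y. L x y (Q K b)", OF L_diff L_scale L_herm L_pos]) (use Q01 in blast)
      also have "\<dots> \<le> (real (2 * M) / (real K + 1) * (norm w)\<^sup>2) * (norm v)\<^sup>2"
      proof (rule mult_mono)
        have "Re (L w w (\<lambda>j. monom 1 (\<epsilon> j) * Q K b j)) \<le> (\<Prod>j\<in>UNIV. if j = i then real (2 * M) / (real K + 1) else 1) * (norm w)\<^sup>2"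
        proof (rule L_le)
          fix j and t :: real assume t: "0 \<le> t" "t \<le> 1"
          have "t * (poly (1 - e K) t * poly (h i) t) \<le> t * (poly (1 - e K) t * 1)"
            using t e01[OF t, of K] h[OF t, of i] by (intro mult_left_mono) auto
          also have "\<dots> \<le> real (2 * M) / (real K + 1)"
            using poly_cutoff_bound[OF t, of K "2 * M"] by (simp add: poly_e)
          finally show "0 \<le> poly (monom 1 (\<epsilon> j) * Q K b j) t \<and>
              poly (monom 1 (\<epsilon> j) * Q K b j) t \<le> (if j = i then real (2 * M) / (real K + 1) else 1)"
            using Q01[OF t, of K b j] t bi by (auto simp: \<epsilon>_def poly_monom Q_def)
        qed
        then show "Re (L (mpow S \<delta> u) (mpow S \<delta> u) (Q K b)) \<le> real (2 * M) / (real K + 1) * (norm w)\<^sup>2"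
          unfolding \<delta> w_def[symmetric] L_mpow by (simp add: prod.delta)
        show "Re (L v v (Q K b)) \<le> (norm v)\<^sup>2"
          using L_le[of "Q K b" "\<lambda>_. 1" v] Q01 by simp
        show "0 \<le> Re (L v v (Q K b))"
          using L_pos[of "Q K b" v] Q01 by (auto simp: complex_nonneg_Reals_iff)
      qed simp
      finally show ?thesis by (simp add: mult_ac)
    qed
    have "(\<lambda>K. real (2 * M) * (norm w)\<^sup>2 * (norm v)\<^sup>2 * (1 / (real K + 1))) \<longlonglongrightarrow> real (2 * M) * (norm w)\<^sup>2 * (norm v)\<^sup>2 * 0"
      by (intro tendsto_mult tendsto_const) real_asymp
    then have g0: "(\<lambda>K. real (2 * M) * (norm w)\<^sup>2 * (norm v)\<^sup>2 * (1 / (real K + 1))) \<longlonglongrightarrow> 0"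
      by (simp only: mult_zero_right)
    have "\<forall>\<^sub>F K in sequentially. norm ((cmod (L (mpow S \<delta> u) v (Q K b)))\<^sup>2) \<le> real (2 * M) * (norm w)\<^sup>2 * (norm v)\<^sup>2 * (1 / (real K + 1))"
      by (rule always_eventually, rule allI, subst real_norm_def, subst abs_of_nonneg, simp, rule bound)
    from Lim_null_comparison[OF this g0]
    have "(\<lambda>K. (cmod (L (mpow S \<delta> u) v (Q K b)))\<^sup>2) \<longlonglongrightarrow> 0" .
    then have "(\<lambda>K. sqrt ((cmod (L (mpow S \<delta> u) v (Q K b)))\<^sup>2)) \<longlonglongrightarrow> sqrt 0" by (rule tendsto_real_sqrt)
    then show ?thesis by (simp add: tendsto_norm_zero_iff)
  qed
  \<comment> \<open>Only vectors whose exponents vanish off \<open>b\<close> contribute in the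
    limit.\<close>
  define G where "G b = {k \<in> F. \<forall>i. \<not> b i \<longrightarrow> \<alpha> k i = 0}" for b
  define R where "R K b k l = L (mpow S (\<alpha> l) (x k)) (mpow S (\<alpha> k) (x l)) (Q K b)" for K b k l
  have R_small: "(\<lambda>K. R K b k l) \<longlonglongrightarrow> 0" if kl: "k \<in> F" "l \<in> F" "\<not> (k \<in> G b \<and> l \<in> G b)" for b k l
  proof -
    consider i where "\<not> b i" "\<alpha> l i \<noteq> 0" | i where "\<not> b i" "\<alpha> k i \<noteq> 0"
      using kl by (auto simp: G_def)
    then show ?thesis
    proof cases
      case 1
      then show ?thesis unfolding R_def by (rule small)
    next
      case 2
      then have "(\<lambda>K. cnj (L (mpow S (\<alpha> k) (x l)) (mpow S (\<alpha> l) (x k)) (Q K b))) \<longlonglongrightarrow> cnj 0"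
        by (intro tendsto_cnj small)
      then show ?thesis unfolding R_def L_herm[of "mpow S (\<alpha> l) (x k)" "mpow S (\<alpha> k) (x l)"] by simp
    qed
  qed
  have G_pos: "(\<Sum>k\<in>G b. \<Sum>l\<in>G b. R K b k l) \<in> \<real>\<^sub>\<ge>\<^sub>0" for K b
  proof -
    \<comment> \<open>On \<open>b\<close>, conj(z)^\<alpha> = t^\<alpha> z^(-\<alpha>), and the
      power z^\<gamma> absorbs the negative exponent: \<open>y k\<close> stands for z^(\<gamma> -
      \<alpha> k) applied to \<open>x k\<close>, while \<open>g k\<close> carries the factor
      t^(\<alpha> k). The kernel sum becomes an instance of \<open>L_matrix_pos\<close>.\<close>
    define \<gamma> where "\<gamma> i = (if b i then 2 * M else 0)" for i
    define y where "y k = mpow S (\<lambda>i. \<gamma> i - \<alpha> k i) (x k)" for k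
    define g where "g k i = (if b i then monom 1 (\<alpha> k i) * s K else 1)" for k i
    define h' where "h' i = (if b i then h i else (1 - e K) * h i)" for i
    have "R K b k l = L (y k) (y l) (\<lambda>i. g k i * g l i * h' i)" if k: "k \<in> G b" and l: "l \<in> G b" for k l
    proof -
      \<comment> \<open>Truncated subtraction is exact here: on \<open>b\<close> both exponents are
        at most \<open>M\<close>, and off \<open>b\<close> everything is 0.\<close>
      define \<delta> where "\<delta> i = \<gamma> i - \<alpha> k i - \<alpha> l i" for i
      have le: "\<alpha> k i \<le> M" "\<alpha> l i \<le> M" and z: "\<not> b i \<Longrightarrow> \<alpha> k i = 0" "\<not> b i \<Longrightarrow> \<alpha> l i = 0" for i
        using k l M by (auto simp: G_def)
      have "(\<lambda>i. \<gamma> i - \<alpha> k i) = (\<lambda>i. \<delta> i + \<alpha> l i)"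
      proof
        fix i show "\<gamma> i - \<alpha> k i = \<delta> i + \<alpha> l i"
          using le[of i] z[of i] by (cases "b i") (auto simp: \<delta>_def \<gamma>_def)
      qed
      then have yk: "y k = mpow S \<delta> (mpow S (\<alpha> l) (x k))" by (simp only: y_def mpow_add)
      have "(\<lambda>i. \<gamma> i - \<alpha> l i) = (\<lambda>i. \<delta> i + \<alpha> k i)"
      proof
        fix i show "\<gamma> i - \<alpha> l i = \<delta> i + \<alpha> k i"
          using le[of i] z[of i] by (cases "b i") (auto simp: \<delta>_def \<gamma>_def)
      qed
      then have yl: "y l = mpow S \<delta> (mpow S (\<alpha> k) (x l))" by (simp only: y_def mpow_add)
      have "(\<lambda>i. monom 1 (\<delta> i) * (g k i * g l i * h' i)) = Q K b"
      proof
        fix i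
        show "monom 1 (\<delta> i) * (g k i * g l i * h' i) = Q K b i"
        proof (cases "b i")
          case True
          have "monom 1 (\<delta> i) * (g k i * g l i * h' i) =
              (monom 1 (\<delta> i) * monom 1 (\<alpha> k i) * monom 1 (\<alpha> l i)) * (s K * s K) * h i"
            using True by (simp add: g_def h'_def mult_ac)
          also have "monom 1 (\<delta> i) * monom 1 (\<alpha> k i) * monom 1 (\<alpha> l i) = monom (1::real) (2 * M)"
            using True le[of i] by (simp add: mult_monom \<delta>_def \<gamma>_def)
          finally show ?thesis using True by (simp add: Q_def e_eq)
        next
          case False
          then show ?thesis using z[of i] by (simp add: g_def h'_def Q_def \<delta>_def \<gamma>_def)
        qed
      qed
      then show ?thesis unfolding yk yl L_mpow R_def by simp
    qed
    then have "(\<Sum>k\<in>G b. \<Sum>l\<in>G b. R K b k l) = (\<Sum>k\<in>G b. \<Sum>l\<in>G b. L (y k) (y l) (\<lambda>i. g k i * g l i * h' i))"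
      by (intro sum.cong refl) auto
    also have "\<dots> \<in> \<real>\<^sub>\<ge>\<^sub>0"
      by (rule L_matrix_pos) (use h e01 in \<open>auto simp: h'_def\<close>)
    finally show ?thesis .
  qed
  \<comment> \<open>The pairs with a vector outside \<open>G b\<close>. By \<open>R_small\<close>
    they tend to 0, so the kernel sum, which does not depend on \<open>K\<close>, is bounded below
    by a null sequence.\<close>
  define E where "E K b = (\<Sum>k\<in>F. \<Sum>l\<in>F. if k \<in> G b \<and> l \<in> G b then 0 else R K b k l)" for K b
  have E_lim: "(\<lambda>K. \<Sum>b\<in>PiE UNIV (\<lambda>_. UNIV). Re (E K b)) \<longlonglongrightarrow> (\<Sum>b\<in>PiE (UNIV::'n set) (\<lambda>_. UNIV::bool set). Re 0)"
  proof (intro tendsto_sum tendsto_Re)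
    fix b :: "'n \<Rightarrow> bool"
    have "(\<lambda>K. E K b) \<longlonglongrightarrow> (\<Sum>k\<in>F. \<Sum>l\<in>F. 0)"
      unfolding E_def
    proof (intro tendsto_sum)
      show "(\<lambda>K. if k \<in> G b \<and> l \<in> G b then 0 else R K b k l) \<longlonglongrightarrow> 0" if "k \<in> F" "l \<in> F" for k l
        using R_small[OF that, of b] by (cases "k \<in> G b \<and> l \<in> G b") auto
    qed
    then show "(\<lambda>K. E K b) \<longlonglongrightarrow> 0" by simp
  qed
  have "(\<Sum>b\<in>PiE UNIV (\<lambda>_. UNIV). Re (E K b)) \<le> Re (\<Sum>k\<in>F. \<Sum>l\<in>F. L (mpow S (\<alpha> l) (x k)) (mpow S (\<alpha> k) (x l)) h)" for K
  proof -
    have sub: "G b \<subseteq> F" for b by (auto simp: G_def)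
    have "(\<Sum>k\<in>F. \<Sum>l\<in>F. R K b k l) = (\<Sum>k\<in>G b. \<Sum>l\<in>G b. R K b k l) + E K b" for b
    proof -
      have "(\<Sum>k\<in>G b. \<Sum>l\<in>G b. R K b k l) = (\<Sum>k\<in>F. \<Sum>l\<in>F. if k \<in> G b \<and> l \<in> G b then R K b k l else 0)"
      proof -
        have "(\<Sum>k\<in>F. \<Sum>l\<in>F. if k \<in> G b \<and> l \<in> G b then R K b k l else 0) =
            (\<Sum>k\<in>G b. \<Sum>l\<in>F. if k \<in> G b \<and> l \<in> G b then R K b k l else 0)"
          using sub fin by (intro sum.mono_neutral_right) auto
        also have "\<dots> = (\<Sum>k\<in>G b. \<Sum>l\<in>G b. if k \<in> G b \<and> l \<in> G b then R K b k l else 0)"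
          using sub fin by (intro sum.cong refl sum.mono_neutral_right) auto
        finally show ?thesis by simp
      qed
      then show ?thesis
        unfolding E_def by (simp add: sum.distrib[symmetric] if_distrib cong: if_cong)
    qed
    then have "Re (E K b) \<le> Re (\<Sum>k\<in>F. \<Sum>l\<in>F. R K b k l)" for b
      using G_pos[of K b] by (simp add: complex_nonneg_Reals_iff)
    then have "(\<Sum>b\<in>PiE UNIV (\<lambda>_. UNIV). Re (E K b)) \<le> (\<Sum>b\<in>PiE UNIV (\<lambda>_. UNIV). Re (\<Sum>k\<in>F. \<Sum>l\<in>F. R K b k l))"
      by (rule sum_mono)
    also have "\<dots> = Re (\<Sum>b\<in>PiE UNIV (\<lambda>_. UNIV). \<Sum>k\<in>F. \<Sum>l\<in>F. R K b k l)"
      by (rule Re_sum[symmetric])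
    also have "(\<Sum>b\<in>PiE UNIV (\<lambda>_. UNIV). \<Sum>k\<in>F. \<Sum>l\<in>F. R K b k l) =
        (\<Sum>k\<in>F. \<Sum>l\<in>F. \<Sum>b\<in>PiE UNIV (\<lambda>_. UNIV). R K b k l)"
      by (rule sum_swap_pair[symmetric])
    finally show ?thesis unfolding R_def split[of _ _ K, symmetric] .
  qed
  then show ?thesis
    using LIMSEQ_le_const2[OF E_lim] by auto
qed

end

subsection \<open>Realising a positive kernel by vectors\<close>

text \<open>Gram-Schmidt by well-founded choice: finitely many vectors never span the space, so some
  vector always leaves a nonzero remainder to be normalised.\<close>

lemma orthonormal_sequence:
  assumes "infinite_dimensional TYPE('k::complex_hilbert)"
  obtains e :: "nat \<Rightarrow> 'k::complex_hilbert" where "\<And>i j. cinner (e i) (e j) = (if i = j then 1 else 0)"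
proof -
  define P where "P f n r \<longleftrightarrow> norm r = 1 \<and> (\<forall>m<n. cinner r (f m) = 0)" for f :: "nat \<Rightarrow> 'k" and n r
  have "\<exists>f. \<forall>n. P f n (f n)"
  proof (rule dependent_wf_choice[OF wf_less])
    show "P f n r = P g n r" if "\<And>z. (z, n) \<in> {(x, y). x < y} \<Longrightarrow> f z = g z" for f g n r
      using that by (simp add: P_def)
    show "\<exists>r. P f n r" if IH: "\<And>y. (y, n) \<in> {(x, y). x < y} \<Longrightarrow> P f y (f y)" for n f
    proof -
      have norm1: "norm (f m) = 1" if "m < n" for m using IH[of m] that by (simp add: P_def)
      have orth: "cinner (f m) (f l) = 0" if "m < n" "l < n" "m \<noteq> l" for m l
        using IH[of m] IH[of l] that cinner_eq_0_commute[of "f m" "f l"] by (cases "l < m") (auto simp: P_def)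
      obtain x where x: "x \<notin> complex_vector.span (f ` {..<n})"
        using assms unfolding infinite_dimensional_def by blast
      define y where "y = x - (\<Sum>m<n. cinner x (f m) *\<^sub>C f m)"
      have "(\<Sum>m<n. cinner x (f m) *\<^sub>C f m) \<in> complex_vector.span (f ` {..<n})"
        by (intro complex_vector.span_sum complex_vector.span_scale complex_vector.span_base) auto
      then have "y \<noteq> 0" using x by (auto simp: y_def)
      have "cinner y (f m) = 0" if m: "m < n" for m
      proof -
        have "(\<Sum>l<n. cinner x (f l) * cinner (f l) (f m)) = (\<Sum>l<n. if l = m then cinner x (f m) else 0)"
          using m orth norm1 by (intro sum.cong) (auto simp: cinner_self)
        then show ?thesis
          using m by (simp add: y_def cinner_diff_left cinner_sum_left cinner_scaleC_left)
      qed
      then have "P f n (of_real (1 / norm y) *\<^sub>C y)"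
        using \<open>y \<noteq> 0\<close> by (simp add: P_def cinner_scaleC_left norm_scaleC norm_divide)
      then show ?thesis by blast
    qed
  qed
  then obtain f where f: "\<And>n. P f n (f n)" by blast
  have "cinner (f i) (f j) = (if i = j then 1 else 0)" for i j
  proof (cases i j rule: linorder_cases)
    case less
    then show ?thesis using f[of j] cinner_eq_0_commute[of "f i" "f j"] by (auto simp: P_def)
  next
    case equal
    then show ?thesis using f[of j] by (simp add: P_def cinner_self)
  next
    case greater
    then show ?thesis using f[of i] by (auto simp: P_def)
  qed
  then show thesis using that by blast
qed

text \<open>Finite combinations are lists in which an index may occur repeatedly, so adjoining a
  term needs no regrouping of coefficients.\<close>

definition kform :: "('i \<Rightarrow> 'i \<Rightarrow> complex) \<Rightarrow> (complex \<times> 'i) list \<Rightarrow> complex" where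
  "kform k L = (\<Sum>(c, i)\<leftarrow>L. \<Sum>(d, j)\<leftarrow>L. c * cnj d * k i j)"

definition psd_kernel :: "('i \<Rightarrow> 'i \<Rightarrow> complex) \<Rightarrow> bool" where
  "psd_kernel k \<longleftrightarrow> (\<forall>i j. k j i = cnj (k i j)) \<and> (\<forall>L. 0 \<le> Re (kform k L))"

text \<open>One elimination step: the Gram kernel after projecting out the vector of index
  \<open>m\<close>. If \<open>k m m = 0\<close>, the quotient is 0 and the kernel is left
  unchanged.\<close>

definition schur_complement :: "'i \<Rightarrow> ('i \<Rightarrow> 'i \<Rightarrow> complex) \<Rightarrow> 'i \<Rightarrow> 'i \<Rightarrow> complex" where
  "schur_complement m k i j = k i j - k i m * k m j / k m m"

lemma psd_kernel_herm: "psd_kernel k \<Longrightarrow> k j i = cnj (k i j)"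
  unfolding psd_kernel_def by (elim conjE allE)

lemma psd_kernel_nonneg: "psd_kernel k \<Longrightarrow> 0 \<le> Re (kform k L)"
  unfolding psd_kernel_def by (elim conjE allE)

lemma kform_Cons:
  assumes "psd_kernel k"
  shows "kform k ((b, m) # L) = b * cnj b * k m m + b * cnj (\<Sum>(c, i)\<leftarrow>L. c * k i m)
      + cnj b * (\<Sum>(c, i)\<leftarrow>L. c * k i m) + kform k L"
proof -
  have herm: "k m j = cnj (k j m)" for j by (rule psd_kernel_herm[OF assms])
  have "(\<Sum>(d, j)\<leftarrow>L. b * cnj d * k m j) = b * cnj (\<Sum>(c, i)\<leftarrow>L. c * k i m)"
    by (induction L) (auto simp: herm algebra_simps)
  moreover have "(\<Sum>(c, i)\<leftarrow>L. c * cnj b * k i m) = cnj b * (\<Sum>(c, i)\<leftarrow>L. c * k i m)"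
    by (induction L) (auto simp: algebra_simps)
  moreover have "(\<Sum>(c, i)\<leftarrow>L'. f c i + g c i) = (\<Sum>(c, i)\<leftarrow>L'. f c i) + (\<Sum>(c, i)\<leftarrow>L'. g c i)"
    for f g :: "complex \<Rightarrow> 'a \<Rightarrow> complex" and L' by (induction L') auto
  ultimately show ?thesis
    by (simp only: kform_def list.map sum_list.Cons prod.case add.assoc)
qed

lemma psd_kernel_diag:
  assumes "psd_kernel k"
  shows "k m m = of_real (Re (k m m))" "0 \<le> Re (k m m)"
proof -
  have "k m m = cnj (k m m)" by (rule psd_kernel_herm[OF assms])
  then have "Im (k m m) = Im (cnj (k m m))" by (rule arg_cong)
  then have "Im (k m m) = 0" by simp
  then show "k m m = of_real (Re (k m m))" by (simp add: complex_eq_iff)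
  have "0 \<le> Re (kform k [(1, m)])" by (rule psd_kernel_nonneg[OF assms])
  then show "0 \<le> Re (k m m)" by (simp add: kform_def)
qed

lemma psd_kernel_zero:
  assumes k: "psd_kernel k" and z: "k m m = 0"
  shows "k i m = 0"
proof (rule ccontr)
  assume n: "k i m \<noteq> 0"
  \<comment> \<open>Chosen so that s |k i m|^2 = Re (k i i) + 1, which makes the form on the two
    indices negative.\<close>
  define s where "s = (Re (k i i) + 1) / (cmod (k i m))\<^sup>2"
  have "0 \<le> Re (kform k [(- of_real s * k i m, m), (1, i)])"
    by (rule psd_kernel_nonneg[OF k])
  also have "kform k [(- of_real s * k i m, m), (1, i)] = k i i - of_real (2 * s) * (k i m * cnj (k i m))"
    unfolding kform_Cons[OF k] by (simp add: kform_def z algebra_simps)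
  also have "\<dots> = k i i - of_real (2 * s * (cmod (k i m))\<^sup>2)"
    by (simp only: complex_norm_square[symmetric]) simp
  finally have "2 * (s * (cmod (k i m))\<^sup>2) \<le> Re (k i i)" by simp
  also have "s * (cmod (k i m))\<^sup>2 = Re (k i i) + 1" using n by (simp add: s_def)
  finally show False using psd_kernel_diag(2)[OF k, of i] by simp
qed

text \<open>For a nonzero pivot, the form of the complement is the form of \<open>k\<close> at the
  same combination enlarged by a multiple of \<open>m\<close>, namely the one that minimises it,
  \<open>- s / k m m\<close>.\<close>

lemma psd_schur_complement:
  assumes k: "psd_kernel k"
  shows "psd_kernel (schur_complement m k)"
proof -
  have herm: "k j i = cnj (k i j)" for i j by (rule psd_kernel_herm[OF k])
  have psd: "0 \<le> Re (kform k L)" for L by (rule psd_kernel_nonneg[OF k])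
  have "0 \<le> Re (kform (schur_complement m k) L)" for L
  proof (cases "k m m = 0")
    case True
    then have "schur_complement m k = k" by (simp add: schur_complement_def fun_eq_iff)
    then show ?thesis using psd by simp
  next
    case False
    define s where "s = (\<Sum>(c, i)\<leftarrow>L. c * k i m)"
    have km: "cnj (k j m) = k m j" for j by (rule herm[symmetric])
    have "kform (schur_complement m k) L = kform k L - s * cnj s / k m m"
    proof -
      have "(\<Sum>(d, j)\<leftarrow>L'. c * cnj d * schur_complement m k i j) =
          (\<Sum>(d, j)\<leftarrow>L'. c * cnj d * k i j) - c * k i m * cnj (\<Sum>(d, j)\<leftarrow>L'. d * k j m) / k m m" for c i L'
        by (induction L') (auto simp: schur_complement_def km diff_divide_distrib add_divide_distrib algebra_simps)
      then have "(\<Sum>(c, i)\<leftarrow>L''. \<Sum>(d, j)\<leftarrow>L'. c * cnj d * schur_complement m k i j) =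
          (\<Sum>(c, i)\<leftarrow>L''. \<Sum>(d, j)\<leftarrow>L'. c * cnj d * k i j) - (\<Sum>(c, i)\<leftarrow>L''. c * k i m) * cnj (\<Sum>(d, j)\<leftarrow>L'. d * k j m) / k m m" for L' L''
        by (induction L'') (auto simp: add_divide_distrib algebra_simps)
      then show ?thesis by (simp add: kform_def s_def)
    qed
    also have "\<dots> = kform k ((- s / k m m, m) # L)"
    proof -
      show ?thesis
        using km[of m] unfolding kform_Cons[OF k] s_def[symmetric] using False by (simp add: field_simps)
    qed
    finally show ?thesis using psd by simp
  qed
  moreover have "schur_complement m k j i = cnj (schur_complement m k i j)" for i j
    unfolding schur_complement_def herm[of i j] herm[of i m] herm[of m j]
    using herm[of m m] by (simp add: mult.commute)
  ultimately show ?thesis unfolding psd_kernel_def by blast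
qed

text \<open>Cholesky factorisation, by iterated Schur complements.\<close>

lemma realise_psd_kernel:
  fixes k :: "nat \<Rightarrow> nat \<Rightarrow> complex"
  assumes inf: "infinite_dimensional TYPE('k::complex_hilbert)" and k: "psd_kernel k"
  obtains v :: "nat \<Rightarrow> 'k::complex_hilbert" where "\<And>i j. cinner (v i) (v j) = k i j"
proof -
  obtain e :: "nat \<Rightarrow> 'k" where e: "\<And>i j. cinner (e i) (e j) = (if i = j then 1 else 0)"
    using orthonormal_sequence[OF inf] by blast
  define K where "K = rec_nat k (\<lambda>m. schur_complement m)"
  have K0: "K 0 = k" and KS: "K (Suc m) = schur_complement m (K m)" for m by (auto simp: K_def)
  have psd: "psd_kernel (K m)" for m by (induction m) (auto simp: K0 KS k psd_schur_complement)
  have herm: "K m j i = cnj (K m i j)" for m i j by (rule psd_kernel_herm[OF psd])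
  \<comment> \<open>Eliminated rows stay zero, so the factor is triangular and each
    \<open>v i\<close> is a finite combination, with no question of convergence.\<close>
  have zero: "K m i j = 0" if "i < m" for i j m
    using that
  proof (induction m arbitrary: j)
    case (Suc m)
    show ?case
    proof (cases "i = m")
      case True
      have "K m m j = 0" if "K m m m = 0"
        using psd_kernel_zero[OF psd that, of j] herm[of m m j] by simp
      then show ?thesis using True by (auto simp: KS schur_complement_def)
    next
      case False
      then have "i < m" using Suc.prems by simp
      then show ?thesis using Suc.IH[of j] Suc.IH[of m] by (simp add: KS schur_complement_def)
    qed
  qed simp
  \<comment> \<open>Column \<open>m\<close> of the factor. For a zero pivot the division yields the
    zero column, in agreement with a Schur complement that changes nothing.\<close>
  define l where "l i m = K m i m / of_real (sqrt (Re (K m m m)))" for i m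
  have l0: "l i m = 0" if "i < m" for i m using zero[OF that] by (simp add: l_def)
  have ll: "l i m * cnj (l j m) = K m i j - K (Suc m) i j" for i j m
  proof -
    have "complex_of_real (sqrt (Re (K m m m))) * of_real (sqrt (Re (K m m m))) = K m m m"
      using psd_kernel_diag[OF psd, of m m] by (simp add: of_real_mult[symmetric] del: of_real_mult)
    then have "l i m * cnj (l j m) = K m i m * K m m j / K m m m"
      using herm[of m j m] by (simp add: l_def)
    then show ?thesis by (simp add: KS schur_complement_def)
  qed
  have sum_l: "(\<Sum>m<M. l i m * cnj (l j m)) = k i j - K M i j" for i j M
    by (induction M) (auto simp: K0 ll)
  define v where "v i = (\<Sum>m\<le>i. l i m *\<^sub>C e m)" for i
  have "cinner (v i) (v j) = k i j" for i j
  proof -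
    have "cinner (v i) (v j) = (\<Sum>m\<le>i. \<Sum>n\<le>j. if n = m then l i m * cnj (l j m) else 0)"
      unfolding v_def cinner_sum_left unfolding cinner_sum_right cinner_scaleC_left cinner_scaleC_right e
      by (intro sum.cong refl) auto
    also have "\<dots> = (\<Sum>m\<le>i. l i m * cnj (l j m))"
      by (intro sum.cong refl) (auto simp: l0)
    also have "\<dots> = k i j" using sum_l[of i j "Suc i"] zero[of i "Suc i" j] by (simp add: lessThan_Suc_atMost)
    finally show ?thesis .
  qed
  then show thesis using that by blast
qed

lemma dense_induct:
  assumes "closure D = UNIV" "closed {x. P x}" "\<And>x. x \<in> D \<Longrightarrow> P x"
  shows "P x"
  using closure_minimal[of D "{x. P x}"] assms by auto

lemma bounded_clinear_continuous: "bounded_clinear T \<Longrightarrow> continuous_on A T"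
  by (simp add: bounded_clinear_def linear_continuous_on)

lemma continuous_on_cinner:
  "continuous_on A f \<Longrightarrow> continuous_on A g \<Longrightarrow> continuous_on A (\<lambda>x. cinner (f x) (g x :: 'a::complex_hilbert))"
  by (rule bounded_bilinear.continuous_on[OF bounded_bilinear_cinner])

lemma cinner_sum_list_left: "cinner (\<Sum>x\<leftarrow>L. f x) y = (\<Sum>x\<leftarrow>L. cinner (f x) (y::'a::complex_hilbert))"
  by (induction L) (auto simp: cinner_add_left)

lemma cinner_sum_list_right: "cinner y (\<Sum>x\<leftarrow>L. f x) = (\<Sum>x\<leftarrow>L. cinner (y::'a::complex_hilbert) (f x))"
  by (induction L) (auto simp: cinner_add_right)

lemma bounded_clinear_sum_list: "bounded_clinear T \<Longrightarrow> T (\<Sum>x\<leftarrow>L. f x) = (\<Sum>x\<leftarrow>L. T (f x))"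
  by (induction L) (auto simp: bounded_clinear_add bounded_clinear_zero)

lemma scaleC_sum_list: "c *\<^sub>C (\<Sum>x\<leftarrow>L. f x) = (\<Sum>x\<leftarrow>L. c *\<^sub>C (f x :: 'a::complex_hilbert))"
  by (induction L) (auto simp: scaleC_add_right)

lemma mom_diff_coordinate:
  "mom a (P(i := p - q)) = mom a (P(i := p)) - mom a (P(i := q))"
proof -
  define D where "D j = (if j = i then max (degree p) (degree q) else degree (P j))" for j
  have "mom a (P(i := r)) = (\<Sum>k\<in>PiE UNIV (\<lambda>j. {..D j}). of_real (coeff r (k i) * (\<Prod>j\<in>UNIV - {i}. coeff (P j) (k j))) * a k)"
    if "degree r \<le> D i" for r
  proof -
    have "(\<Prod>j\<in>UNIV. coeff ((P(i := r)) j) (k j)) = coeff r (k i) * (\<Prod>j\<in>UNIV - {i}. coeff (P j) (k j))" for k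
    proof -
      have "(\<Prod>j\<in>UNIV. coeff ((P(i := r)) j) (k j)) = coeff ((P(i := r)) i) (k i) * (\<Prod>j\<in>UNIV - {i}. coeff ((P(i := r)) j) (k j))"
        by (rule prod.remove) auto
      also have "(\<Prod>j\<in>UNIV - {i}. coeff ((P(i := r)) j) (k j)) = (\<Prod>j\<in>UNIV - {i}. coeff (P j) (k j))"
        by (rule prod.cong) auto
      finally show ?thesis by simp
    qed
    then show ?thesis
      using that by (subst mom_degree_le[where D = D]) (auto simp: D_def)
  qed
  moreover have "degree p \<le> D i" "degree q \<le> D i" "degree (p - q) \<le> D i"
    by (auto simp: D_def degree_diff_le_max)
  ultimately show ?thesis
    by (simp add: sum_subtractf[symmetric] algebra_simps)
qed

section \<open>Operators on the space of the kernel\<close>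

context completely_hypercontractive
begin

text \<open>The polynomial 1 - t_i gives the defect form of \<open>S i\<close>; inserted into the
  kernel inequality it makes the extended operators contractive.\<close>

lemma L_defect: "L u v ((\<lambda>_. 1)(i := [:1, -1:])) = cinner u v - cinner (S i u) (S i v)"
proof -
  have "[:1, -1:] = (1 :: real poly) - monom 1 1" by (simp add: monom_altdef one_pCons)
  then have "L u v ((\<lambda>_. 1)(i := [:1, -1:])) = L u v ((\<lambda>_. 1)(i := 1)) - L u v ((\<lambda>_. 1)(i := monom 1 1))"
    unfolding L_def by (simp only: mom_diff_coordinate)
  also have "(\<lambda>_. 1)(i := 1) = (\<lambda>_::'n. 1 :: real poly)" by auto
  also have "(\<lambda>_. 1)(i := monom 1 1) = (\<lambda>j. monom (1::real) (if j = i then 1 else 0))" by (auto simp: fun_eq_iff)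
  also have "L u v (\<lambda>j. monom (1::real) (if j = i then 1 else 0)) = cinner (S i u) (S i v)"
    unfolding L_def mom_monom using mpow_single[of i 1] by simp
  finally show ?thesis unfolding L_one .
qed

text \<open>Lists match the way in which elements of the spans are written below, as sums over lists
  of pairs.\<close>

lemma kernel_pos_list:
  assumes "\<And>i t. 0 \<le> t \<Longrightarrow> t \<le> 1 \<Longrightarrow> 0 \<le> poly (h i) t \<and> poly (h i) t \<le> 1"
  shows "0 \<le> Re (\<Sum>(\<alpha>, x)\<leftarrow>A. \<Sum>(\<beta>, y)\<leftarrow>A. L (mpow S \<beta> x) (mpow S \<alpha> y) h)"
proof -
  have "(\<Sum>(\<alpha>, x)\<leftarrow>A. \<Sum>(\<beta>, y)\<leftarrow>A. L (mpow S \<beta> x) (mpow S \<alpha> y) h) =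
      (\<Sum>k\<in>{0..<length A}. \<Sum>l\<in>{0..<length A}. L (mpow S (fst (A ! l)) (snd (A ! k))) (mpow S (fst (A ! k)) (snd (A ! l))) h)"
    by (simp add: sum_list_sum_nth case_prod_beta)
  then show ?thesis
    using kernel_pos[of "{0..<length A}" h "\<lambda>k. fst (A ! k)" "\<lambda>k. snd (A ! k)"] assms by simp
qed

text \<open>\<open>j \<alpha> x\<close> plays the part of N^{*\<alpha>} x. Only the indices formed
  by a multi-index and a member of a dense sequence are realised; boundedness for fixed \<alpha>
  carries the map to all \<open>x\<close>.\<close>

lemma kernel_embedding:
  assumes inf: "infinite_dimensional TYPE('k::complex_hilbert)"
    and sep: "separable_space (euclidean :: 'a topology)"
  obtains j :: "('n \<Rightarrow> nat) \<Rightarrow> 'a \<Rightarrow> 'k::complex_hilbert" where "\<And>\<alpha>. bounded_clinear (j \<alpha>)"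
    "\<And>\<alpha> \<beta> x y. cinner (j \<alpha> x) (j \<beta> y) = cinner (mpow S \<beta> x) (mpow S \<alpha> y)"
proof -
  obtain D :: "'a set" where D: "countable D" "closure D = UNIV"
    using sep by (auto simp: separable_space_def)
  then have "D \<noteq> {}" by auto
  define d where "d = from_nat_into D"
  have d: "range d = D" unfolding d_def using D(1) \<open>D \<noteq> {}\<close> by (rule range_from_nat_into[rotated])
  \<comment> \<open>Multi-indices over finitely many coordinates are countable, so their pairs with
    positions in the dense sequence can be enumerated.\<close>
  define ix :: "nat \<Rightarrow> ('n \<Rightarrow> nat) \<times> 'a" where "ix s = (let (\<alpha>, n) = from_nat s in (\<alpha>, d n))" for s
  define k where "k s t = cinner (mpow S (fst (ix t)) (snd (ix s))) (mpow S (fst (ix s)) (snd (ix t)))" for s t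
  have "psd_kernel k"
    unfolding psd_kernel_def
  proof (intro conjI allI)
    show "k j i = cnj (k i j)" for i j unfolding k_def by (rule cinner_commute)
    show "0 \<le> Re (kform k A)" for A
    proof -
      have "kform k A = (\<Sum>(\<alpha>, x)\<leftarrow>map (\<lambda>(c, s). (fst (ix s), c *\<^sub>C snd (ix s))) A.
          \<Sum>(\<beta>, y)\<leftarrow>map (\<lambda>(c, s). (fst (ix s), c *\<^sub>C snd (ix s))) A. L (mpow S \<beta> x) (mpow S \<alpha> y) (\<lambda>_. 1))"
        by (simp add: kform_def k_def L_one o_def case_prod_beta' bounded_clinear_scaleC[OF bounded_mpow]
            cinner_scaleC_left cinner_scaleC_right mult_ac)
      then show ?thesis by (simp only:) (rule kernel_pos_list, simp)
    qed
  qed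
  then obtain v :: "nat \<Rightarrow> 'k" where v: "\<And>s t. cinner (v s) (v t) = k s t"
    using realise_psd_kernel[OF inf] by blast
  have "\<exists>T. bounded_clinear T \<and> (\<forall>n. T (d n) = v (to_nat (\<alpha>, n)))" for \<alpha> :: "'n \<Rightarrow> nat"
  proof -
    define G where "G = range (\<lambda>A. (\<Sum>(c, n)\<leftarrow>A. c *\<^sub>C d n, \<Sum>(c, n)\<leftarrow>A. c *\<^sub>C v (to_nat (\<alpha>, n))))"
    obtain C where C: "C \<ge> 0" "\<And>x. norm (mpow S \<alpha> x) \<le> C * norm x"
      using bounded_clinear_bounded[OF bounded_mpow] by blast
    obtain T where T: "bounded_clinear T" "\<And>x w. (x, w) \<in> G \<Longrightarrow> T x = w"
    proof (rule bounded_clinear_extension[of G C])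
      show "(0, 0) \<in> G" unfolding G_def by (rule range_eqI[of _ _ "[]"]) simp
      show "(x + x', w + w') \<in> G" if "(x, w) \<in> G" "(x', w') \<in> G" for x w x' w'
      proof -
        obtain A B where "(x, w) = (\<Sum>(c, n)\<leftarrow>A. c *\<^sub>C d n, \<Sum>(c, n)\<leftarrow>A. c *\<^sub>C v (to_nat (\<alpha>, n)))"
          "(x', w') = (\<Sum>(c, n)\<leftarrow>B. c *\<^sub>C d n, \<Sum>(c, n)\<leftarrow>B. c *\<^sub>C v (to_nat (\<alpha>, n)))"
          using \<open>(x, w) \<in> G\<close> \<open>(x', w') \<in> G\<close> unfolding G_def by auto
        then show ?thesis unfolding G_def by (intro range_eqI[of _ _ "A @ B"]) simp
      qed
      show "(b *\<^sub>C x, b *\<^sub>C w) \<in> G" if "(x, w) \<in> G" for b x w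
      proof -
        obtain A where "(x, w) = (\<Sum>(c, n)\<leftarrow>A. c *\<^sub>C d n, \<Sum>(c, n)\<leftarrow>A. c *\<^sub>C v (to_nat (\<alpha>, n)))"
          using \<open>(x, w) \<in> G\<close> unfolding G_def by auto
        then show ?thesis unfolding G_def
          by (intro range_eqI[of _ _ "map (\<lambda>(c, n). (b * c, n)) A"])
            (simp add: scaleC_sum_list o_def case_prod_beta scaleC_scaleC)
      qed
      show "norm w \<le> C * norm x" if xw: "(x, w) \<in> G" for x w
      proof -
        obtain A where A: "x = (\<Sum>(c, n)\<leftarrow>A. c *\<^sub>C d n)" "w = (\<Sum>(c, n)\<leftarrow>A. c *\<^sub>C v (to_nat (\<alpha>, n)))"
          using xw unfolding G_def by auto
        \<comment> \<open>All terms carry the same \<alpha>, so the kernel collapses to the inner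
          product of S^\<alpha> x with itself.\<close>
        have "cinner w w = cinner (mpow S \<alpha> x) (mpow S \<alpha> x)"
          by (simp add: A case_prod_beta cinner_sum_list_left cinner_sum_list_right cinner_scaleC_left
              cinner_scaleC_right v k_def ix_def bounded_clinear_sum_list[OF bounded_mpow] bounded_clinear_scaleC[OF bounded_mpow])
        then have "norm w = norm (mpow S \<alpha> x)"
          by (simp add: cinner_self power2_eq_iff_nonneg del: of_real_power)
        then show ?thesis using C(2) by simp
      qed
    qed (use C in auto)
    have "(d n, v (to_nat (\<alpha>, n))) \<in> G" for n
      unfolding G_def by (rule range_eqI[of _ _ "[(1, n)]"]) simp
    then show ?thesis using T by blast
  qed
  then obtain j :: "('n \<Rightarrow> nat) \<Rightarrow> 'a \<Rightarrow> 'k" where j: "\<And>\<alpha>. bounded_clinear (j \<alpha>)" "\<And>\<alpha> n. j \<alpha> (d n) = v (to_nat (\<alpha>, n))"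
    by metis
  \<comment> \<open>The inner product formula is extended from the dense sequence by continuity, one
    argument at a time.\<close>
  have c1: "cinner (j \<alpha> x) (j \<beta> (d n)) = cinner (mpow S \<beta> x) (mpow S \<alpha> (d n))" for \<alpha> \<beta> x n
  proof (rule dense_induct[OF D(2), of _ x])
    show "closed {x. cinner (j \<alpha> x) (j \<beta> (d n)) = cinner (mpow S \<beta> x) (mpow S \<alpha> (d n))}"
      by (intro closed_Collect_eq continuous_on_cinner bounded_clinear_continuous j bounded_mpow continuous_on_const)
    show "cinner (j \<alpha> x) (j \<beta> (d n)) = cinner (mpow S \<beta> x) (mpow S \<alpha> (d n))" if "x \<in> D" for x
      using that d by (auto simp: j v k_def ix_def)
  qed
  have "cinner (j \<alpha> x) (j \<beta> y) = cinner (mpow S \<beta> x) (mpow S \<alpha> y)" for \<alpha> \<beta> x y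
  proof (rule dense_induct[OF D(2), of _ y])
    show "closed {y. cinner (j \<alpha> x) (j \<beta> y) = cinner (mpow S \<beta> x) (mpow S \<alpha> y)}"
      by (intro closed_Collect_eq continuous_on_cinner bounded_clinear_continuous j bounded_mpow continuous_on_const)
    show "cinner (j \<alpha> x) (j \<beta> y) = cinner (mpow S \<beta> x) (mpow S \<alpha> y)" if "y \<in> D" for y
      using that d c1 by auto
  qed
  with j(1) show thesis using that by blast
qed

text \<open>\<open>N i\<close> applies \<open>S i\<close> to the vector and \<open>C i\<close>
  raises the multi-index, just as N_i and its adjoint act on the vectors N^{*\<alpha>} x. Both are
  well defined because they are contractive on finite combinations.\<close>

lemma normal_operators:
  assumes inf: "infinite_dimensional TYPE('k::complex_hilbert)"
    and sep: "separable_space (euclidean :: 'a topology)"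
  obtains j :: "('n \<Rightarrow> nat) \<Rightarrow> 'a \<Rightarrow> 'k::complex_hilbert" and N C :: "'n \<Rightarrow> 'k \<Rightarrow> 'k"
  where "\<And>\<alpha>. bounded_clinear (j \<alpha>)"
    "\<And>\<alpha> \<beta> x y. cinner (j \<alpha> x) (j \<beta> y) = cinner (mpow S \<beta> x) (mpow S \<alpha> y)"
    "\<And>i. bounded_clinear (N i)" "\<And>i. bounded_clinear (C i)"
    "\<And>i \<alpha> x. N i (j \<alpha> x) = j \<alpha> (S i x)" "\<And>i \<alpha> x. C i (j \<alpha> x) = j (\<alpha>(i := Suc (\<alpha> i))) x"
    "\<And>i y. norm (N i y) \<le> norm y"
    "\<And>i y. (\<And>\<alpha> x. cinner y (j \<alpha> x) = 0) \<Longrightarrow> N i y = 0"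
    "\<And>i y. (\<And>\<alpha> x. cinner y (j \<alpha> x) = 0) \<Longrightarrow> C i y = 0"
proof -
  obtain j :: "('n \<Rightarrow> nat) \<Rightarrow> 'a \<Rightarrow> 'k" where j: "\<And>\<alpha>. bounded_clinear (j \<alpha>)"
    and jj: "\<And>\<alpha> \<beta> x y. cinner (j \<alpha> x) (j \<beta> y) = cinner (mpow S \<beta> x) (mpow S \<alpha> y)"
    using kernel_embedding[OF inf sep] by blast
  have norm_sum: "(norm (\<Sum>(\<alpha>, x)\<leftarrow>A. j \<alpha> x))\<^sup>2 = Re (\<Sum>(\<alpha>, x)\<leftarrow>A. \<Sum>(\<beta>, y)\<leftarrow>A. cinner (mpow S \<beta> x) (mpow S \<alpha> y))" for A
    unfolding Re_cinner_self[symmetric] case_prod_beta' cinner_sum_list_left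
    unfolding cinner_sum_list_right jj ..
  have S_mpow: "mpow S \<beta> (S i x) = S i (mpow S \<beta> x)" for \<beta> i x
    using fpow_funpow[where A = UNIV and \<alpha> = \<beta> and i = i and m = 1 and x = x] by simp
  have mpow_upd: "mpow S (\<beta>(i := Suc (\<beta> i))) x = mpow S \<beta> (S i x)" for \<beta> i x
  proof -
    have "\<beta>(i := Suc (\<beta> i)) = (\<lambda>l. \<beta> l + (if l = i then 1 else 0))" by auto
    then show ?thesis using mpow_add[of \<beta> "\<lambda>l. if l = i then 1 else 0" x] mpow_single[of i 1 x] by simp
  qed
  \<comment> \<open>The difference of the two sides is the kernel sum for the polynomial 1 -
    t_i.\<close>
  have contr: "(norm (\<Sum>(\<alpha>, x)\<leftarrow>A. j \<alpha> (S i x)))\<^sup>2 \<le> (norm (\<Sum>(\<alpha>, x)\<leftarrow>A. j \<alpha> x))\<^sup>2" for A i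
  proof -
    have "(\<Sum>(\<alpha>, x)\<leftarrow>A. \<Sum>(\<beta>, y)\<leftarrow>A. L (mpow S \<beta> x) (mpow S \<alpha> y) ((\<lambda>_. 1)(i := [:1, -1:]))) =
        (\<Sum>(\<alpha>, x)\<leftarrow>A. \<Sum>(\<beta>, y)\<leftarrow>A. cinner (mpow S \<beta> x) (mpow S \<alpha> y)) -
        (\<Sum>(\<alpha>, x)\<leftarrow>A. \<Sum>(\<beta>, y)\<leftarrow>A. cinner (mpow S \<beta> (S i x)) (mpow S \<alpha> (S i y)))"
      unfolding L_defect S_mpow[symmetric] by (simp add: case_prod_beta' sum_list_subtractf)
    moreover have "(\<Sum>(\<alpha>, x)\<leftarrow>map (\<lambda>(\<alpha>, x). (\<alpha>, S i x)) A. \<Sum>(\<beta>, y)\<leftarrow>map (\<lambda>(\<alpha>, x). (\<alpha>, S i x)) A. cinner (mpow S \<beta> x) (mpow S \<alpha> y))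
        = (\<Sum>(\<alpha>, x)\<leftarrow>A. \<Sum>(\<beta>, y)\<leftarrow>A. cinner (mpow S \<beta> (S i x)) (mpow S \<alpha> (S i y)))"
      by (simp add: case_prod_beta' o_def)
    moreover have "(\<Sum>(\<alpha>, x)\<leftarrow>A. j \<alpha> (S i x)) = (\<Sum>(\<alpha>, x)\<leftarrow>map (\<lambda>(\<alpha>, x). (\<alpha>, S i x)) A. j \<alpha> x)"
      by (simp add: case_prod_beta' o_def)
    moreover have "0 \<le> Re (\<Sum>(\<alpha>, x)\<leftarrow>A. \<Sum>(\<beta>, y)\<leftarrow>A. L (mpow S \<beta> x) (mpow S \<alpha> y) ((\<lambda>_. 1)(i := [:1, -1:])))"
      by (rule kernel_pos_list) auto
    ultimately show ?thesis by (simp only: norm_sum) simp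
  qed
  \<comment> \<open>Normality in its metric form: on finite combinations N_i and its adjoint produce
    vectors of equal norm, so contractivity of one gives that of the other.\<close>
  have shift: "(norm (\<Sum>(\<alpha>, x)\<leftarrow>A. j (\<alpha>(i := Suc (\<alpha> i))) x))\<^sup>2 = (norm (\<Sum>(\<alpha>, x)\<leftarrow>A. j \<alpha> (S i x)))\<^sup>2" for A i
  proof -
    have "(\<Sum>(\<alpha>, x)\<leftarrow>A. j (\<alpha>(i := Suc (\<alpha> i))) x) = (\<Sum>(\<alpha>, x)\<leftarrow>map (\<lambda>(\<alpha>, x). (\<alpha>(i := Suc (\<alpha> i)), x)) A. j \<alpha> x)"
      "(\<Sum>(\<alpha>, x)\<leftarrow>A. j \<alpha> (S i x)) = (\<Sum>(\<alpha>, x)\<leftarrow>map (\<lambda>(\<alpha>, x). (\<alpha>, S i x)) A. j \<alpha> x)"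
      by (simp_all add: case_prod_beta' o_def)
    then show ?thesis
      by (simp only: norm_sum) (simp add: case_prod_beta' o_def mpow_upd)
  qed
  have ext: "\<exists>T. bounded_clinear T \<and> (\<forall>\<alpha> x. T (j \<alpha> x) = j (a \<alpha>) (s x)) \<and> (\<forall>y. norm (T y) \<le> norm y) \<and>
      (\<forall>y. (\<forall>\<alpha> x. cinner y (j \<alpha> x) = 0) \<longrightarrow> T y = 0)"
    if s: "bounded_clinear s" and le: "\<And>A. (norm (\<Sum>(\<alpha>, x)\<leftarrow>A. j (a \<alpha>) (s x)))\<^sup>2 \<le> (norm (\<Sum>(\<alpha>, x)\<leftarrow>A. j \<alpha> x))\<^sup>2"
    for a and s :: "'a \<Rightarrow> 'a"
  proof -
    define G where "G = range (\<lambda>A. (\<Sum>(\<alpha>, x)\<leftarrow>A. j \<alpha> x, \<Sum>(\<alpha>, x)\<leftarrow>A. j (a \<alpha>) (s x)))"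
    have GI: "(j \<alpha> x, j (a \<alpha>) (s x)) \<in> G" for \<alpha> x
      unfolding G_def by (rule range_eqI[of _ _ "[(\<alpha>, x)]"]) simp
    obtain T where T: "bounded_clinear T" "\<And>x w. (x, w) \<in> G \<Longrightarrow> T x = w" "\<And>x. norm (T x) \<le> 1 * norm x"
      "\<And>x. (\<And>v w. (v, w) \<in> G \<Longrightarrow> cinner x v = 0) \<Longrightarrow> T x = 0"
    proof (rule bounded_clinear_extension[of G 1])
      show "(0, 0) \<in> G" unfolding G_def by (rule range_eqI[of _ _ "[]"]) simp
      show "(x + x', w + w') \<in> G" if xw: "(x, w) \<in> G" "(x', w') \<in> G" for x w x' w'
      proof -
        obtain A B where "(x, w) = (\<Sum>(\<alpha>, x)\<leftarrow>A. j \<alpha> x, \<Sum>(\<alpha>, x)\<leftarrow>A. j (a \<alpha>) (s x))"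
          "(x', w') = (\<Sum>(\<alpha>, x)\<leftarrow>B. j \<alpha> x, \<Sum>(\<alpha>, x)\<leftarrow>B. j (a \<alpha>) (s x))"
          using xw unfolding G_def by auto
        then show ?thesis unfolding G_def by (intro range_eqI[of _ _ "A @ B"]) simp
      qed
      show "(b *\<^sub>C x, b *\<^sub>C w) \<in> G" if xw: "(x, w) \<in> G" for b x w
      proof -
        obtain A where "(x, w) = (\<Sum>(\<alpha>, x)\<leftarrow>A. j \<alpha> x, \<Sum>(\<alpha>, x)\<leftarrow>A. j (a \<alpha>) (s x))"
          using xw unfolding G_def by auto
        then show ?thesis unfolding G_def
          by (intro range_eqI[of _ _ "map (\<lambda>(\<alpha>, x). (\<alpha>, b *\<^sub>C x)) A"])
            (simp add: scaleC_sum_list o_def case_prod_beta' bounded_clinear_scaleC[OF j] bounded_clinear_scaleC[OF s])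
      qed
      show "norm w \<le> 1 * norm x" if xw: "(x, w) \<in> G" for x w
      proof -
        obtain A where A: "x = (\<Sum>(\<alpha>, x)\<leftarrow>A. j \<alpha> x)" "w = (\<Sum>(\<alpha>, x)\<leftarrow>A. j (a \<alpha>) (s x))"
          using xw unfolding G_def by auto
        show ?thesis using le[of A] unfolding A[symmetric] by (simp add: power2_le_iff_abs_le)
      qed
    qed auto
    have "T y = 0" if y: "\<forall>\<alpha> x. cinner y (j \<alpha> x) = 0" for y
    proof (rule T(4))
      show "cinner y v = 0" if vw: "(v, w) \<in> G" for v w
      proof -
        obtain A where "v = (\<Sum>(\<alpha>, x)\<leftarrow>A. j \<alpha> x)" using vw unfolding G_def by auto
        then show ?thesis using y by (simp add: cinner_sum_list_right case_prod_beta')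
      qed
    qed
    then show ?thesis using T(1-3) GI by (intro exI[of _ T]) auto
  qed
  have "\<exists>T. bounded_clinear T \<and> (\<forall>\<alpha> x. T (j \<alpha> x) = j \<alpha> (S i x)) \<and> (\<forall>y. norm (T y) \<le> norm y) \<and>
      (\<forall>y. (\<forall>\<alpha> x. cinner y (j \<alpha> x) = 0) \<longrightarrow> T y = 0)" for i
    using ext[OF bounded[of i], of "\<lambda>\<alpha>. \<alpha>"] contr by simp
  then obtain N where N: "\<And>i. bounded_clinear (N i)" "\<And>i \<alpha> x. N i (j \<alpha> x) = j \<alpha> (S i x)" "\<And>i y. norm (N i y) \<le> norm y"
    "\<And>i y. (\<And>\<alpha> x. cinner y (j \<alpha> x) = 0) \<Longrightarrow> N i y = 0"
    by metis
  have "\<exists>T. bounded_clinear T \<and> (\<forall>\<alpha> x. T (j \<alpha> x) = j (\<alpha>(i := Suc (\<alpha> i))) x) \<and> (\<forall>y. norm (T y) \<le> norm y) \<and>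
      (\<forall>y. (\<forall>\<alpha> x. cinner y (j \<alpha> x) = 0) \<longrightarrow> T y = 0)" for i
    using ext[OF bounded_clinear_id, of "\<lambda>\<alpha>. \<alpha>(i := Suc (\<alpha> i))"] contr[of i] shift[of i] by simp
  then obtain C where C: "\<And>i. bounded_clinear (C i)" "\<And>i \<alpha> x. C i (j \<alpha> x) = j (\<alpha>(i := Suc (\<alpha> i))) x"
    "\<And>i y. (\<And>\<alpha> x. cinner y (j \<alpha> x) = 0) \<Longrightarrow> C i y = 0"
    by metis
  from j jj N C show thesis by (intro that[of j N C]) auto
qed

end

text \<open>The component of \<open>y\<close> orthogonal to the closed subspace where
  \<open>P\<close> holds is in particular orthogonal to \<open>R\<close>, so \<open>perp\<close>
  applies to it, and \<open>P\<close> is additive.\<close>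

lemma total_induct:
  fixes R :: "'a::complex_hilbert set"
  assumes sub: "complex_vector.subspace {y. P y}" and cl: "closed {y. P y}"
    and R: "\<And>r. r \<in> R \<Longrightarrow> P r" and perp: "\<And>u. (\<And>r. r \<in> R \<Longrightarrow> cinner u r = 0) \<Longrightarrow> P u"
  shows "P y"
proof -
  obtain u where u: "P u" "\<And>v. P v \<Longrightarrow> cinner (y - u) v = 0"
    using orthogonal_projection_exists[OF sub cl, of y] by auto
  have "P (y - u)" by (rule perp) (use u(2) R in blast)
  then have "P ((y - u) + u)"
    using complex_vector.subspace_add[OF sub, of "y - u" u] u(1) by simp
  then show ?thesis by simp
qed

subsection \<open>Linear functionals on bounded Borel functions\<close>

definition bounded_borel :: "('x::topological_space \<Rightarrow> complex) \<Rightarrow> bool" where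
  "bounded_borel f \<longleftrightarrow> f \<in> borel_measurable borel \<and> (\<exists>B. \<forall>t. cmod (f t) \<le> B)"

text \<open>Integration against a complex measure, axiomatised by linearity and continuity under
  bounded pointwise convergence. This class is closed under the differences, conjugations and
  multiplications by bounded functions that the identities for spectral measures involve.\<close>

definition sigma_functional :: "(('x::topological_space \<Rightarrow> complex) \<Rightarrow> complex) \<Rightarrow> bool" where
  "sigma_functional \<Phi> \<longleftrightarrow>
     (\<forall>f g. bounded_borel f \<longrightarrow> bounded_borel g \<longrightarrow> \<Phi> (\<lambda>t. f t + g t) = \<Phi> f + \<Phi> g) \<and>
     (\<forall>c f. bounded_borel f \<longrightarrow> \<Phi> (\<lambda>t. c * f t) = c * \<Phi> f) \<and>
     (\<forall>F f B. (\<forall>n. bounded_borel (F n)) \<longrightarrow> bounded_borel f \<longrightarrow> (\<forall>n t. cmod (F n t) \<le> B) \<longrightarrow>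
        (\<forall>t. (\<lambda>n. F n t) \<longlonglongrightarrow> f t) \<longrightarrow> (\<lambda>n. \<Phi> (F n)) \<longlonglongrightarrow> \<Phi> f)"

lemma bounded_borelI: "f \<in> borel_measurable borel \<Longrightarrow> (\<And>t. cmod (f t) \<le> B) \<Longrightarrow> bounded_borel f"
  unfolding bounded_borel_def by blast

lemma bounded_borel_measurable: "bounded_borel f \<Longrightarrow> f \<in> borel_measurable borel"
  by (simp add: bounded_borel_def)

lemma bounded_borel_bound: "bounded_borel f \<Longrightarrow> \<exists>B\<ge>0. \<forall>t. cmod (f t) \<le> B"
  unfolding bounded_borel_def by (meson norm_ge_zero order_trans)

lemma bounded_borel_const: "bounded_borel (\<lambda>_. c)"
  by (rule bounded_borelI[of _ "cmod c"]) auto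

lemma bounded_borel_add: "bounded_borel f \<Longrightarrow> bounded_borel g \<Longrightarrow> bounded_borel (\<lambda>t. f t + g t)"
proof -
  assume f: "bounded_borel f" and g: "bounded_borel g"
  obtain B B' where B: "\<And>t. cmod (f t) \<le> B" "\<And>t. cmod (g t) \<le> B'"
    using bounded_borel_bound[OF f] bounded_borel_bound[OF g] by blast
  show ?thesis
    by (rule bounded_borelI[of _ "B + B'"])
      (auto intro: norm_triangle_le add_mono B borel_measurable_add bounded_borel_measurable f g)
qed

lemma bounded_borel_mult: "bounded_borel f \<Longrightarrow> bounded_borel g \<Longrightarrow> bounded_borel (\<lambda>t. f t * g t)"
proof -
  assume f: "bounded_borel f" and g: "bounded_borel g"
  obtain B B' where B: "B \<ge> 0" "\<And>t. cmod (f t) \<le> B" "\<And>t. cmod (g t) \<le> B'"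
    using bounded_borel_bound[OF f] bounded_borel_bound[OF g] by blast
  show ?thesis
  proof (rule bounded_borelI)
    show "(\<lambda>t. f t * g t) \<in> borel_measurable borel"
      by (intro borel_measurable_times bounded_borel_measurable f g)
    show "cmod (f t * g t) \<le> B * B'" for t
      unfolding norm_mult by (intro mult_mono B norm_ge_zero)
  qed
qed

lemma bounded_borel_cnj: "bounded_borel f \<Longrightarrow> bounded_borel (\<lambda>t. cnj (f t))"
  unfolding bounded_borel_def by (auto intro: borel_measurable_continuous_on[OF continuous_on_cnj[OF continuous_on_id]])

lemma bounded_borel_indicator: "A \<in> sets borel \<Longrightarrow> bounded_borel (indicator A :: _ \<Rightarrow> complex)"
  by (rule bounded_borelI[of _ 1]) (auto simp: indicator_def)

lemma bounded_borel_sum: "(\<And>i. i \<in> I \<Longrightarrow> bounded_borel (f i)) \<Longrightarrow> bounded_borel (\<lambda>t. \<Sum>i\<in>I. f i t)"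
  by (induction I rule: infinite_finite_induct) (auto intro: bounded_borel_add bounded_borel_const)

lemma sigma_functional_plus:
  "sigma_functional \<Phi> \<Longrightarrow> bounded_borel f \<Longrightarrow> bounded_borel g \<Longrightarrow> \<Phi> (\<lambda>t. f t + g t) = \<Phi> f + \<Phi> g"
  unfolding sigma_functional_def by (elim conjE) blast

lemma sigma_functional_times:
  "sigma_functional \<Phi> \<Longrightarrow> bounded_borel f \<Longrightarrow> \<Phi> (\<lambda>t. c * f t) = c * \<Phi> f"
  unfolding sigma_functional_def by (elim conjE) blast

lemma sigma_functional_tendsto:
  "sigma_functional \<Phi> \<Longrightarrow> (\<And>n. bounded_borel (F n)) \<Longrightarrow> bounded_borel f \<Longrightarrow> (\<And>n t. cmod (F n t) \<le> B) \<Longrightarrow>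
     (\<And>t. (\<lambda>n. F n t) \<longlonglongrightarrow> f t) \<Longrightarrow> (\<lambda>n. \<Phi> (F n)) \<longlonglongrightarrow> \<Phi> f"
  unfolding sigma_functional_def by (elim conjE) blast

lemma sigma_functional_zero: "sigma_functional \<Phi> \<Longrightarrow> \<Phi> (\<lambda>_. 0) = 0"
  using sigma_functional_times[of \<Phi> "\<lambda>_. 0" 0] by (simp add: bounded_borel_const)

lemma sigma_functional_sum:
  assumes "sigma_functional \<Phi>" "\<And>i. i \<in> I \<Longrightarrow> bounded_borel (f i)"
  shows "\<Phi> (\<lambda>t. \<Sum>i\<in>I. f i t) = (\<Sum>i\<in>I. \<Phi> (f i))"
  using assms(2)
proof (induction I rule: infinite_finite_induct)
  case (insert i I)
  then show ?case
    using sigma_functional_plus[OF assms(1), of "f i" "\<lambda>t. \<Sum>i\<in>I. f i t"] by (simp add: bounded_borel_sum)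
qed (simp_all add: sigma_functional_zero[OF assms(1)])

lemma sigma_functional_diff:
  assumes "sigma_functional \<Phi>" "sigma_functional \<Psi>"
  shows "sigma_functional (\<lambda>f. \<Phi> f - \<Psi> f)"
  unfolding sigma_functional_def
  by (auto simp: sigma_functional_plus[OF assms(1)] sigma_functional_plus[OF assms(2)]
      sigma_functional_times[OF assms(1)] sigma_functional_times[OF assms(2)] right_diff_distrib
      intro!: tendsto_diff sigma_functional_tendsto[OF assms(1)] sigma_functional_tendsto[OF assms(2)])

lemma sigma_functional_add:
  assumes "sigma_functional \<Phi>" "sigma_functional \<Psi>"
  shows "sigma_functional (\<lambda>f. \<Phi> f + \<Psi> f)"
  unfolding sigma_functional_def
  by (auto simp: sigma_functional_plus[OF assms(1)] sigma_functional_plus[OF assms(2)]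
      sigma_functional_times[OF assms(1)] sigma_functional_times[OF assms(2)] distrib_left
      intro!: tendsto_add sigma_functional_tendsto[OF assms(1)] sigma_functional_tendsto[OF assms(2)])

lemma sigma_functional_cmult:
  assumes "sigma_functional \<Phi>"
  shows "sigma_functional (\<lambda>f. c * \<Phi> f)"
  unfolding sigma_functional_def
  by (auto simp: sigma_functional_plus[OF assms(1)] sigma_functional_times[OF assms(1)] distrib_left
      intro!: tendsto_mult tendsto_const sigma_functional_tendsto[OF assms(1)])

lemma sigma_functional_mult:
  assumes \<Phi>: "sigma_functional \<Phi>" and h: "bounded_borel h"
  shows "sigma_functional (\<lambda>f. \<Phi> (\<lambda>t. h t * f t))"
  unfolding sigma_functional_def
proof (intro conjI allI impI)
  fix f g :: "'a \<Rightarrow> complex" and c assume f: "bounded_borel f"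
  show "\<Phi> (\<lambda>t. h t * (c * f t)) = c * \<Phi> (\<lambda>t. h t * f t)"
    using sigma_functional_times[OF \<Phi> bounded_borel_mult[OF h f], of c] by (simp add: mult.left_commute)
  assume g: "bounded_borel g"
  show "\<Phi> (\<lambda>t. h t * (f t + g t)) = \<Phi> (\<lambda>t. h t * f t) + \<Phi> (\<lambda>t. h t * g t)"
    using sigma_functional_plus[OF \<Phi> bounded_borel_mult[OF h f] bounded_borel_mult[OF h g]] by (simp add: distrib_left)
next
  fix F :: "nat \<Rightarrow> 'a \<Rightarrow> complex" and f B
  assume F: "\<forall>n. bounded_borel (F n)" "bounded_borel f" "\<forall>n t. cmod (F n t) \<le> B" "\<forall>t. (\<lambda>n. F n t) \<longlonglongrightarrow> f t"
  obtain C where C: "C \<ge> 0" "\<And>t. cmod (h t) \<le> C" using bounded_borel_bound[OF h] by blast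
  show "(\<lambda>n. \<Phi> (\<lambda>t. h t * F n t)) \<longlonglongrightarrow> \<Phi> (\<lambda>t. h t * f t)"
    by (rule sigma_functional_tendsto[OF \<Phi>, where B = "C * B"])
      (use F C in \<open>auto intro!: bounded_borel_mult h tendsto_intros mult_mono simp: norm_mult\<close>)
qed

lemma sigma_functional_cnj:
  assumes \<Phi>: "sigma_functional \<Phi>"
  shows "sigma_functional (\<lambda>f. cnj (\<Phi> (\<lambda>t. cnj (f t))))"
  unfolding sigma_functional_def
proof (intro conjI allI impI)
  fix F :: "nat \<Rightarrow> 'a \<Rightarrow> complex" and f B
  assume F: "\<forall>n. bounded_borel (F n)" "bounded_borel f" "\<forall>n t. cmod (F n t) \<le> B" "\<forall>t. (\<lambda>n. F n t) \<longlonglongrightarrow> f t"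
  have "(\<lambda>n. \<Phi> (\<lambda>t. cnj (F n t))) \<longlonglongrightarrow> \<Phi> (\<lambda>t. cnj (f t))"
    by (rule sigma_functional_tendsto[OF \<Phi>, where B = B]) (use F in \<open>auto intro: bounded_borel_cnj tendsto_cnj\<close>)
  then show "(\<lambda>n. cnj (\<Phi> (\<lambda>t. cnj (F n t)))) \<longlonglongrightarrow> cnj (\<Phi> (\<lambda>t. cnj (f t)))"
    by (rule tendsto_cnj)
qed (simp_all add: sigma_functional_plus[OF \<Phi>] sigma_functional_times[OF \<Phi>] bounded_borel_cnj)

lemma integrable_bounded_borel:
  assumes "finite_measure M" "sets M = sets borel" "bounded_borel f"
  shows "integrable M f"
proof -
  interpret finite_measure M by fact
  obtain B where "\<And>t. cmod (f t) \<le> B" using bounded_borel_bound[OF assms(3)] by blast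
  then show ?thesis
    using bounded_borel_measurable[OF assms(3)] assms(2)
    by (intro integrable_const_bound[where B = B]) (auto simp: measurable_cong_sets[OF assms(2) refl])
qed

lemma sigma_functional_integral:
  assumes M: "finite_measure M" "sets M = sets borel"
  shows "sigma_functional (\<lambda>f. \<integral>t. f t \<partial>M)"
  unfolding sigma_functional_def
proof (intro conjI allI impI)
  fix F :: "nat \<Rightarrow> 'a \<Rightarrow> complex" and f B
  assume F: "\<forall>n. bounded_borel (F n)" "bounded_borel f" "\<forall>n t. cmod (F n t) \<le> B" "\<forall>t. (\<lambda>n. F n t) \<longlonglongrightarrow> f t"
  have meas: "bounded_borel g \<Longrightarrow> g \<in> borel_measurable M" for g :: "'a \<Rightarrow> complex"
    by (simp add: bounded_borel_measurable measurable_cong_sets[OF M(2) refl])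
  show "(\<lambda>n. \<integral>t. F n t \<partial>M) \<longlonglongrightarrow> (\<integral>t. f t \<partial>M)"
    by (rule integral_dominated_convergence[where w = "\<lambda>_. B"])
      (use F meas finite_measure.integrable_const[OF M(1)] in auto)
qed (simp_all add: integrable_bounded_borel[OF M])

text \<open>Simple functions reduce to indicators; the approximating sequence is dominated by twice
  the bound of \<open>f\<close>, so continuity under bounded convergence applies.\<close>

lemma sigma_functional_eq_0:
  assumes \<Phi>: "sigma_functional \<Phi>" and ind: "\<And>A. A \<in> sets borel \<Longrightarrow> \<Phi> (indicator A) = 0" and f: "bounded_borel f"
  shows "\<Phi> f = 0"
proof -
  obtain B where B: "\<And>t. cmod (f t) \<le> B" using bounded_borel_bound[OF f] by blast
  obtain F where F: "\<And>i. simple_function borel (F i)" "\<And>t. (\<lambda>i. F i t) \<longlonglongrightarrow> f t"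
    "\<And>i t. dist (F i t) 0 \<le> 2 * dist (f t) 0"
    using borel_measurable_implies_sequence_metric[OF bounded_borel_measurable[OF f], of 0] by auto
  have F_bound: "cmod (F i t) \<le> 2 * B" for i t using F(3)[of i t] B[of t] by simp
  have F_bb: "bounded_borel (F i)" for i
    by (rule bounded_borelI[OF borel_measurable_simple_function[OF F(1)] F_bound])
  have "\<Phi> (F i) = 0" for i
  proof -
    have fin: "finite (range (F i))" using F(1)[of i] by (simp add: simple_function_def)
    have sets: "F i -` {y} \<in> sets borel" for y
      using measurable_sets[OF bounded_borel_measurable[OF F_bb[of i]], of "{y}"] by simp
    have "F i = (\<lambda>t. \<Sum>y\<in>range (F i). y * indicator (F i -` {y}) t)"
    proof
      fix t
      have "(\<Sum>y\<in>range (F i). y * indicator (F i -` {y}) t) = (\<Sum>y\<in>range (F i). if y = F i t then y else 0)"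
        by (intro sum.cong refl) (auto simp: indicator_def)
      then show "F i t = (\<Sum>y\<in>range (F i). y * indicator (F i -` {y}) t)"
        using fin by (simp add: sum.delta)
    qed
    then have "\<Phi> (F i) = \<Phi> (\<lambda>t. \<Sum>y\<in>range (F i). y * indicator (F i -` {y}) t)" by (rule arg_cong)
    also have "\<dots> = (\<Sum>y\<in>range (F i). \<Phi> (\<lambda>t. y * indicator (F i -` {y}) t))"
      by (rule sigma_functional_sum[OF \<Phi>])
        (intro bounded_borel_mult bounded_borel_const bounded_borel_indicator sets)
    also have "\<dots> = 0"
      by (intro sum.neutral ballI)
        (simp add: sigma_functional_times[OF \<Phi> bounded_borel_indicator[OF sets]] ind[OF sets])
    finally show ?thesis .
  qed
  moreover have "(\<lambda>i. \<Phi> (F i)) \<longlonglongrightarrow> \<Phi> f"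
    by (rule sigma_functional_tendsto[OF \<Phi> F_bb f F_bound F(2)])
  ultimately show ?thesis by (simp add: LIMSEQ_const_iff)
qed

text \<open>Cut off at the unit cube, monomials become bounded and thus admissible arguments of the
  functionals, and products of them keep this form.\<close>

definition cube_monom :: "('d::finite \<Rightarrow> nat) \<Rightarrow> real ^ 'd \<Rightarrow> complex" where
  "cube_monom \<alpha> t = indicator (cbox 0 1) t * of_real (\<Prod>i\<in>UNIV. (t $ i) ^ \<alpha> i)"

lemma bounded_borel_restrict_cube:
  fixes f :: "real ^ 'd::finite \<Rightarrow> real"
  assumes f: "continuous_on UNIV f"
  shows "bounded_borel (\<lambda>t. indicator (cbox 0 1) t * of_real (f t))"
proof -
  have "compact (f ` cbox 0 1)"
    by (rule compact_continuous_image[OF continuous_on_subset[OF f]]) auto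
  then obtain B where B: "\<And>t. t \<in> cbox 0 1 \<Longrightarrow> \<bar>f t\<bar> \<le> B"
    using compact_imp_bounded bounded_iff by (metis imageI real_norm_def)
  have "(\<lambda>t. complex_of_real (f t)) \<in> borel_measurable borel"
    by (rule borel_measurable_continuous_onI) (intro continuous_intros f)
  then show ?thesis
    by (intro bounded_borelI[of _ "\<bar>B\<bar>"] borel_measurable_times)
      (auto simp: indicator_def intro: order_trans[OF B])
qed

lemma bounded_borel_cube_monom: "bounded_borel (cube_monom \<alpha>)"
  unfolding cube_monom_def[abs_def]
  by (rule bounded_borel_restrict_cube) (intro continuous_intros)

lemma cube_monom_mult: "cube_monom \<alpha> t * cube_monom \<beta> t = cube_monom (\<lambda>i. \<alpha> i + \<beta> i) t"
  by (auto simp: cube_monom_def indicator_def power_add prod.distrib)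

text \<open>Determinacy of the moment problem on a compact set: the vanishing passes from monomials
  to continuous functions by Stone-Weierstrass, to closed sets by distance functions, to Borel sets
  by Dynkin's argument and to bounded Borel functions by simple ones.\<close>

lemma sigma_functional_cube_eq_0:
  fixes \<Phi> :: "(real ^ 'd::finite \<Rightarrow> complex) \<Rightarrow> complex"
  assumes \<Phi>: "sigma_functional \<Phi>" and mon: "\<And>\<alpha>. \<Phi> (cube_monom \<alpha>) = 0"
    and supp: "\<And>g. bounded_borel g \<Longrightarrow> (\<And>t. t \<in> cbox 0 1 \<Longrightarrow> g t = 0) \<Longrightarrow> \<Phi> g = 0"
    and f: "bounded_borel f"
  shows "\<Phi> f = 0"
proof -
  define poly where "poly g \<longleftrightarrow> (\<exists>F c. finite F \<and> g = (\<lambda>t. \<Sum>\<alpha>\<in>F. c \<alpha> * (\<Prod>i\<in>UNIV. (t $ i) ^ \<alpha> i)))"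
    for g :: "real ^ 'd \<Rightarrow> real"
  have cont_poly: "continuous_on A g" if "poly g" for A g
    using that unfolding poly_def by (auto intro!: continuous_intros)
  have poly_monom: "poly (\<lambda>t. c * (\<Prod>i\<in>UNIV. (t $ i) ^ \<alpha> i))" for c \<alpha>
    unfolding poly_def by (rule exI[of _ "{\<alpha>}"], rule exI[of _ "\<lambda>_. c"]) simp
  have poly_add: "poly (\<lambda>t. g t + h t)" if "poly g" "poly h" for g h
  proof -
    obtain F c where g: "finite F" "g = (\<lambda>t. \<Sum>\<alpha>\<in>F. c \<alpha> * (\<Prod>i\<in>UNIV. (t $ i) ^ \<alpha> i))"
      using \<open>poly g\<close> unfolding poly_def by auto
    obtain F' c' where h: "finite F'" "h = (\<lambda>t. \<Sum>\<alpha>\<in>F'. c' \<alpha> * (\<Prod>i\<in>UNIV. (t $ i) ^ \<alpha> i))"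
      using \<open>poly h\<close> unfolding poly_def by auto
    have ext: "(\<Sum>\<alpha>\<in>F. c \<alpha> * r \<alpha>) = (\<Sum>\<alpha>\<in>F \<union> F'. (if \<alpha> \<in> F then c \<alpha> else 0) * r \<alpha>)"
      "(\<Sum>\<alpha>\<in>F'. c' \<alpha> * r \<alpha>) = (\<Sum>\<alpha>\<in>F \<union> F'. (if \<alpha> \<in> F' then c' \<alpha> else 0) * r \<alpha>)" for r :: "_ \<Rightarrow> real"
      using g(1) h(1) by (auto intro!: sum.mono_neutral_cong_left)
    show ?thesis
      unfolding poly_def
      by (rule exI[of _ "F \<union> F'"], rule exI[of _ "\<lambda>\<alpha>. (if \<alpha> \<in> F then c \<alpha> else 0) + (if \<alpha> \<in> F' then c' \<alpha> else 0)"])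
        (simp only: g h ext distrib_right sum.distrib finite_Un)
  qed
  have poly_sum: "poly (\<lambda>t. \<Sum>i\<in>I. g i t)" if "finite I" "\<And>i. i \<in> I \<Longrightarrow> poly (g i)" for I :: "('d \<Rightarrow> nat) set" and g
    using that
  proof (induction I rule: finite_induct)
    case empty
    show ?case using poly_monom[of 0 "\<lambda>_. 0"] by simp
  qed (auto intro: poly_add)
  have poly_mult: "poly (\<lambda>t. g t * h t)" if "poly g" "poly h" for g h
  proof -
    obtain F c where g: "finite F" "g = (\<lambda>t. \<Sum>\<alpha>\<in>F. c \<alpha> * (\<Prod>i\<in>UNIV. (t $ i) ^ \<alpha> i))"
      using \<open>poly g\<close> unfolding poly_def by auto
    obtain F' c' where h: "finite F'" "h = (\<lambda>t. \<Sum>\<alpha>\<in>F'. c' \<alpha> * (\<Prod>i\<in>UNIV. (t $ i) ^ \<alpha> i))"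
      using \<open>poly h\<close> unfolding poly_def by auto
    have "(\<lambda>t. g t * h t) = (\<lambda>t. \<Sum>\<alpha>\<in>F. \<Sum>\<beta>\<in>F'. (c \<alpha> * c' \<beta>) * (\<Prod>i\<in>UNIV. (t $ i) ^ (\<alpha> i + \<beta> i)))"
      unfolding g(2) h(2) sum_product power_add prod.distrib by (simp only: mult_ac)
    moreover have "poly (\<lambda>t. \<Sum>\<alpha>\<in>F. \<Sum>\<beta>\<in>F'. (c \<alpha> * c' \<beta>) * (\<Prod>i\<in>UNIV. (t $ i) ^ (\<alpha> i + \<beta> i)))"
      by (intro poly_sum g h poly_monom)
    ultimately show ?thesis by (simp only:)
  qed
  have bb: "bounded_borel (\<lambda>t. indicator (cbox 0 1) t * of_real (g t))" if "continuous_on UNIV g" for g :: "real ^ 'd \<Rightarrow> real"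
    using that by (rule bounded_borel_restrict_cube)
  have \<Phi>_poly: "\<Phi> (\<lambda>t. indicator (cbox 0 1) t * of_real (g t)) = 0" if "poly g" for g
  proof -
    obtain F c where g: "finite F" "g = (\<lambda>t. \<Sum>\<alpha>\<in>F. c \<alpha> * (\<Prod>i\<in>UNIV. (t $ i) ^ \<alpha> i))"
      using \<open>poly g\<close> unfolding poly_def by auto
    have "(\<lambda>t. indicator (cbox 0 1) t * of_real (g t)) = (\<lambda>t. \<Sum>\<alpha>\<in>F. of_real (c \<alpha>) * cube_monom \<alpha> t)"
      by (simp add: g cube_monom_def[abs_def] sum_distrib_left mult_ac)
    then have "\<Phi> (\<lambda>t. indicator (cbox 0 1) t * of_real (g t)) = \<Phi> (\<lambda>t. \<Sum>\<alpha>\<in>F. of_real (c \<alpha>) * cube_monom \<alpha> t)"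
      by (rule arg_cong)
    also have "\<dots> = (\<Sum>\<alpha>\<in>F. \<Phi> (\<lambda>t. of_real (c \<alpha>) * cube_monom \<alpha> t))"
      by (rule sigma_functional_sum[OF \<Phi>]) (intro bounded_borel_mult bounded_borel_const bounded_borel_cube_monom)
    also have "\<dots> = 0"
      by (intro sum.neutral ballI) (simp add: sigma_functional_times[OF \<Phi> bounded_borel_cube_monom] mon)
    finally show ?thesis .
  qed
  have \<Phi>_cont: "\<Phi> (\<lambda>t. indicator (cbox 0 1) t * of_real (g t)) = 0" if g: "continuous_on UNIV g" for g
  proof -
    have "\<exists>p. poly p \<and> (\<forall>t\<in>cbox 0 1. \<bar>g t - p t\<bar> < 1 / real (Suc n))" for n
    proof (rule Stone_Weierstrass_HOL)
      show "poly (\<lambda>x. c)" for c using poly_monom[of c "\<lambda>_. 0"] by simp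
      show "\<exists>p. poly p \<and> p x \<noteq> p y" if xy: "x \<in> cbox 0 1 \<and> y \<in> cbox 0 1 \<and> x \<noteq> y" for x y
      proof -
        obtain l where l: "x $ l \<noteq> y $ l" using xy by (auto simp: vec_eq_iff)
        have "(\<Prod>i\<in>UNIV. (t $ i) ^ (if i = l then 1 else 0)) = t $ l" for t :: "real ^ 'd"
          by (simp add: if_distrib[of "\<lambda>n. _ ^ n"] cong: if_cong)
        then show ?thesis
          using poly_monom[of 1 "\<lambda>i. if i = l then 1 else 0"] l by (intro exI[of _ "\<lambda>t. t $ l"]) simp
      qed
    qed (use cont_poly poly_add poly_mult continuous_on_subset[OF g] in auto)
    then obtain p where p: "\<And>n. poly (p n)" "\<And>n t. t \<in> cbox 0 1 \<Longrightarrow> \<bar>g t - p n t\<bar> < 1 / real (Suc n)"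
      by metis
    obtain B where B: "\<And>t. cmod (indicator (cbox 0 1) t * of_real (g t)) \<le> B"
      using bounded_borel_bound[OF bb[OF g]] by blast
    have "(\<lambda>n. \<Phi> (\<lambda>t. indicator (cbox 0 1) t * of_real (p n t))) \<longlonglongrightarrow> \<Phi> (\<lambda>t. indicator (cbox 0 1) t * of_real (g t))"
    proof (rule sigma_functional_tendsto[OF \<Phi>, where B = "B + 1"])
      show "cmod (indicator (cbox 0 1) t * of_real (p n t)) \<le> B + 1" for n t
      proof (cases "t \<in> cbox 0 1")
        case True
        have "1 / real (Suc n) \<le> 1" by simp
        moreover have "\<bar>g t\<bar> \<le> B" using B[of t] True by simp
        ultimately have "\<bar>p n t\<bar> \<le> B + 1" using p(2)[OF True, of n] by linarith
        then show ?thesis using True by simp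
      qed (use order_trans[OF norm_ge_zero B] in \<open>simp add: indicator_def\<close>)
      show "(\<lambda>n. indicator (cbox 0 1) t * complex_of_real (p n t)) \<longlonglongrightarrow> indicator (cbox 0 1) t * of_real (g t)" for t
      proof (cases "t \<in> cbox 0 1")
        case True
        have "(\<lambda>n. p n t - g t) \<longlonglongrightarrow> 0"
          by (rule Lim_null_comparison[OF _ LIMSEQ_Suc[OF lim_1_over_n]])
            (use p(2)[OF True] in \<open>auto intro!: always_eventually less_imp_le simp: abs_minus_commute\<close>)
        then have "(\<lambda>n. p n t) \<longlonglongrightarrow> g t" by (simp add: LIM_zero_iff)
        then show ?thesis by (intro tendsto_intros)
      qed (simp add: indicator_def)
    qed (use bb cont_poly p(1) g in auto)
    then show ?thesis using \<Phi>_poly[OF p(1)] by (simp add: LIMSEQ_const_iff)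
  qed
  have \<Phi>_restrict: "\<Phi> g = \<Phi> (\<lambda>t. indicator (cbox 0 1) t * g t)" if g: "bounded_borel g" for g
  proof -
    have b1: "bounded_borel (\<lambda>t. indicator (cbox 0 1) t * g t)"
      by (intro bounded_borel_mult bounded_borel_indicator g) simp
    have b2: "bounded_borel (\<lambda>t. indicator (- cbox 0 1) t * g t)"
      by (intro bounded_borel_mult bounded_borel_indicator g) simp
    have "g = (\<lambda>t. indicator (cbox 0 1) t * g t + indicator (- cbox 0 1) t * g t)"
      by (auto simp: indicator_def)
    then have "\<Phi> g = \<Phi> (\<lambda>t. indicator (cbox 0 1) t * g t + indicator (- cbox 0 1) t * g t)" by (rule arg_cong)
    also have "\<dots> = \<Phi> (\<lambda>t. indicator (cbox 0 1) t * g t) + \<Phi> (\<lambda>t. indicator (- cbox 0 1) t * g t)"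
      by (rule sigma_functional_plus[OF \<Phi> b1 b2])
    also have "\<Phi> (\<lambda>t. indicator (- cbox 0 1) t * g t) = 0" by (rule supp[OF b2]) simp
    finally show ?thesis by simp
  qed
  have \<Phi>_closed: "\<Phi> (indicator A) = 0" if A: "closed A" for A
  proof (cases "A = {}")
    case True
    then show ?thesis using sigma_functional_zero[OF \<Phi>] by (simp add: indicator_def[abs_def])
  next
    case False
    \<comment> \<open>Continuous functions decreasing to the indicator of \<open>A\<close>: off the
      closed set the distance is positive and \<open>g n\<close> is eventually 0.\<close>
    define g where "g n t = max 0 (1 - real n * infdist t A)" for n t
    have g: "continuous_on UNIV (g n)" for n unfolding g_def by (intro continuous_intros)
    have g01: "0 \<le> g n t" "g n t \<le> 1" for n t by (auto simp: g_def infdist_nonneg)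
    have gb: "bounded_borel (\<lambda>t. complex_of_real (g n t))" for n
    proof (rule bounded_borelI[of _ 1])
      show "(\<lambda>t. complex_of_real (g n t)) \<in> borel_measurable borel"
        by (rule borel_measurable_continuous_onI) (intro continuous_intros g)
    qed (use g01 in \<open>simp add: abs_of_nonneg\<close>)
    have "(\<lambda>n. \<Phi> (\<lambda>t. of_real (g n t))) \<longlonglongrightarrow> \<Phi> (indicator A)"
    proof (rule sigma_functional_tendsto[OF \<Phi>, where B = 1])
      show "bounded_borel (indicator A)" by (rule bounded_borel_indicator) (use A in simp)
      show "(\<lambda>n. complex_of_real (g n t)) \<longlonglongrightarrow> indicator A t" for t
      proof (cases "t \<in> A")
        case True
        then show ?thesis using False by (simp add: g_def)
      next
        case t: False
        then have pos: "infdist t A > 0"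
          using in_closed_iff_infdist_zero[OF A False] infdist_nonneg[of t A] by (metis order_le_less)
        then obtain n0 where n0: "1 < real n0 * infdist t A" using reals_Archimedean3 by blast
        have "g n t = 0" if "n \<ge> n0" for n
        proof -
          have "real n0 * infdist t A \<le> real n * infdist t A" using that pos by (intro mult_right_mono) auto
          then show ?thesis using n0 by (simp add: g_def)
        qed
        then have "\<forall>\<^sub>F n in sequentially. complex_of_real (g n t) = 0"
          unfolding eventually_sequentially by auto
        then show ?thesis using t by (simp add: tendsto_eventually)
      qed
    qed (use gb g01 in \<open>auto simp: abs_of_nonneg\<close>)
    moreover have "\<Phi> (\<lambda>t. of_real (g n t)) = 0" for n
      unfolding \<Phi>_restrict[OF gb] by (rule \<Phi>_cont[OF g])
    ultimately show ?thesis by (simp add: LIMSEQ_const_iff)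
  qed
  have "\<Phi> (indicator A) = 0" if A: "A \<in> sets borel" for A
  proof -
    have "Int_stable (Collect closed :: (real ^ 'd) set set)" by (auto simp: Int_stable_def)
    moreover have "Collect closed \<subseteq> Pow (UNIV :: (real ^ 'd) set)" by simp
    moreover have "A \<in> sigma_sets UNIV (Collect closed)" using A by (simp add: borel_eq_closed)
    ultimately show ?thesis
    proof (induction rule: sigma_sets_induct_disjoint)
      case (basic A)
      then show ?case using \<Phi>_closed by simp
    next
      case empty
      show ?case by (rule \<Phi>_closed) simp
    next
      case (compl A)
      then have A: "A \<in> sets borel" by (simp add: borel_eq_closed)
      have "(\<lambda>t. indicator UNIV t + (-1) * indicator A t) = (indicator (UNIV - A) :: _ \<Rightarrow> complex)"
        by (auto simp: indicator_def fun_eq_iff)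
      then have "\<Phi> (indicator (UNIV - A)) = \<Phi> (\<lambda>t. indicator UNIV t + (-1) * indicator A t)" by simp
      also have "\<dots> = \<Phi> (indicator UNIV) + (-1) * \<Phi> (indicator A)"
        using A by (simp only: sigma_functional_plus[OF \<Phi>] sigma_functional_times[OF \<Phi>] bounded_borel_indicator
            bounded_borel_mult bounded_borel_const sets.top space_borel[symmetric])
      finally show ?case using compl \<Phi>_closed[of UNIV] by simp
    next
      case (union A)
      then have A: "A k \<in> sets borel" for k by (auto simp: borel_eq_closed)
      have "(\<lambda>n. \<Phi> (\<lambda>t. \<Sum>k<n. indicator (A k) t)) \<longlonglongrightarrow> \<Phi> (indicator (\<Union>k. A k))"
      proof (rule sigma_functional_tendsto[OF \<Phi>, where B = 1])
        have *: "(\<Sum>k<n. indicator (A k) t) = (indicator (\<Union>k<n. A k) t :: complex)" for n t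
          using union(1) by (intro indicator_UN_disjoint[symmetric]) (auto intro: disjoint_family_on_mono)
        show "cmod (\<Sum>k<n. indicator (A k) t) \<le> 1" for n t
          unfolding * by (simp add: indicator_def)
        show "(\<lambda>n. \<Sum>k<n. indicator (A k) t) \<longlonglongrightarrow> (indicator (\<Union>k. A k) t :: complex)" for t
          unfolding * by (rule LIMSEQ_indicator_UN)
        show "bounded_borel (indicator (\<Union>k. A k) :: _ \<Rightarrow> complex)"
          by (rule bounded_borel_indicator) (use A in auto)
      qed (intro bounded_borel_sum bounded_borel_indicator A)
      moreover have "\<Phi> (\<lambda>t. \<Sum>k<n. indicator (A k) t) = 0" for n
        using union(3) by (simp add: sigma_functional_sum[OF \<Phi>] bounded_borel_indicator A)
      ultimately show ?case by (simp add: LIMSEQ_const_iff)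
    qed
  qed
  then show ?thesis by (rule sigma_functional_eq_0[OF \<Phi> _ f])
qed

subsection \<open>Products of commuting positive operators\<close>

definition self_adjoint :: "('k::complex_hilbert \<Rightarrow> 'k) \<Rightarrow> bool" where
  "self_adjoint T \<longleftrightarrow> bounded_clinear T \<and> (\<forall>x y. cinner (T x) y = cinner x (T y))"

definition effect :: "('k::complex_hilbert \<Rightarrow> 'k) \<Rightarrow> bool" where
  "effect T \<longleftrightarrow> self_adjoint T \<and> (\<forall>x. 0 \<le> Re (cinner (T x) x) \<and> Re (cinner (T x) x) \<le> (norm x)\<^sup>2)"

lemma self_adjoint_bounded: "self_adjoint T \<Longrightarrow> bounded_clinear T"
  by (simp add: self_adjoint_def)

lemma self_adjointD: "self_adjoint T \<Longrightarrow> cinner (T x) y = cinner x (T y)"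
  by (simp add: self_adjoint_def)

lemma self_adjoint_Im: "self_adjoint T \<Longrightarrow> Im (cinner (T x) x) = 0"
proof -
  assume "self_adjoint T"
  then have "cinner (T x) x = cnj (cinner (T x) x)"
    using cinner_commute[of x "T x"] self_adjointD[of T x x] by simp
  then have "Im (cinner (T x) x) = Im (cnj (cinner (T x) x))" by (rule arg_cong)
  then show ?thesis by simp
qed

lemma effect_complement:
  assumes "effect T" shows "effect (\<lambda>x. x - T x)"
  using assms unfolding effect_def self_adjoint_def
  by (auto intro: bounded_clinear_minus bounded_clinear_id simp: cinner_diff_left cinner_diff_right Re_cinner_self)

text \<open>Riesz's argument: \<open>A = \<Sum>\<^sub>n A\<^sub>n\<^sup>2\<close> strongly, where \<open>A\<^sub>0 = A\<close> and
  \<open>A\<^sub>n\<^sub>+\<^sub>1 = A\<^sub>n - A\<^sub>n\<^sup>2\<close>.\<close>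

lemma product_positive:
  fixes A B :: "'k::complex_hilbert \<Rightarrow> 'k"
  assumes A: "effect A" and B: "self_adjoint B" "\<And>x. 0 \<le> Re (cinner (B x) x)"
    and AB: "\<And>x. A (B x) = B (A x)"
  shows "0 \<le> Re (cinner (A (B x)) x)"
proof -
  define T where "T = rec_nat A (\<lambda>n f x. f x - f (f x))"
  have T0: "T 0 = A" and TS: "T (Suc n) = (\<lambda>x. T n x - T n (T n x))" for n by (auto simp: T_def)
  have T: "effect (T n) \<and> (\<forall>x. T n (B x) = B (T n x))" for n
  proof (induction n)
    case 0
    show ?case using A AB by (simp add: T0)
  next
    case (Suc n)
    then have e: "effect (T n)" and c: "\<And>x. T n (B x) = B (T n x)" by auto
    then have sa: "self_adjoint (T n)" by (simp add: effect_def)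
    note bd = self_adjoint_bounded[OF sa]
    have "self_adjoint (T (Suc n))"
      unfolding self_adjoint_def TS
      by (auto intro!: bounded_clinear_minus bd bounded_clinear_compose[OF bd bd]
          simp: cinner_diff_left cinner_diff_right self_adjointD[OF sa])
    moreover have "0 \<le> Re (cinner (T (Suc n) x) x)" for x
    proof -
      \<comment> \<open>With A_{n+1} = A_n (1 - A_n), the form <A_{n+1} x, x> is the sum of <A_n w,
        w> and <(1 - A_n) A_n x, A_n x>, both nonnegative.\<close>
      define w where "w = x - T n x"
      have "T (Suc n) x = T n w" by (simp add: TS w_def bounded_clinear_diff[OF bd])
      moreover have "x = T n x + w" by (simp add: w_def)
      ultimately have "cinner (T (Suc n) x) x = cinner (T n w) (T n x) + cinner (T n w) w"
        by (metis cinner_add_right)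
      moreover have "cinner (T n w) (T n x) = cinner (T n x) (T n x) - cinner (T n (T n x)) (T n x)"
        by (simp add: w_def bounded_clinear_diff[OF bd] cinner_diff_left)
      moreover have "Re (cinner (T n (T n x)) (T n x)) \<le> (norm (T n x))\<^sup>2" "0 \<le> Re (cinner (T n w) w)"
        using e by (auto simp: effect_def)
      ultimately show ?thesis by (simp add: Re_cinner_self)
    qed
    moreover have "Re (cinner (T (Suc n) x) x) \<le> (norm x)\<^sup>2" for x
    proof -
      have "Re (cinner (T (Suc n) x) x) = Re (cinner (T n x) x) - (norm (T n x))\<^sup>2"
        by (simp add: TS cinner_diff_left self_adjointD[OF sa, of "T n x" x] Re_cinner_self)
      also have "\<dots> \<le> Re (cinner (T n x) x)" by simp
      also have "\<dots> \<le> (norm x)\<^sup>2" using e by (auto simp: effect_def)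
      finally show ?thesis .
    qed
    moreover have "T (Suc n) (B x) = B (T (Suc n) x)" for x
      by (simp add: TS c bounded_clinear_diff[OF self_adjoint_bounded[OF B(1)]])
    ultimately show ?case by (simp add: effect_def)
  qed
  then have sa: "self_adjoint (T n)" and pos: "0 \<le> Re (cinner (T n x) x)" and c: "T n (B x) = B (T n x)" for n x
    by (auto simp: effect_def)
  \<comment> \<open>Telescoping of A_n^2 = A_n - A_{n+1} bounds the sums of squared norms, hence
    \<open>T n x\<close> tends to 0.\<close>
  have "Re (cinner (T m x) x) + (\<Sum>n<m. (norm (T n x))\<^sup>2) = Re (cinner (A x) x)" for m
  proof (induction m)
    case 0
    show ?case by (simp add: T0)
  next
    case (Suc m)
    have "Re (cinner (T (Suc m) x) x) = Re (cinner (T m x) x) - (norm (T m x))\<^sup>2"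
      by (simp add: TS cinner_diff_left self_adjointD[OF sa, of m "T m x" x] Re_cinner_self)
    then show ?case using Suc by simp
  qed
  then have "(\<Sum>n<m. (norm (T n x))\<^sup>2) \<le> Re (cinner (A x) x)" for m
    using pos[of m x] by (metis add_increasing2 add.commute order_refl add_le_cancel_left le_add_same_cancel2)
  then have "summable (\<lambda>n. (norm (T n x))\<^sup>2)"
    by (intro summableI_nonneg_bounded) auto
  then have "(\<lambda>n. (norm (T n x))\<^sup>2) \<longlonglongrightarrow> 0" by (rule summable_LIMSEQ_zero)
  then have "(\<lambda>n. sqrt ((norm (T n x))\<^sup>2)) \<longlonglongrightarrow> sqrt 0" by (rule tendsto_real_sqrt)
  then have lim: "(\<lambda>n. norm (B x) * norm (T n x)) \<longlonglongrightarrow> 0"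
    using tendsto_mult_right_zero[of "\<lambda>n. norm (T n x)"] by simp
  \<comment> \<open>Each step loses <B A_n x, A_n x> \<ge> 0, so the sequence decreases to its limit
    0 and its initial term is nonnegative.\<close>
  define r where "r n = Re (cinner (T n (B x)) x)" for n
  have "r \<longlonglongrightarrow> 0"
  proof (rule Lim_null_comparison[OF _ lim], intro always_eventually allI)
    fix n
    have "norm (r n) \<le> cmod (cinner (B x) (T n x))"
      unfolding r_def self_adjointD[OF sa] by (simp add: abs_Re_le_cmod)
    also have "\<dots> \<le> norm (B x) * norm (T n x)" by (rule cinner_Cauchy_Schwarz)
    finally show "norm (r n) \<le> norm (B x) * norm (T n x)" .
  qed
  moreover have "r (Suc n) \<le> r n" for n
  proof -
    have "cinner (T n (T n (B x))) x = cinner (T n (B x)) (T n x)" by (rule self_adjointD[OF sa])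
    then have "cinner (T n (T n (B x))) x = cinner (B (T n x)) (T n x)" by (simp only: c)
    then have "cinner (T (Suc n) (B x)) x = cinner (T n (B x)) x - cinner (B (T n x)) (T n x)"
      by (simp add: TS cinner_diff_left)
    then show ?thesis using B(2)[of "T n x"] by (simp add: r_def)
  qed
  then have "r n \<le> r 0" for n by (induction n) (auto intro: order_trans)
  ultimately have "0 \<le> r 0" by (intro LIMSEQ_le_const2[of r 0]) auto
  then show ?thesis by (simp add: r_def T0)
qed

subsection \<open>The spectral theorem for commuting self-adjoint operators\<close>

lemma mom_minus: "mom (\<lambda>j. a j - b j) P = mom a P - mom b P"
  by (simp add: mom_def sum_subtractf right_diff_distrib)

text \<open>The polarisation identity taken as a definition for an arbitrary function
  \<open>q\<close>, usable before \<open>q\<close> is known to be a quadratic form; later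
  \<open>q x\<close> is an integral against the measure of \<open>x\<close>.\<close>

definition polarized :: "('k::complex_hilbert \<Rightarrow> complex) \<Rightarrow> 'k \<Rightarrow> 'k \<Rightarrow> complex" where
  "polarized q x y = (q (x + y) - q (x - y) + \<i> * q (x + \<i> *\<^sub>C y) - \<i> * q (x - \<i> *\<^sub>C y)) / 4"

lemma polarized_form:
  assumes add: "\<And>x y. T (x + y) = T x + T y" and diff: "\<And>x y. T (x - y) = T x - T y" and scale: "\<And>c x. T (c *\<^sub>C x) = c *\<^sub>C T x"
  shows "polarized (\<lambda>x. cinner (T x) x) x y = cinner (T x) y"
  unfolding polarized_def add diff scale
  by (simp add: cinner_add_left cinner_add_right cinner_diff_left cinner_diff_right cinner_scaleC_left
      cinner_scaleC_right algebra_simps)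

lemma polarized_bounded_clinear:
  "bounded_clinear T \<Longrightarrow> polarized (\<lambda>x. cinner (T x) x) x y = cinner (T x) y"
  by (rule polarized_form) (auto simp: bounded_clinear_add bounded_clinear_diff bounded_clinear_scaleC)

section \<open>Scalar measures and spectral projections of commuting operators between 0 and
  1\<close>

locale commuting_effects =
  fixes A :: "'d::finite \<Rightarrow> 'k::complex_hilbert \<Rightarrow> 'k"
  assumes effect: "effect (A i)" and comm: "A i (A j x) = A j (A i x)"
begin

sublocale commuting A by standard (rule comm)

lemma sa: "self_adjoint (A i)"
  using effect by (simp add: effect_def)

lemma bounded_mpow: "bounded_clinear (mpow A \<alpha>)"
  by (rule bounded_clinear_fpow) (auto intro: self_adjoint_bounded sa commuting_axioms)

lemma mpow_adjoint: "cinner (mpow A \<alpha> x) y = cinner x (mpow A \<alpha> y)"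
  by (rule cinner_fpow_adj[OF commuting_axioms commuting_axioms]) (auto intro: self_adjointD sa)

lemma mpow_intertwine:
  assumes "\<And>i x. A i (T x) = T (A i x)" "finite B"
  shows "fpow B A \<alpha> (T x) = T (fpow B A \<alpha> x)"
  using assms(2)
proof (induction B arbitrary: x rule: finite_induct)
  case (insert i B)
  have "(A i ^^ n) (T x) = T ((A i ^^ n) x)" for n x by (induction n) (auto simp: assms(1))
  with insert show ?case by (simp add: fpow_insert)
qed simp

definition mform :: "'k \<Rightarrow> 'k \<Rightarrow> ('d \<Rightarrow> real poly) \<Rightarrow> complex" where
  "mform x y P = mom (\<lambda>\<alpha>. cinner (mpow A \<alpha> x) y) P"

lemma mform_monom: "mform x y (P(i := monom 1 1 * P i)) = mform (A i x) y P"
proof -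
  have "P(i := monom 1 1 * P i) = (\<lambda>j. monom 1 (if j = i then 1 else 0) * P j)" by (auto simp: fun_eq_iff)
  moreover have "mpow A (\<lambda>l. (if l = i then 1 else 0) + j l) x = mpow A j (A i x)" for j
    using mpow_add[of "\<lambda>l. if l = i then 1 else 0" j x] mpow_single[of i 1 "mpow A j x"]
      fpow_funpow[where A = UNIV and \<alpha> = j and i = i and m = 1 and x = x] by simp
  ultimately show ?thesis unfolding mform_def by (simp add: mom_shift)
qed

lemma mform_complement: "mform x y (P(i := [:1, -1:] * P i)) = mform (x - A i x) y P"
proof -
  have "[:1, -1:] * P i = P i - monom 1 1 * P i" by (simp add: monom_altdef)
  then have "mform x y (P(i := [:1, -1:] * P i)) = mform x y (P(i := P i)) - mform x y (P(i := monom 1 1 * P i))"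
    unfolding mform_def by (simp only: mom_diff_coordinate)
  also have "\<dots> = mform (x - A i x) y P"
    unfolding mform_monom
    by (simp add: mform_def mom_minus[symmetric] bounded_clinear_diff[OF bounded_mpow] cinner_diff_left)
  finally show ?thesis .
qed

text \<open>Induction on the number of factors A_i and 1 - A_i. One factor at a time is absorbed
  into \<open>T\<close>, which stays positive by \<open>product_positive\<close> and keeps commuting
  with all A_i; hence the general \<open>T\<close>.\<close>

lemma mform_nonneg_Reals:
  assumes "self_adjoint T" "\<And>x. 0 \<le> Re (cinner (T x) x)" "\<And>i x. A i (T x) = T (A i x)"
  shows "mform (T x) x (\<lambda>i. monom 1 (k i) * [:1, -1:] ^ l i) \<in> \<real>\<^sub>\<ge>\<^sub>0"
  using assms
proof (induction "\<Sum>i\<in>UNIV. k i + l i" arbitrary: k l T x)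
  case 0
  then have "k = (\<lambda>_. 0)" "l = (\<lambda>_. 0)" by (auto simp: fun_eq_iff)
  then have "mform (T x) x (\<lambda>i. monom 1 (k i) * [:1, -1:] ^ l i) = mom (\<lambda>\<alpha>. cinner (mpow A \<alpha> (T x)) x) (\<lambda>i. monom 1 ((\<lambda>_. 0) i))"
    by (simp add: mform_def)
  also have "\<dots> = cinner (T x) x" unfolding mom_monom by simp
  finally show ?case using 0(3)[of x] self_adjoint_Im[OF 0(2), of x] by (simp add: complex_nonneg_Reals_iff)
next
  case (Suc n)
  note T = Suc.prems
  have step: "self_adjoint (\<lambda>x. B (T x)) \<and> (\<forall>x. 0 \<le> Re (cinner (B (T x)) x)) \<and> (\<forall>i x. A i (B (T x)) = B (T (A i x)))"
    if B: "effect B" and BA: "\<And>i x. A i (B x) = B (A i x)" and BT: "\<And>x. B (T x) = T (B x)" for B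
  proof (intro conjI allI)
    have sB: "self_adjoint B" using B by (simp add: effect_def)
    show "self_adjoint (\<lambda>x. B (T x))"
      unfolding self_adjoint_def
      using bounded_clinear_compose[OF self_adjoint_bounded[OF sB] self_adjoint_bounded[OF T(1)]]
      by (auto simp: self_adjointD[OF sB] self_adjointD[OF T(1)] BT)
    show "0 \<le> Re (cinner (B (T x)) x)" for x by (rule product_positive[OF B T(1,2) BT])
    show "A i (B (T x)) = B (T (A i x))" for i x by (simp add: BA T(3))
  qed
  from Suc(2) obtain i where "k i + l i \<noteq> 0" by (metis nat.distinct(1) sum.neutral)
  then consider "k i > 0" | "l i > 0" by linarith
  then show ?case
  proof cases
    case 1
    have "(\<Sum>j\<in>UNIV. k j + l j) = (k i + l i) + (\<Sum>j\<in>UNIV - {i}. k j + l j)" by (rule sum.remove) auto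
    moreover have "(\<Sum>j\<in>UNIV. (k(i := k i - 1)) j + l j) = (k i - 1 + l i) + (\<Sum>j\<in>UNIV - {i}. k j + l j)"
      by (subst sum.remove[of _ i]) (auto intro!: sum.cong)
    ultimately have n: "n = (\<Sum>j\<in>UNIV. (k(i := k i - 1)) j + l j)" using Suc(2) 1 by simp
    define P where "P j = (monom 1 ((k(i := k i - 1)) j) * [:1, -1:] ^ l j :: real poly)" for j
    have P: "P = (\<lambda>j. monom 1 ((k(i := k i - 1)) j) * [:1, -1:] ^ l j)" by (simp add: P_def fun_eq_iff)
    have "(\<lambda>i. monom 1 (k i) * [:1, -1:] ^ l i) = P(i := monom 1 1 * P i)"
      using 1 by (auto simp: fun_eq_iff P_def mult.assoc[symmetric] mult_monom)
    then have "mform (T x) x (\<lambda>i. monom 1 (k i) * [:1, -1:] ^ l i) = mform (A i (T x)) x P"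
      by (simp only: mform_monom)
    moreover have "mform (A i (T x)) x P \<in> \<real>\<^sub>\<ge>\<^sub>0"
      using Suc(1)[OF n, of "\<lambda>x. A i (T x)" x] step[OF effect comm T(3), of i] unfolding P by blast
    ultimately show ?thesis by simp
  next
    case 2
    have "(\<Sum>j\<in>UNIV. k j + l j) = (k i + l i) + (\<Sum>j\<in>UNIV - {i}. k j + l j)" by (rule sum.remove) auto
    moreover have "(\<Sum>j\<in>UNIV. k j + (l(i := l i - 1)) j) = (k i + (l i - 1)) + (\<Sum>j\<in>UNIV - {i}. k j + l j)"
      by (subst sum.remove[of _ i]) (auto intro!: sum.cong)
    ultimately have n: "n = (\<Sum>j\<in>UNIV. k j + (l(i := l i - 1)) j)" using Suc(2) 2 by simp
    define P where "P j = (monom 1 (k j) * [:1, -1:] ^ (l(i := l i - 1)) j :: real poly)" for j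
    have P: "P = (\<lambda>j. monom 1 (k j) * [:1, -1:] ^ (l(i := l i - 1)) j)" by (simp add: P_def fun_eq_iff)
    have "l i = Suc (l i - 1)" using 2 by simp
    then have "[:1, -1:] ^ l i = [:1, -1:] * ([:1, -1:] ^ (l i - 1) :: real poly)"
      by (metis power_Suc)
    then have "monom 1 (k i) * [:1, -1:] ^ l i = [:1, -1:] * P i"
      unfolding P_def by (simp only: fun_upd_same mult.left_commute)
    then have "(\<lambda>i. monom 1 (k i) * [:1, -1:] ^ l i) = P(i := [:1, -1:] * P i)"
      by (auto simp: fun_eq_iff P_def)
    then have "mform (T x) x (\<lambda>i. monom 1 (k i) * [:1, -1:] ^ l i) = mform (T x - A i (T x)) x P"
      by (simp only: mform_complement)
    moreover have "mform (T x - A i (T x)) x P \<in> \<real>\<^sub>\<ge>\<^sub>0"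
    proof -
      have "A j (x - A i x) = A j x - A i (A j x)" "T x - A i (T x) = T (x - A i x)" for j x
        by (simp_all add: bounded_clinear_diff[OF self_adjoint_bounded[OF sa]]
            bounded_clinear_diff[OF self_adjoint_bounded[OF T(1)]] comm[of j i] T(3))
      then show ?thesis
        using Suc(1)[OF n, of "\<lambda>x. T x - A i (T x)" x] step[OF effect_complement[OF effect[of i]]]
        unfolding P by blast
    qed
    ultimately show ?thesis by simp
  qed
qed

text \<open>Bernstein polynomials are multiples of products of powers of t_i and 1 - t_i, so
  \<open>mform_nonneg_Reals\<close> with \<open>T\<close> the identity gives the positivity that the
  moment problem requires.\<close>

lemma spectral_measures_exist:
  "\<exists>M :: (real ^ 'd) measure. sets M = sets borel \<and> finite_measure M \<and> (AE t in M. t \<in> cbox 0 1) \<and>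
     (\<forall>\<alpha>. complex_of_real (\<integral>t. (\<Prod>i\<in>UNIV. (t $ i) ^ \<alpha> i) \<partial>M) = cinner (mpow A \<alpha> x) x)"
proof -
  have id: "self_adjoint (\<lambda>x :: 'k. x)" by (simp add: self_adjoint_def bounded_clinear_id)
  have pos: "mom (\<lambda>\<alpha>. cinner (mpow A \<alpha> x) x) (\<lambda>i. bernp N (k i)) \<in> \<real>\<^sub>\<ge>\<^sub>0" for N k
  proof -
    have "mom (\<lambda>\<alpha>. cinner (mpow A \<alpha> x) x) (\<lambda>i. bernp N (k i)) =
        of_real (\<Prod>i\<in>UNIV. real (N choose k i)) * mform x x (\<lambda>i. monom 1 (k i) * [:1, -1:] ^ (N - k i))"
      unfolding bernp_def mom_smult mform_def ..
    also have "\<dots> \<in> \<real>\<^sub>\<ge>\<^sub>0"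
    proof (rule nonneg_Reals_mult_I)
      show "complex_of_real (\<Prod>i\<in>UNIV. real (N choose k i)) \<in> \<real>\<^sub>\<ge>\<^sub>0"
        unfolding nonneg_Reals_of_real_iff by (rule prod_nonneg) simp
      show "mform x x (\<lambda>i. monom 1 (k i) * [:1, -1:] ^ (N - k i)) \<in> \<real>\<^sub>\<ge>\<^sub>0"
        by (rule mform_nonneg_Reals[OF id]) (auto simp: Re_cinner_self)
    qed
    finally show ?thesis .
  qed
  show ?thesis
  proof (rule hausdorff_moment[of "\<lambda>\<alpha>. cinner (mpow A \<alpha> x) x"])
    fix M :: "(real ^ 'd) measure"
    assume "sets M = sets borel" "finite_measure M" "AE t in M. t \<in> cbox 0 1"
      "\<And>\<alpha>. complex_of_real (\<integral>t. (\<Prod>i\<in>UNIV. (t $ i) ^ \<alpha> i) \<partial>M) = cinner (mpow A \<alpha> x) x"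
    then show ?thesis by (intro exI[of _ M] conjI allI)
  qed (rule pos)
qed

definition M :: "'k \<Rightarrow> (real ^ 'd) measure" where
  "M x = (SOME M. sets M = sets borel \<and> finite_measure M \<and> (AE t in M. t \<in> cbox 0 1) \<and>
     (\<forall>\<alpha>. complex_of_real (\<integral>t. (\<Prod>i\<in>UNIV. (t $ i) ^ \<alpha> i) \<partial>M) = cinner (mpow A \<alpha> x) x))"

lemma
  shows sets_M: "sets (M x) = sets borel" and finite_M: "finite_measure (M x)"
    and AE_M: "AE t in M x. t \<in> cbox 0 1"
    and moments_M: "complex_of_real (\<integral>t. (\<Prod>i\<in>UNIV. (t $ i) ^ \<alpha> i) \<partial>M x) = cinner (mpow A \<alpha> x) x"
  using someI_ex[OF spectral_measures_exist[of x]] unfolding M_def[symmetric] by auto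

text \<open>Candidate for integration against d<E x, y>. Since each \<open>M x\<close> is chosen by
  itself, sesquilinearity is not visible from the definition and has to come from the
  moments.\<close>

definition I :: "'k \<Rightarrow> 'k \<Rightarrow> (real ^ 'd \<Rightarrow> complex) \<Rightarrow> complex" where
  "I x y f = polarized (\<lambda>x. \<integral>t. f t \<partial>M x) x y"

lemma integral_cube_monom: "(\<integral>t. cube_monom \<alpha> t \<partial>M x) = cinner (mpow A \<alpha> x) x"
proof -
  have meas: "(\<lambda>t. complex_of_real (\<Prod>i\<in>UNIV. (t $ i) ^ \<alpha> i)) \<in> borel_measurable (M x)"
    unfolding measurable_cong_sets[OF sets_M refl]
    by (intro borel_measurable_continuous_onI continuous_intros)
  have "(\<integral>t. cube_monom \<alpha> t \<partial>M x) = (\<integral>t. complex_of_real (\<Prod>i\<in>UNIV. (t $ i) ^ \<alpha> i) \<partial>M x)"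
  proof (rule integral_cong_AE)
    show "cube_monom \<alpha> \<in> borel_measurable (M x)"
      unfolding measurable_cong_sets[OF sets_M refl] by (rule bounded_borel_measurable[OF bounded_borel_cube_monom])
    show "AE t in M x. cube_monom \<alpha> t = complex_of_real (\<Prod>i\<in>UNIV. (t $ i) ^ \<alpha> i)"
      using AE_M by eventually_elim (simp add: cube_monom_def)
  qed (rule meas)
  also have "\<dots> = complex_of_real (\<integral>t. (\<Prod>i\<in>UNIV. (t $ i) ^ \<alpha> i) \<partial>M x)" by (rule integral_complex_of_real)
  finally show ?thesis by (simp only: moments_M)
qed

lemma sigma_functional_M: "sigma_functional (\<lambda>f. \<integral>t. f t \<partial>M x)"
  by (rule sigma_functional_integral[OF finite_M sets_M])

lemma sigma_functional_I: "sigma_functional (I x y)"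
proof -
  have "I x y = (\<lambda>f. 1 / 4 * (((\<integral>t. f t \<partial>M (x + y)) - (\<integral>t. f t \<partial>M (x - y)) + \<i> * (\<integral>t. f t \<partial>M (x + \<i> *\<^sub>C y)))
      - \<i> * (\<integral>t. f t \<partial>M (x - \<i> *\<^sub>C y))))"
    by (simp add: I_def polarized_def fun_eq_iff)
  then show ?thesis
    by (simp only:) (intro sigma_functional_cmult sigma_functional_diff sigma_functional_add sigma_functional_M)
qed

lemma integral_off_cube:
  assumes g: "bounded_borel g" and z: "\<And>t. t \<in> cbox 0 1 \<Longrightarrow> g t = 0"
  shows "(\<integral>t. g t \<partial>M x) = 0"
proof -
  have "(\<integral>t. g t \<partial>M x) = (\<integral>t. 0 \<partial>M x)"
  proof (rule integral_cong_AE)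
    show "g \<in> borel_measurable (M x)"
      unfolding measurable_cong_sets[OF sets_M refl] by (rule bounded_borel_measurable[OF g])
    show "AE t in M x. g t = 0" using AE_M by eventually_elim (rule z)
  qed simp
  then show ?thesis by simp
qed

lemma I_off_cube: "bounded_borel g \<Longrightarrow> (\<And>t. t \<in> cbox 0 1 \<Longrightarrow> g t = 0) \<Longrightarrow> I x y g = 0"
  by (simp add: I_def polarized_def integral_off_cube)

lemma I_cube_monom: "I x y (cube_monom \<alpha>) = cinner (mpow A \<alpha> x) y"
  unfolding I_def integral_cube_monom by (rule polarized_bounded_clinear[OF bounded_mpow])

text \<open>The difference of the two sides is a functional carried by the cube that vanishes on
  monomials. The algebraic properties of \<open>I\<close> below follow the same scheme.\<close>

lemma I_diag: "bounded_borel f \<Longrightarrow> I x x f = (\<integral>t. f t \<partial>M x)"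
proof -
  assume f: "bounded_borel f"
  have "I x x f - (\<integral>t. f t \<partial>M x) = 0"
    by (rule sigma_functional_cube_eq_0[OF sigma_functional_diff[OF sigma_functional_I sigma_functional_M] _ _ f])
      (simp_all add: I_cube_monom integral_cube_monom I_off_cube integral_off_cube)
  then show ?thesis by simp
qed

lemma I_add: "bounded_borel f \<Longrightarrow> I (x + x') y f = I x y f + I x' y f"
proof -
  assume f: "bounded_borel f"
  have "I (x + x') y f - (I x y f + I x' y f) = 0"
    by (rule sigma_functional_cube_eq_0[OF sigma_functional_diff[OF sigma_functional_I sigma_functional_add[OF sigma_functional_I sigma_functional_I]] _ _ f])
      (simp_all add: I_cube_monom I_off_cube bounded_clinear_add[OF bounded_mpow] cinner_add_left)
  then show ?thesis by simp
qed

lemma I_scale: "bounded_borel f \<Longrightarrow> I (c *\<^sub>C x) y f = c * I x y f"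
proof -
  assume f: "bounded_borel f"
  have "I (c *\<^sub>C x) y f - c * I x y f = 0"
    by (rule sigma_functional_cube_eq_0[OF sigma_functional_diff[OF sigma_functional_I sigma_functional_cmult[OF sigma_functional_I]] _ _ f])
      (simp_all add: I_cube_monom I_off_cube bounded_clinear_scaleC[OF bounded_mpow] cinner_scaleC_left)
  then show ?thesis by simp
qed

lemma I_herm: "bounded_borel f \<Longrightarrow> I y x f = cnj (I x y (\<lambda>t. cnj (f t)))"
proof -
  assume f: "bounded_borel f"
  have "I y x f - cnj (I x y (\<lambda>t. cnj (f t))) = 0"
  proof (rule sigma_functional_cube_eq_0[OF sigma_functional_diff[OF sigma_functional_I sigma_functional_cnj[OF sigma_functional_I]] _ _ f])
    fix \<alpha> :: "'d \<Rightarrow> nat"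
    have "(\<lambda>t. cnj (cube_monom \<alpha> t)) = cube_monom \<alpha>" by (auto simp: cube_monom_def indicator_def fun_eq_iff)
    then show "I y x (cube_monom \<alpha>) - cnj (I x y (\<lambda>t. cnj (cube_monom \<alpha> t))) = 0"
      using cinner_commute[of "mpow A \<alpha> y" x] by (simp add: I_cube_monom mpow_adjoint)
  qed (simp_all add: I_off_cube bounded_borel_cnj)
  then show ?thesis by simp
qed

lemma I_mult_monom: "bounded_borel f \<Longrightarrow> I x y (\<lambda>t. cube_monom \<beta> t * f t) = I (mpow A \<beta> x) y f"
proof -
  assume f: "bounded_borel f"
  have "I x y (\<lambda>t. cube_monom \<beta> t * f t) - I (mpow A \<beta> x) y f = 0"
    by (rule sigma_functional_cube_eq_0[OF sigma_functional_diff[OF sigma_functional_mult[OF sigma_functional_I bounded_borel_cube_monom] sigma_functional_I] _ _ f])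
      (simp_all add: cube_monom_mult I_cube_monom mpow_add mpow_commute[of \<beta>] I_off_cube bounded_borel_mult bounded_borel_cube_monom)
  then show ?thesis by simp
qed

lemma I_intertwine:
  assumes T: "self_adjoint T" "\<And>i x. A i (T x) = T (A i x)" and f: "bounded_borel f"
  shows "I (T x) y f = I x (T y) f"
proof -
  have "I (T x) y f - I x (T y) f = 0"
    by (rule sigma_functional_cube_eq_0[OF sigma_functional_diff[OF sigma_functional_I sigma_functional_I] _ _ f])
      (simp_all add: I_cube_monom I_off_cube mpow_intertwine[OF T(2)] self_adjointD[OF T(1)])
  then show ?thesis by simp
qed

lemma I_indicator_diag: "B \<in> sets borel \<Longrightarrow> I x x (indicator B) = of_real (measure (M x) B)"
proof -
  assume B: "B \<in> sets borel"
  interpret finite_measure "M x" by (rule finite_M)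
  have "(indicator B :: real ^ 'd \<Rightarrow> complex) = (\<lambda>t. complex_of_real (indicator B t))"
    by (auto simp: indicator_def fun_eq_iff)
  then have "(\<integral>t. indicator B t \<partial>M x) = complex_of_real (\<integral>t. indicator B t \<partial>M x)"
    by (simp only: integral_complex_of_real)
  also have "(\<integral>t. indicator B t \<partial>M x) = measure (M x) (B \<inter> space (M x))"
    using B by simp
  finally have "(\<integral>t. indicator B t \<partial>M x) = complex_of_real (measure (M x) (B \<inter> space (M x)))" .
  then show ?thesis
    using B by (simp add: I_diag bounded_borel_indicator sets_eq_imp_space_eq[OF sets_M])
qed

text \<open>The complement of the cube is null, and on the cube the constant 1 is the monomial of
  exponent 0.\<close>

lemma measure_M_space: "measure (M x) UNIV = (norm x)\<^sup>2"
proof -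
  have "indicator (- cbox 0 1 :: (real ^ 'd) set) t = (0 :: complex)" if "t \<in> cbox 0 1" for t using that by simp
  then have "I x x (indicator (- cbox 0 1)) = 0"
    by (intro I_off_cube bounded_borel_indicator) auto
  moreover have "(\<lambda>t. indicator (cbox 0 1) t + indicator (- cbox 0 1) t) = (indicator UNIV :: real ^ 'd \<Rightarrow> complex)"
    by (auto simp: indicator_def fun_eq_iff)
  then have "I x x (indicator UNIV) = I x x (indicator (cbox 0 1)) + I x x (indicator (- cbox 0 1))"
    using sigma_functional_plus[OF sigma_functional_I, of "indicator (cbox 0 1)" "indicator (- cbox 0 1)" x x]
    by (simp add: bounded_borel_indicator)
  moreover have "(indicator (cbox 0 1) :: real ^ 'd \<Rightarrow> complex) = cube_monom (\<lambda>_. 0)" by (simp add: cube_monom_def fun_eq_iff)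
  ultimately have "I x x (indicator UNIV) = I x x (cube_monom (\<lambda>_. 0))"
    by (simp only: add_0_right)
  also have "\<dots> = of_real ((norm x)\<^sup>2)" by (simp add: I_cube_monom cinner_self)
  finally have "complex_of_real (measure (M x) UNIV) = of_real ((norm x)\<^sup>2)"
    using I_indicator_diag[of UNIV x] by (simp only: space_borel[symmetric] sets.top)
  then show ?thesis by (simp only: of_real_eq_iff)
qed

text \<open>On the diagonal the form lies between 0 and the total mass; Cauchy-Schwarz then bounds
  it everywhere, so it is the form of an operator.\<close>

lemma spectral_projection_exists:
  assumes B: "B \<in> sets borel"
  shows "\<exists>T. bounded_clinear T \<and> (\<forall>x y. I x y (indicator B) = cinner (T x) y)"
proof -
  note bb = bounded_borel_indicator[OF B]
  have herm: "I y x (indicator B) = cnj (I x y (indicator B))" for x y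
  proof -
    have "(\<lambda>t. cnj (indicator B t)) = (indicator B :: real ^ 'd \<Rightarrow> complex)" by (auto simp: indicator_def)
    then show ?thesis using I_herm[OF bb, of y x] by simp
  qed
  have diff: "I (x - y) z (indicator B) = I x z (indicator B) - I y z (indicator B)" for x y z
    using I_add[OF bb, of "x - y" y z] by simp
  have pos: "I x x (indicator B) \<in> \<real>\<^sub>\<ge>\<^sub>0" for x
    by (simp add: I_indicator_diag[OF B] complex_nonneg_Reals_iff)
  have le: "Re (I x x (indicator B)) \<le> (norm x)\<^sup>2" for x
  proof -
    interpret finite_measure "M x" by (rule finite_M)
    have "measure (M x) B \<le> measure (M x) UNIV" by (rule finite_measure_mono) (auto simp: sets_M)
    then show ?thesis by (simp add: I_indicator_diag[OF B] measure_M_space)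
  qed
  have bound: "cmod (I x y (indicator B)) \<le> 1 * norm x * norm y" for x y
  proof -
    have "(cmod (I x y (indicator B)))\<^sup>2 \<le> Re (I x x (indicator B)) * Re (I y y (indicator B))"
      by (rule psd_form_Cauchy_Schwarz[of "\<lambda>x y. I x y (indicator B)", OF diff I_scale[OF bb] herm pos])
    also have "\<dots> \<le> (norm x)\<^sup>2 * (norm y)\<^sup>2"
      using pos[of y] by (intro mult_mono le) (auto simp: complex_nonneg_Reals_iff)
    also have "\<dots> = (norm x * norm y)\<^sup>2" by (simp add: power_mult_distrib)
    finally show ?thesis by (simp add: power2_le_iff_abs_le)
  qed
  have scale: "I x (c *\<^sub>C y) (indicator B) = cnj c * I x y (indicator B)" for c x y
    unfolding herm[of x "c *\<^sub>C y"] herm[of x y] I_scale[OF bb] by simp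
  have add: "I x (y + y') (indicator B) = I x y (indicator B) + I x y' (indicator B)" for x y y'
    unfolding herm[of x "y + y'"] herm[of x y] herm[of x y'] I_add[OF bb] by simp
  show ?thesis
    by (rule sesquilinear_operator[of "\<lambda>x y. I x y (indicator B)" 1,
          OF I_add[OF bb] add I_scale[OF bb] scale bound]) blast
qed

definition E :: "(real ^ 'd) set \<Rightarrow> 'k \<Rightarrow> 'k" where
  "E B = (SOME T. bounded_clinear T \<and> (\<forall>x y. I x y (indicator B) = cinner (T x) y))"

context
  fixes B assumes B: "B \<in> sets (borel :: (real ^ 'd) measure)"
begin

lemma bounded_E: "bounded_clinear (E B)"
  and cinner_E: "cinner (E B x) y = I x y (indicator B)"
  using someI_ex[OF spectral_projection_exists[OF B]] unfolding E_def[symmetric] by auto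

lemma E_adjoint: "cinner (E B x) y = cinner x (E B y)"
proof -
  have "(\<lambda>t. cnj (indicator B t)) = (indicator B :: real ^ 'd \<Rightarrow> complex)" by (auto simp: indicator_def)
  then have "I x y (indicator B) = cnj (I y x (indicator B))"
    using I_herm[OF bounded_borel_indicator[OF B], of x y] by simp
  then show ?thesis using cinner_commute[of x "E B y"] by (simp add: cinner_E)
qed

lemma measure_M: "cinner (E B x) x = of_real (measure (M x) B)"
  by (simp add: cinner_E I_indicator_diag[OF B])

text \<open>Tested on monomials, which \<open>I_mult_monom\<close> moves onto \<open>x\<close>, so
  that self-adjointness of \<open>E B\<close> can be used. This is the source of multiplicativity of
  \<open>E\<close>.\<close>

lemma I_indicator_mult: "bounded_borel f \<Longrightarrow> I x y (\<lambda>t. indicator B t * f t) = I x (E B y) f"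
proof -
  assume f: "bounded_borel f"
  note bb = bounded_borel_indicator[OF B]
  have "I x y (\<lambda>t. indicator B t * f t) - I x (E B y) f = 0"
  proof (rule sigma_functional_cube_eq_0[OF sigma_functional_diff[OF sigma_functional_mult[OF sigma_functional_I bb] sigma_functional_I] _ _ f])
    fix \<alpha> :: "'d \<Rightarrow> nat"
    have "I x y (\<lambda>t. indicator B t * cube_monom \<alpha> t) = I (mpow A \<alpha> x) y (indicator B)"
      using I_mult_monom[OF bb, of x y \<alpha>] by (simp add: mult.commute)
    then show "I x y (\<lambda>t. indicator B t * cube_monom \<alpha> t) - I x (E B y) (cube_monom \<alpha>) = 0"
      by (simp add: I_cube_monom cinner_E[symmetric] E_adjoint)
  qed (simp_all add: I_off_cube bounded_borel_mult bb)
  then show ?thesis by simp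
qed

end

lemma E_Int:
  assumes "B \<in> sets borel" "C \<in> sets borel"
  shows "E (B \<inter> C) x = E B (E C x)"
proof (rule cinner_eqI)
  fix y
  have BC: "B \<inter> C \<in> sets borel" using assms by simp
  have "cinner (E (B \<inter> C) x) y = I x y (\<lambda>t. indicator B t * indicator C t)"
    unfolding cinner_E[OF BC] by (rule arg_cong[of _ _ "I x y"]) (auto simp: indicator_def fun_eq_iff)
  also have "\<dots> = cinner (E C x) (E B y)"
    by (simp add: I_indicator_mult assms bounded_borel_indicator cinner_E[OF assms(2)])
  finally show "cinner (E (B \<inter> C) x) y = cinner (E B (E C x)) y"
    by (simp add: E_adjoint[OF assms(1)])
qed

lemma E_empty: "E {} x = 0"
  by (rule cinner_eqI)
    (use sigma_functional_zero[OF sigma_functional_I] in \<open>simp add: cinner_E indicator_def[abs_def]\<close>)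

lemma E_UNIV: "E UNIV x = x"
proof -
  have "cinner (E UNIV x) y = cinner x y" for y
  proof -
    have "I x y (indicator UNIV) = polarized (\<lambda>x. cinner x x) x y"
      unfolding polarized_def I_def
      using measure_M_space I_indicator_diag[of UNIV] I_diag[OF bounded_borel_indicator[of UNIV]]
      by (simp add: cinner_self)
    also have "\<dots> = cinner x y" by (rule polarized_bounded_clinear[OF bounded_clinear_id])
    finally show ?thesis by (simp add: cinner_E)
  qed
  then show ?thesis by (rule cinner_eqI)
qed

lemma E_Un:
  assumes "B \<in> sets borel" "C \<in> sets borel" "B \<inter> C = {}"
  shows "E (B \<union> C) x = E B x + E C x"
proof (rule cinner_eqI)
  fix y
  have "(\<lambda>t. indicator B t + indicator C t) = (indicator (B \<union> C) :: real ^ 'd \<Rightarrow> complex)"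
    using assms(3) by (auto simp: indicator_def fun_eq_iff)
  then have "I x y (indicator (B \<union> C)) = I x y (indicator B) + I x y (indicator C)"
    using sigma_functional_plus[OF sigma_functional_I bounded_borel_indicator[OF assms(1)] bounded_borel_indicator[OF assms(2)], of x y]
    by simp
  then show "cinner (E (B \<union> C) x) y = cinner (E B x + E C x) y"
    using assms by (simp add: cinner_E cinner_add_left)
qed

text \<open>Strong convergence: the remainder \<open>E (R n) x\<close> has squared norm equal to the
  scalar measure of \<open>R n\<close>, and these sets decrease to the empty set.\<close>

lemma E_sums:
  assumes S: "\<And>k :: nat. S k \<in> sets borel" and disj: "disjoint_family S"
  shows "(\<lambda>k. E (S k) x) sums E (\<Union>k. S k) x"
proof -
  define R where "R n = (\<Union>k. S k) - (\<Union>k<n. S k)" for n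
  have R: "R n \<in> sets borel" for n unfolding R_def using S by auto
  have part: "(\<Sum>k<n. E (S k) x) = E (\<Union>k<n. S k) x" for n
  proof (induction n)
    case (Suc n)
    have "(\<Union>k<n. S k) \<inter> S n = {}"
      using disj unfolding disjoint_family_on_def by (auto, metis Int_iff empty_iff less_irrefl UNIV_I)
    moreover have "(\<Union>k<Suc n. S k) = (\<Union>k<n. S k) \<union> S n" by (auto simp: less_Suc_eq)
    ultimately show ?case using Suc S by (simp add: E_Un sets.finite_UN)
  qed (simp add: E_empty)
  have diff: "(\<Sum>k<n. E (S k) x) - E (\<Union>k. S k) x = - E (R n) x" for n
  proof -
    have "(\<Union>k. S k) = (\<Union>k<n. S k) \<union> R n" by (auto simp: R_def)
    moreover have "(\<Union>k<n. S k) \<inter> R n = {}" by (auto simp: R_def)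
    ultimately have "E (\<Union>k. S k) x = E (\<Union>k<n. S k) x + E (R n) x"
      using E_Un[of "\<Union>k<n. S k" "R n" x] S R by (simp add: sets.finite_UN)
    then show ?thesis by (simp add: part)
  qed
  have norm_R: "(norm (E (R n) x))\<^sup>2 = measure (M x) (R n)" for n
  proof -
    have "cinner (E (R n) x) (E (R n) x) = cinner (E (R n) (E (R n) x)) x"
      by (simp add: E_adjoint[OF R])
    also have "\<dots> = cinner (E (R n) x) x" using E_Int[OF R R, of n n x] by simp
    finally have "Re (cinner (E (R n) x) (E (R n) x)) = Re (cinner (E (R n) x) x)" by simp
    then show ?thesis by (simp add: Re_cinner_self measure_M[OF R])
  qed
  interpret finite_measure "M x" by (rule finite_M)
  have "(\<lambda>n. measure (M x) (R n)) \<longlonglongrightarrow> measure (M x) (\<Inter>n. R n)"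
    by (rule finite_Lim_measure_decseq) (auto simp: R sets_M decseq_def, auto simp: R_def)
  moreover have "(\<Inter>n. R n) = {}" by (auto simp: R_def)
  ultimately have "(\<lambda>n. (norm (E (R n) x))\<^sup>2) \<longlonglongrightarrow> 0" by (simp add: norm_R)
  then have "(\<lambda>n. sqrt ((norm (E (R n) x))\<^sup>2)) \<longlonglongrightarrow> sqrt 0" by (rule tendsto_real_sqrt)
  then have "(\<lambda>n. E (R n) x) \<longlonglongrightarrow> 0" by (simp add: tendsto_norm_zero_iff)
  then have "(\<lambda>n. (\<Sum>k<n. E (S k) x) - E (\<Union>k. S k) x) \<longlonglongrightarrow> 0"
    unfolding diff using tendsto_minus[of "\<lambda>n. E (R n) x" 0] by simp
  then show ?thesis unfolding sums_def by (simp only: LIM_zero_iff)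
qed

lemma integral_coordinate: "integrable (M x) (\<lambda>t. t $ i)" "complex_of_real (\<integral>t. t $ i \<partial>M x) = cinner (A i x) x"
proof -
  interpret finite_measure "M x" by (rule finite_M)
  show "integrable (M x) (\<lambda>t. t $ i)"
  proof (rule integrable_const_bound[where B = 1])
    show "AE t in M x. norm (t $ i) \<le> 1"
      using AE_M by eventually_elim (auto simp: mem_box_cart)
    show "(\<lambda>t. t $ i) \<in> borel_measurable (M x)"
      unfolding measurable_cong_sets[OF sets_M refl] by (intro borel_measurable_continuous_onI continuous_intros)
  qed
  have "(\<Prod>j\<in>UNIV. (t $ j) ^ (if j = i then 1 else 0)) = t $ i" for t :: "real ^ 'd"
    by (simp add: if_distrib[of "\<lambda>n. _ ^ n"] cong: if_cong)
  then show "complex_of_real (\<integral>t. t $ i \<partial>M x) = cinner (A i x) x"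
    using moments_M[where \<alpha> = "\<lambda>j. if j = i then 1 else 0" and x = x] mpow_single[of i 1 x] by simp
qed

end

subsection \<open>Integration against a joint spectral measure\<close>

lemma bounded_op_onD:
  assumes "bounded_op_on K T"
  shows "x \<in> K \<Longrightarrow> T x \<in> K" "x \<in> K \<Longrightarrow> y \<in> K \<Longrightarrow> T (x + y) = T x + T y"
    "x \<in> K \<Longrightarrow> T (c *\<^sub>C x) = c *\<^sub>C T x"
  using assms by (auto simp: bounded_op_on_def)

lemma bounded_op_on_diff:
  assumes T: "bounded_op_on K T" and K: "complex_vector.subspace K" and x: "x \<in> K" and y: "y \<in> K"
  shows "T (x - y) = T x - T y"
proof -
  have my: "(-1) *\<^sub>C y \<in> K" using K y by (rule complex_vector.subspace_scale)
  have "T (x + (-1) *\<^sub>C y) = T x + T ((-1) *\<^sub>C y)" by (rule bounded_op_onD(2)[OF T x my])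
  also have "T ((-1) *\<^sub>C y) = (-1) *\<^sub>C T y" by (rule bounded_op_onD(3)[OF T y])
  finally show ?thesis by simp
qed

lemma polarized_on:
  assumes T: "bounded_op_on K T" and K: "complex_vector.subspace K" and x: "x \<in> K" and y: "y \<in> K"
    and q: "\<And>x. x \<in> K \<Longrightarrow> q x = cinner (T x) x"
  shows "polarized q x y = cinner (T x) y"
proof -
  have iy: "\<i> *\<^sub>C y \<in> K" using K y by (rule complex_vector.subspace_scale)
  have mem: "x + y \<in> K" "x - y \<in> K" "x + \<i> *\<^sub>C y \<in> K" "x - \<i> *\<^sub>C y \<in> K"
    using K x y iy by (auto intro: complex_vector.subspace_add complex_vector.subspace_diff)
  show ?thesis
    unfolding polarized_def q[OF mem(1)] q[OF mem(2)] q[OF mem(3)] q[OF mem(4)]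
      bounded_op_onD(2)[OF T x y] bounded_op_onD(2)[OF T x iy] bounded_op_on_diff[OF T K x y]
      bounded_op_on_diff[OF T K x iy] bounded_op_onD(3)[OF T y]
    by (simp add: cinner_add_left cinner_add_right cinner_diff_left cinner_diff_right cinner_scaleC_left
        cinner_scaleC_right algebra_simps)
qed

text \<open>Calculus for any joint spectral measure with a bounded carrier \<open>Q\<close>, which
  is the boundary in one direction of the equivalence and a square in the other.\<close>

locale joint_pvm =
  fixes K :: "'k::complex_hilbert set" and N :: "'n::finite \<Rightarrow> 'k \<Rightarrow> 'k"
    and E :: "(complex ^ 'n) set \<Rightarrow> 'k \<Rightarrow> 'k" and Q :: "(complex ^ 'n) set"
  assumes K: "closed_csubspace K" and N: "bounded_op_on K (N i)"
    and joint: "joint_spectral_measure K N E"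
    and Q: "Q \<in> sets borel" "bounded Q" and E_Q: "x \<in> K \<Longrightarrow> E (- Q) x = 0"
begin

lemma subspace_K: "complex_vector.subspace K"
  using K by (simp add: closed_csubspace_def)

lemma K_mem: "x \<in> K \<Longrightarrow> y \<in> K \<Longrightarrow> x + y \<in> K" "x \<in> K \<Longrightarrow> y \<in> K \<Longrightarrow> x - y \<in> K" "x \<in> K \<Longrightarrow> c *\<^sub>C x \<in> K"
  using subspace_K by (auto intro: complex_vector.subspace_add complex_vector.subspace_diff complex_vector.subspace_scale)

lemma pvm: "projection_valued_measure K E"
  using joint by (simp add: joint_spectral_measure_def)

lemma
  assumes "B \<in> sets borel"
  shows E_op: "bounded_op_on K (E B)" and E_idem: "x \<in> K \<Longrightarrow> E B (E B x) = E B x"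
    and E_adj: "x \<in> K \<Longrightarrow> y \<in> K \<Longrightarrow> cinner (E B x) y = cinner x (E B y)"
  using pvm assms unfolding projection_valued_measure_def by auto

lemma E_empty: "x \<in> K \<Longrightarrow> E {} x = 0" and E_UNIV: "x \<in> K \<Longrightarrow> E UNIV x = x"
  using pvm unfolding projection_valued_measure_def by auto

lemma E_Int: "A \<in> sets borel \<Longrightarrow> B \<in> sets borel \<Longrightarrow> x \<in> K \<Longrightarrow> E (A \<inter> B) x = E A (E B x)"
  using pvm unfolding projection_valued_measure_def by auto

lemma E_sums:
  fixes A :: "nat \<Rightarrow> (complex ^ 'n) set"
  shows "range A \<subseteq> sets borel \<Longrightarrow> disjoint_family A \<Longrightarrow> x \<in> K \<Longrightarrow> (\<lambda>k. E (A k) x) sums E (\<Union>k. A k) x"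
  using pvm unfolding projection_valued_measure_def by blast

lemma E_mem: "B \<in> sets borel \<Longrightarrow> x \<in> K \<Longrightarrow> E B x \<in> K"
  using bounded_op_onD(1)[OF E_op] by blast

lemma cinner_E_self: "B \<in> sets borel \<Longrightarrow> x \<in> K \<Longrightarrow> cinner (E B x) x = of_real ((norm (E B x))\<^sup>2)"
proof -
  assume B: "B \<in> sets borel" and x: "x \<in> K"
  have "cinner (E B x) x = cinner (E B (E B x)) x" by (simp add: E_idem[OF B x])
  also have "\<dots> = cinner (E B x) (E B x)" by (rule E_adj[OF B E_mem[OF B x] x])
  finally show ?thesis by (simp add: cinner_self)
qed

abbreviation M where "M \<equiv> scalar_measure E"

lemma sets_M: "sets (M x) = sets borel"
  unfolding scalar_measure_def by (metis sets.sets_measure_of_eq space_borel)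

text \<open>\<open>measure_of\<close> takes the prescribed values only if they form a countably
  additive set function; here this comes from the strong countable additivity of
  \<open>E\<close>.\<close>

lemma emeasure_M:
  assumes x: "x \<in> K" and B: "B \<in> sets borel"
  shows "emeasure (M x) B = ennreal (Re (cinner (E B x) x))"
  unfolding scalar_measure_def
proof (rule emeasure_measure_of_sigma[OF _ _ _ B])
  show "sigma_algebra UNIV (sets (borel :: (complex ^ 'n) measure))"
    using sets.sigma_algebra_axioms[of "borel :: (complex ^ 'n) measure"] by simp
  show "positive (sets borel) (\<lambda>B. ennreal (Re (cinner (E B x) x)))"
    by (simp add: positive_def E_empty[OF x])
  show "countably_additive (sets borel) (\<lambda>B. ennreal (Re (cinner (E B x) x)))"
  proof (rule countably_additiveI)
    fix A :: "nat \<Rightarrow> (complex ^ 'n) set"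
    assume A: "range A \<subseteq> sets borel" "disjoint_family A" "(\<Union>k. A k) \<in> sets borel"
    have Ak: "A k \<in> sets borel" for k using A(1) by auto
    have "(\<lambda>k. cinner (E (A k) x) x) sums cinner (E (\<Union>k. A k) x) x"
      by (rule bounded_linear.sums[OF bounded_bilinear.bounded_linear_left[OF bounded_bilinear_cinner] E_sums[OF A(1,2) x]])
    then have s: "(\<lambda>k. Re (cinner (E (A k) x) x)) sums Re (cinner (E (\<Union>k. A k) x) x)" by (rule sums_Re)
    have "0 \<le> Re (cinner (E (A k) x) x)" for k by (simp add: cinner_E_self[OF Ak x])
    then have "suminf (\<lambda>k. ennreal (Re (cinner (E (A k) x) x))) = ennreal (suminf (\<lambda>k. Re (cinner (E (A k) x) x)))"
      by (rule suminf_ennreal2) (rule sums_summable[OF s])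
    also have "\<dots> = ennreal (Re (cinner (E (\<Union>k. A k) x) x))" by (simp only: sums_unique[OF s])
    finally show "suminf (\<lambda>k. ennreal (Re (cinner (E (A k) x) x))) = ennreal (Re (cinner (E (\<Union>k. A k) x) x))" .
  qed
qed

lemma finite_M: "x \<in> K \<Longrightarrow> finite_measure (M x)"
  using emeasure_M[of x UNIV] sets_eq_imp_space_eq[OF sets_M, of x]
  by (intro finite_measureI) simp

lemma measure_M:
  assumes "x \<in> K" "B \<in> sets borel"
  shows "cinner (E B x) x = of_real (measure (M x) B)"
  using emeasure_M[OF assms] cinner_E_self[OF assms(2,1)] by (simp add: measure_def)

definition I :: "'k \<Rightarrow> 'k \<Rightarrow> (complex ^ 'n \<Rightarrow> complex) \<Rightarrow> complex" where
  "I x y f = polarized (\<lambda>x. \<integral>z. f z \<partial>M x) x y"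

lemma sigma_functional_M: "x \<in> K \<Longrightarrow> sigma_functional (\<lambda>f. \<integral>z. f z \<partial>M x)"
  by (rule sigma_functional_integral[OF finite_M sets_M])

lemma sigma_functional_I:
  assumes "x \<in> K" "y \<in> K" shows "sigma_functional (I x y)"
proof -
  have "I x y = (\<lambda>f. 1 / 4 * (((\<integral>t. f t \<partial>M (x + y)) - (\<integral>t. f t \<partial>M (x - y)) + \<i> * (\<integral>t. f t \<partial>M (x + \<i> *\<^sub>C y)))
      - \<i> * (\<integral>t. f t \<partial>M (x - \<i> *\<^sub>C y))))"
    by (simp add: I_def polarized_def fun_eq_iff)
  then show ?thesis
    by (simp only:) (intro sigma_functional_cmult sigma_functional_diff sigma_functional_add sigma_functional_M K_mem assms)
qed

lemma integral_indicator_M: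
  assumes "x \<in> K" "B \<in> sets borel"
  shows "(\<integral>t. indicator B t \<partial>M x) = cinner (E B x) x"
proof -
  have "(indicator B :: complex ^ 'n \<Rightarrow> complex) = (\<lambda>t. complex_of_real (indicator B t))"
    by (auto simp: indicator_def fun_eq_iff)
  then have "(\<integral>t. indicator B t \<partial>M x) = complex_of_real (\<integral>t. indicator B t \<partial>M x)"
    by (simp only: integral_complex_of_real)
  also have "(\<integral>t. indicator B t \<partial>M x) = measure (M x) (B \<inter> space (M x))"
    by simp
  finally show ?thesis
    using measure_M[OF assms] sets_eq_imp_space_eq[OF sets_M, of x] by simp
qed

lemma I_indicator:
  assumes x: "x \<in> K" and y: "y \<in> K" and B: "B \<in> sets borel"
  shows "I x y (indicator B) = cinner (E B x) y"
  unfolding I_def by (rule polarized_on[OF E_op[OF B] subspace_K x y integral_indicator_M[OF _ B]])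

text \<open>The projections are given here, so identities between functionals are tested on
  indicators instead of monomials.\<close>

lemma I_diag:
  assumes x: "x \<in> K" and f: "bounded_borel f"
  shows "I x x f = (\<integral>z. f z \<partial>M x)"
proof -
  have "I x x f - (\<integral>t. f t \<partial>M x) = 0"
    by (rule sigma_functional_eq_0[OF sigma_functional_diff[OF sigma_functional_I[OF x x] sigma_functional_M[OF x]] _ f])
      (simp add: I_indicator[OF x x] integral_indicator_M[OF x])
  then show ?thesis by simp
qed

lemma I_herm:
  assumes x: "x \<in> K" and y: "y \<in> K" and f: "bounded_borel f"
  shows "I y x f = cnj (I x y (\<lambda>t. cnj (f t)))"
proof -
  have "I y x f - cnj (I x y (\<lambda>t. cnj (f t))) = 0"
  proof (rule sigma_functional_eq_0[OF sigma_functional_diff[OF sigma_functional_I[OF y x] sigma_functional_cnj[OF sigma_functional_I[OF x y]]] _ f])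
    fix B :: "(complex ^ 'n) set" assume B: "B \<in> sets borel"
    have "(\<lambda>t. cnj (indicator B t)) = (indicator B :: complex ^ 'n \<Rightarrow> complex)"
      by (auto simp: indicator_def fun_eq_iff)
    then show "I y x (indicator B) - cnj (I x y (\<lambda>t. cnj (indicator B t))) = 0"
      using cinner_commute[of "E B y" x] by (simp add: I_indicator x y B E_adj)
  qed
  then show ?thesis by simp
qed

lemma I_indicator_mult:
  assumes x: "x \<in> K" and y: "y \<in> K" and B: "B \<in> sets borel" and f: "bounded_borel f"
  shows "I x y (\<lambda>t. indicator B t * f t) = I x (E B y) f"
proof -
  note By = E_mem[OF B y]
  have "I x y (\<lambda>t. indicator B t * f t) - I x (E B y) f = 0"
  proof (rule sigma_functional_eq_0[OF sigma_functional_diff[OF sigma_functional_mult[OF sigma_functional_I[OF x y] bounded_borel_indicator[OF B]] sigma_functional_I[OF x By]] _ f])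
    fix A :: "(complex ^ 'n) set" assume A: "A \<in> sets borel"
    have "I x y (\<lambda>t. indicator B t * indicator A t) = I x y (indicator (B \<inter> A))"
      by (rule arg_cong[of _ _ "I x y"]) (auto simp: indicator_def fun_eq_iff)
    also have "\<dots> = cinner (E A x) (E B y)"
      using A B by (simp add: I_indicator x y E_Int E_adj[OF B E_mem[OF A x] y])
    finally show "I x y (\<lambda>t. indicator B t * indicator A t) - I x (E B y) (indicator A) = 0"
      by (simp add: I_indicator[OF x By A])
  qed
  then show ?thesis by simp
qed

lemma AE_Q: "x \<in> K \<Longrightarrow> AE z in M x. z \<in> Q"
proof -
  assume x: "x \<in> K"
  have "- Q \<in> null_sets (M x)"
    using Q(1) emeasure_M[OF x, of "- Q"] E_Q[OF x] by (auto simp: null_sets_def sets_M)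
  then show ?thesis by (rule AE_I') auto
qed

lemma I_off_Q:
  assumes x: "x \<in> K" and y: "y \<in> K" and f: "bounded_borel f" and z: "\<And>t. t \<in> Q \<Longrightarrow> f t = 0"
  shows "I x y f = 0"
proof -
  have "(\<integral>t. f t \<partial>M x) = 0" if x: "x \<in> K" for x
  proof -
    have "(\<integral>t. f t \<partial>M x) = (\<integral>t. 0 \<partial>M x)"
    proof (rule integral_cong_AE)
      show "f \<in> borel_measurable (M x)"
        unfolding measurable_cong_sets[OF sets_M refl] by (rule bounded_borel_measurable[OF f])
      show "AE t in M x. f t = 0" using AE_Q[OF x] by eventually_elim (rule z)
    qed simp
    then show ?thesis by simp
  qed
  then show ?thesis unfolding I_def polarized_def using x y by (simp add: K_mem)
qed

text \<open>Restriction to the carrier makes the coordinate bounded and changes it only on a null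
  set.\<close>

definition zc :: "'n \<Rightarrow> complex ^ 'n \<Rightarrow> complex" where
  "zc i z = indicator Q z * (z $ i)"

lemma bounded_borel_zc: "bounded_borel (zc i)"
proof -
  obtain B where B: "\<And>z. z \<in> Q \<Longrightarrow> norm z \<le> B" using Q(2) bounded_iff by blast
  have m: "(\<lambda>z :: complex ^ 'n. z $ i) \<in> borel_measurable borel"
    by (intro borel_measurable_continuous_onI continuous_intros)
  show ?thesis
    unfolding zc_def[abs_def]
  proof (rule bounded_borelI[of _ "\<bar>B\<bar>"])
    show "(\<lambda>z. indicator Q z * z $ i) \<in> borel_measurable borel"
      using Q(1) m by (intro borel_measurable_times borel_measurable_indicator) auto
    show "cmod (indicator Q z * z $ i) \<le> \<bar>B\<bar>" for z
      using B[of z] Finite_Cartesian_Product.norm_nth_le[of z i] by (cases "z \<in> Q") auto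
  qed
qed

lemma N_mem: "x \<in> K \<Longrightarrow> N i x \<in> K"
  using bounded_op_onD(1)[OF N] .

lemma cinner_N:
  assumes x: "x \<in> K" and y: "y \<in> K"
  shows "cinner (N i x) y = I x y (zc i)"
proof -
  have "(\<integral>z. zc i z \<partial>M x) = cinner (N i x) x" if x: "x \<in> K" for x
  proof -
    have "(\<integral>z. zc i z \<partial>M x) = (\<integral>z. z $ i \<partial>M x)"
    proof (rule integral_cong_AE)
      show "zc i \<in> borel_measurable (M x)"
        unfolding measurable_cong_sets[OF sets_M refl] by (rule bounded_borel_measurable[OF bounded_borel_zc])
      show "(\<lambda>z. z $ i) \<in> borel_measurable (M x)"
        unfolding measurable_cong_sets[OF sets_M refl] by (intro borel_measurable_continuous_onI continuous_intros)
      show "AE z in M x. zc i z = z $ i" using AE_Q[OF x] by eventually_elim (simp add: zc_def)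
    qed
    then show ?thesis using joint x by (simp add: joint_spectral_measure_def)
  qed
  then show ?thesis
    unfolding I_def by (rule polarized_on[OF N subspace_K x y, symmetric])
qed

text \<open>\<open>N i\<close> acts as multiplication by z_i: for an indicator of \<open>B\<close>,
  the projection \<open>E B\<close> moves to the second argument and returns as a factor of the
  integrand of \<open>cinner_N\<close>.\<close>

lemma I_N_left:
  assumes x: "x \<in> K" and y: "y \<in> K" and f: "bounded_borel f"
  shows "I (N i x) y f = I x y (\<lambda>z. zc i z * f z)"
proof -
  note Nx = N_mem[OF x]
  have "I (N i x) y f - I x y (\<lambda>z. zc i z * f z) = 0"
  proof (rule sigma_functional_eq_0[OF sigma_functional_diff[OF sigma_functional_I[OF Nx y] sigma_functional_mult[OF sigma_functional_I[OF x y] bounded_borel_zc]] _ f])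
    fix B :: "(complex ^ 'n) set" assume B: "B \<in> sets borel"
    have "I (N i x) y (indicator B) = cinner (N i x) (E B y)"
      by (simp add: I_indicator[OF Nx y B] E_adj[OF B Nx y])
    also have "\<dots> = I x y (\<lambda>z. indicator B z * zc i z)"
      by (simp only: cinner_N[OF x E_mem[OF B y]] I_indicator_mult[OF x y B bounded_borel_zc])
    finally show "I (N i x) y (indicator B) - I x y (\<lambda>z. zc i z * indicator B z) = 0"
      by (simp add: mult.commute)
  qed
  then show ?thesis by simp
qed

lemma I_N_right:
  assumes x: "x \<in> K" and y: "y \<in> K" and f: "bounded_borel f"
  shows "I x (N i y) f = I x y (\<lambda>z. cnj (zc i z) * f z)"
proof -
  have "I x (N i y) f = cnj (I (N i y) x (\<lambda>z. cnj (f z)))"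
    by (rule I_herm[OF N_mem[OF y] x f])
  also have "\<dots> = cnj (I y x (\<lambda>z. zc i z * cnj (f z)))"
    by (simp add: I_N_left[OF y x] bounded_borel_cnj[OF f])
  also have "\<dots> = I x y (\<lambda>z. cnj (zc i z) * f z)"
    using I_herm[OF y x, of "\<lambda>z. cnj (zc i z) * f z"]
    by (simp add: bounded_borel_mult bounded_borel_cnj bounded_borel_zc f)
  finally show ?thesis .
qed

lemma bounded_borel_zc_power: "bounded_borel (\<lambda>z. of_real (cmod (zc i z) ^ (2 * p)))"
proof -
  obtain B where B: "B \<ge> 0" "\<And>z. cmod (zc i z) \<le> B" using bounded_borel_bound[OF bounded_borel_zc] by blast
  show ?thesis
  proof (rule bounded_borelI[of _ "B ^ (2 * p)"])
    have "(\<lambda>z. cmod (zc i z)) \<in> borel_measurable borel"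
      using bounded_borel_measurable[OF bounded_borel_zc, of i] by measurable
    then show "(\<lambda>z. complex_of_real (cmod (zc i z) ^ (2 * p))) \<in> borel_measurable borel"
      by measurable
    show "cmod (complex_of_real (cmod (zc i z) ^ (2 * p))) \<le> B ^ (2 * p)" for z
      using power_mono[OF B(2), of z "2 * p"] by (simp add: norm_power)
  qed
qed

lemma funpow_N_mem: "x \<in> K \<Longrightarrow> (N i ^^ p) x \<in> K"
  by (induction p) (auto intro: N_mem)

lemma I_N_power:
  assumes x: "x \<in> K" and y: "y \<in> K" and f: "bounded_borel f"
  shows "I ((N i ^^ p) x) ((N i ^^ p) y) f = I x y (\<lambda>z. of_real (cmod (zc i z) ^ (2 * p)) * f z)"
  using f
proof (induction p arbitrary: f)
  case (Suc p)
  note xp = funpow_N_mem[OF x, of p] and yp = funpow_N_mem[OF y, of p]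
  have "I ((N i ^^ Suc p) x) ((N i ^^ Suc p) y) f
      = I ((N i ^^ p) x) ((N i ^^ p) y) (\<lambda>z. cnj (zc i z) * (zc i z * f z))"
    using I_N_left[OF xp N_mem[OF yp] Suc.prems]
      I_N_right[OF xp yp bounded_borel_mult[OF bounded_borel_zc Suc.prems]] by simp
  also have "\<dots> = I x y (\<lambda>z. of_real (cmod (zc i z) ^ (2 * p)) * (cnj (zc i z) * (zc i z * f z)))"
    by (rule Suc.IH) (intro bounded_borel_mult bounded_borel_cnj bounded_borel_zc Suc.prems)
  also have "\<dots> = I x y (\<lambda>z. of_real (cmod (zc i z) ^ (2 * Suc p)) * f z)"
  proof (rule arg_cong[of _ _ "I x y"], rule ext)
    fix z
    have "cnj (zc i z) * (zc i z * f z) = of_real ((cmod (zc i z))\<^sup>2) * f z"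
      unfolding complex_norm_square by (simp only: mult_ac)
    moreover have "cmod (zc i z) ^ (2 * Suc p) = cmod (zc i z) ^ (2 * p) * (cmod (zc i z))\<^sup>2"
      by (simp add: power_add[symmetric])
    ultimately show "of_real (cmod (zc i z) ^ (2 * p)) * (cnj (zc i z) * (zc i z * f z)) = of_real (cmod (zc i z) ^ (2 * Suc p)) * f z"
      by (simp only: of_real_mult mult.assoc)
  qed
  finally show ?case .
qed simp

lemma I_one: "x \<in> K \<Longrightarrow> y \<in> K \<Longrightarrow> I x y (\<lambda>_. 1) = cinner x y"
  using I_indicator[of x y UNIV] by (simp add: E_UNIV indicator_UNIV[abs_def])

end

subsection \<open>From the spectral measure to the operator inequalities\<close>

locale subnormal_pvm = joint_pvm K N E Q
  for K :: "'k::complex_hilbert set" and N :: "'n::finite \<Rightarrow> 'k \<Rightarrow> 'k" and E Q +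
  fixes S :: "'n \<Rightarrow> 'a::complex_hilbert \<Rightarrow> 'a" and V :: "'a \<Rightarrow> 'k"
  assumes bounded: "bounded_clinear (S i)" and comm: "S i (S j x) = S j (S i x)"
    and V_mem: "V x \<in> K" and V_inner: "cinner (V x) (V y) = cinner x y" and NV: "N i (V x) = V (S i x)"
begin

lemma commuting_S: "commuting S"
  by standard (rule comm)

lemma N_power_V: "(N i ^^ m) (V x) = V ((S i ^^ m) x)"
  by (induction m) (simp_all add: NV)

lemma I_fpow:
  assumes "finite A" "bounded_borel f"
  shows "I (V (fpow A S j x)) (V (fpow A S j y)) f =
    I (V x) (V y) (\<lambda>z. (\<Prod>i\<in>A. of_real (cmod (zc i z) ^ (2 * j i))) * f z)"
  using assms
proof (induction A arbitrary: f rule: finite_induct)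
  case empty
  then show ?case by (simp add: commuting.fpow_empty[OF commuting_S])
next
  case (insert i A)
  have "I (V (fpow (insert i A) S j x)) (V (fpow (insert i A) S j y)) f =
      I (V (fpow A S j x)) (V (fpow A S j y)) (\<lambda>z. of_real (cmod (zc i z) ^ (2 * j i)) * f z)"
    using I_N_power[OF V_mem[of "fpow A S j x"] V_mem[of "fpow A S j y"] insert.prems, where i = i and p = "j i"]
    by (simp add: commuting.fpow_insert[OF commuting_S insert.hyps(1,2)] N_power_V)
  also have "\<dots> = I (V x) (V y) (\<lambda>z. (\<Prod>i\<in>A. of_real (cmod (zc i z) ^ (2 * j i))) * (of_real (cmod (zc i z) ^ (2 * j i)) * f z))"
    by (rule insert.IH) (intro bounded_borel_mult bounded_borel_zc_power insert.prems)
  finally show ?case using insert.hyps by (simp add: mult_ac)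
qed

lemma bounded_borel_prod: "(\<And>i. i \<in> A \<Longrightarrow> bounded_borel (f i)) \<Longrightarrow> bounded_borel (\<lambda>t. \<Prod>i\<in>A. f i t)"
  by (induction A rule: infinite_finite_induct) (auto intro: bounded_borel_mult bounded_borel_const)

text \<open>Each entry of the array is an integral of |z|^(2j), so the moment functional of
  \<open>S\<close> becomes integration and inequalities can be checked pointwise.\<close>

lemma mom_eq_integral:
  "mom (pw S x y) P = I (V x) (V y) (\<lambda>z. of_real (\<Prod>i\<in>UNIV. poly (P i) ((cmod (zc i z))\<^sup>2)))"
proof -
  let ?B = "PiE UNIV (\<lambda>i. {..degree (P i)})"
  have bb: "bounded_borel (\<lambda>z. \<Prod>i\<in>UNIV. complex_of_real (cmod (zc i z) ^ (2 * j i)))" for j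
    by (intro bounded_borel_prod bounded_borel_zc_power)
  have "pw S x y j = I (V x) (V y) (\<lambda>z. \<Prod>i\<in>UNIV. of_real (cmod (zc i z) ^ (2 * j i)))" for j
  proof -
    have "pw S x y j = I (V (mpow S j x)) (V (mpow S j y)) (\<lambda>_. 1)"
      unfolding pw_def[OF bounded comm] by (simp add: I_one V_mem V_inner)
    also have "\<dots> = I (V x) (V y) (\<lambda>z. (\<Prod>i\<in>UNIV. of_real (cmod (zc i z) ^ (2 * j i))) * 1)"
      by (rule I_fpow) (auto intro: bounded_borel_const)
    finally show ?thesis by simp
  qed
  then have "mom (pw S x y) P = (\<Sum>j\<in>?B. I (V x) (V y) (\<lambda>z. of_real (\<Prod>i\<in>UNIV. coeff (P i) (j i)) * (\<Prod>i\<in>UNIV. of_real (cmod (zc i z) ^ (2 * j i)))))"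
    unfolding mom_def
    by (intro sum.cong refl) (simp only: sigma_functional_times[OF sigma_functional_I[OF V_mem V_mem] bb])
  also have "\<dots> = I (V x) (V y) (\<lambda>z. \<Sum>j\<in>?B. of_real (\<Prod>i\<in>UNIV. coeff (P i) (j i)) * (\<Prod>i\<in>UNIV. of_real (cmod (zc i z) ^ (2 * j i))))"
    by (rule sigma_functional_sum[OF sigma_functional_I[OF V_mem V_mem], symmetric])
      (intro bounded_borel_mult bounded_borel_const bb)
  also have "\<dots> = I (V x) (V y) (\<lambda>z. of_real (\<Prod>i\<in>UNIV. poly (P i) ((cmod (zc i z))\<^sup>2)))"
  proof (rule arg_cong[of _ _ "I (V x) (V y)"], rule ext)
    fix z
    have "(\<Prod>i\<in>UNIV. poly (P i) ((cmod (zc i z))\<^sup>2)) = (\<Sum>j\<in>?B. (\<Prod>i\<in>UNIV. coeff (P i) (j i)) * (\<Prod>i\<in>UNIV. cmod (zc i z) ^ (2 * j i)))"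
      unfolding poly_altdef by (subst prod_sum_PiE) (auto simp: prod.distrib power_mult)
    then show "(\<Sum>j\<in>?B. of_real (\<Prod>i\<in>UNIV. coeff (P i) (j i)) * (\<Prod>i\<in>UNIV. of_real (cmod (zc i z) ^ (2 * j i)))) =
        complex_of_real (\<Prod>i\<in>UNIV. poly (P i) ((cmod (zc i z))\<^sup>2))"
      by simp
  qed
  finally show ?thesis .
qed

lemma positive_hereditary:
  assumes Q1: "\<And>z i. z \<in> Q \<Longrightarrow> cmod (z $ i) \<le> 1"
  shows "positive_op (hereditary (\<Prod>i\<in>UNIV. (1 - zvar i * wvar i) ^ k i) S)"
  unfolding positive_op_hereditary[OF bounded comm] hform_prod[OF bounded comm]
proof
  fix x
  define g where "g z = (\<Prod>i\<in>UNIV. (1 - (cmod (zc i z))\<^sup>2) ^ k i)" for z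
  have g: "(\<lambda>z. complex_of_real (\<Prod>i\<in>UNIV. poly ([:1, -1:] ^ k i) ((cmod (zc i z))\<^sup>2))) = (\<lambda>z. complex_of_real (g z))"
    by (simp add: g_def)
  have zc1: "cmod (zc i z) \<le> 1" for i z using Q1[of z i] by (cases "z \<in> Q") (auto simp: zc_def)
  have pos: "0 \<le> g z" for z
    unfolding g_def using zc1 by (intro prod_nonneg zero_le_power) (simp add: power_le_one)
  have bb: "bounded_borel (\<lambda>z. complex_of_real (g z))"
  proof -
    have "bounded_borel (\<lambda>z. \<Prod>i\<in>UNIV. \<Prod>l<k i. 1 + (-1) * complex_of_real (cmod (zc i z) ^ (2 * 1)))"
      by (intro bounded_borel_prod bounded_borel_add bounded_borel_mult bounded_borel_const bounded_borel_zc_power)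
    then show ?thesis by (simp add: g_def)
  qed
  have "mom (pw S x x) (\<lambda>i. [:1, -1:] ^ k i) = (\<integral>z. complex_of_real (g z) \<partial>M (V x))"
    unfolding mom_eq_integral g by (rule I_diag[OF V_mem bb])
  also have "\<dots> = complex_of_real (\<integral>z. g z \<partial>M (V x))" by (rule integral_complex_of_real)
  finally show "mom (pw S x x) (\<lambda>i. [:1, -1:] ^ k i) \<in> \<real>\<^sub>\<ge>\<^sub>0"
    using Bochner_Integration.integral_nonneg[of "M (V x)" g] pos by simp
qed

text \<open>The test function \<open>f\<close> is kept general: \<open>f = 1\<close> gives the
  operator identity, and for \<open>f\<close> the defining function of the boundary the right side
  is the integral of its square.\<close>

lemma boundary_form:
  assumes x: "x \<in> K" and y: "y \<in> K" and f: "bounded_borel f"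
  shows "I x y f - (\<Sum>i\<in>UNIV. \<Sum>j=1..m i. I ((N i ^^ p i j) x) ((N i ^^ p i j) y) f)
    = I x y (\<lambda>z. of_real (1 - (\<Sum>i\<in>UNIV. \<Sum>j=1..m i. cmod (zc i z) ^ (2 * p i j))) * f z)"
proof -
  note sf = sigma_functional_I[OF x y]
  have bb: "bounded_borel (\<lambda>z. of_real (cmod (zc i z) ^ (2 * p i j)) * f z)" for i j
    by (intro bounded_borel_mult bounded_borel_zc_power f)
  have "(\<Sum>i\<in>UNIV. \<Sum>j=1..m i. I ((N i ^^ p i j) x) ((N i ^^ p i j) y) f)
      = (\<Sum>i\<in>UNIV. I x y (\<lambda>z. \<Sum>j=1..m i. of_real (cmod (zc i z) ^ (2 * p i j)) * f z))"
    by (intro sum.cong refl) (simp only: I_N_power[OF x y f] sigma_functional_sum[OF sf bb])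
  also have "\<dots> = I x y (\<lambda>z. \<Sum>i\<in>UNIV. \<Sum>j=1..m i. of_real (cmod (zc i z) ^ (2 * p i j)) * f z)"
    by (rule sigma_functional_sum[OF sf, symmetric]) (intro bounded_borel_sum bb)
  finally have eq: "(\<Sum>i\<in>UNIV. \<Sum>j=1..m i. I ((N i ^^ p i j) x) ((N i ^^ p i j) y) f)
      = I x y (\<lambda>z. \<Sum>i\<in>UNIV. \<Sum>j=1..m i. of_real (cmod (zc i z) ^ (2 * p i j)) * f z)" .
  have bS: "bounded_borel (\<lambda>z. \<Sum>i\<in>UNIV. \<Sum>j=1..m i. of_real (cmod (zc i z) ^ (2 * p i j)) * f z)"
    by (intro bounded_borel_sum bb)
  have "I x y f - I x y (\<lambda>z. \<Sum>i\<in>UNIV. \<Sum>j=1..m i. of_real (cmod (zc i z) ^ (2 * p i j)) * f z)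
      = I x y f + (-1) * I x y (\<lambda>z. \<Sum>i\<in>UNIV. \<Sum>j=1..m i. of_real (cmod (zc i z) ^ (2 * p i j)) * f z)"
    by simp
  also have "\<dots> = I x y (\<lambda>z. f z + (-1) * (\<Sum>i\<in>UNIV. \<Sum>j=1..m i. of_real (cmod (zc i z) ^ (2 * p i j)) * f z))"
    by (simp only: sigma_functional_times[OF sf bS, symmetric]
        sigma_functional_plus[OF sf f bounded_borel_mult[OF bounded_borel_const bS], symmetric])
  also have "\<dots> = I x y (\<lambda>z. of_real (1 - (\<Sum>i\<in>UNIV. \<Sum>j=1..m i. cmod (zc i z) ^ (2 * p i j))) * f z)"
    by (rule arg_cong[of _ _ "I x y"]) (simp add: fun_eq_iff sum_distrib_right left_diff_distrib)
  finally show ?thesis unfolding eq .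
qed

lemma bounded_borel_boundary:
  "bounded_borel (\<lambda>z. complex_of_real (1 - (\<Sum>i\<in>UNIV. \<Sum>j=1..m i. cmod (zc i z) ^ (2 * p i j))))"
proof -
  have "bounded_borel (\<lambda>z. 1 + (-1) * (\<Sum>i\<in>UNIV. \<Sum>j=1..m i. complex_of_real (cmod (zc i z) ^ (2 * p i j))))"
    by (intro bounded_borel_add bounded_borel_mult bounded_borel_const bounded_borel_sum bounded_borel_zc_power)
  then show ?thesis by (simp only: of_real_diff of_real_1 of_real_sum) simp
qed

lemma hereditary_boundary_eq_0:
  assumes Q0: "\<And>z. z \<in> Q \<Longrightarrow> (\<Sum>i\<in>UNIV. \<Sum>j=1..m i. cmod (z $ i) ^ (2 * p i j)) = 1"
  shows "hereditary (1 - (\<Sum>i\<in>UNIV. \<Sum>j=1..m i. zvar i ^ p i j * wvar i ^ p i j)) S = (\<lambda>x. 0)"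
  unfolding hereditary_eq_0_iff[OF bounded comm] hform_boundary[OF bounded comm]
proof (intro allI)
  fix x y
  have "cinner x y - (\<Sum>i\<in>UNIV. \<Sum>j=1..m i. cinner ((S i ^^ p i j) x) ((S i ^^ p i j) y))
      = I (V x) (V y) (\<lambda>_. 1) - (\<Sum>i\<in>UNIV. \<Sum>j=1..m i. I ((N i ^^ p i j) (V x)) ((N i ^^ p i j) (V y)) (\<lambda>_. 1))"
    unfolding N_power_V by (simp add: I_one V_mem V_inner)
  also have "\<dots> = I (V x) (V y) (\<lambda>z. of_real (1 - (\<Sum>i\<in>UNIV. \<Sum>j=1..m i. cmod (zc i z) ^ (2 * p i j))) * 1)"
    by (rule boundary_form[OF V_mem V_mem bounded_borel_const])
  also have "\<dots> = 0"
  proof (rule I_off_Q[OF V_mem V_mem])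
    show "bounded_borel (\<lambda>z. complex_of_real (1 - (\<Sum>i\<in>UNIV. \<Sum>j=1..m i. cmod (zc i z) ^ (2 * p i j))) * 1)"
      using bounded_borel_boundary by simp
    show "complex_of_real (1 - (\<Sum>i\<in>UNIV. \<Sum>j=1..m i. cmod (zc i z) ^ (2 * p i j))) * 1 = 0" if "z \<in> Q" for z
      using Q0[OF that] that by (simp add: zc_def)
  qed
  finally show "cinner x y - (\<Sum>i\<in>UNIV. \<Sum>j=1..m i. cinner ((S i ^^ p i j) x) ((S i ^^ p i j) y)) = 0" .
qed

text \<open>If \<open>g = 1 - \<Sum>\<bar>z\<^sub>i\<bar>\<^sup>2\<^sup>p\<close> and \<open>\<langle>g(N)x, y\<rangle>\<close> vanishes, then
  \<open>\<integral>g\<^sup>2 d\<langle>E x, x\<rangle>\<close> is a combination of integrals \<open>\<integral>g d\<langle>E u, u\<rangle>\<close>, hence vanishes too.\<close>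

lemma E_off_boundary:
  assumes z: "\<And>x y. x \<in> K \<Longrightarrow> y \<in> K \<Longrightarrow>
      cinner x y = (\<Sum>i\<in>UNIV. \<Sum>j=1..m i. cinner ((N i ^^ p i j) x) ((N i ^^ p i j) y))"
    and B: "boundary_Sigma m p \<in> sets borel" and x: "x \<in> K"
  shows "E (- boundary_Sigma m p) x = 0"
proof -
  define g where "g z = 1 - (\<Sum>i\<in>UNIV. \<Sum>j=1..m i. cmod (zc i z) ^ (2 * p i j))" for z
  have gb: "bounded_borel (\<lambda>z. complex_of_real (g z))" unfolding g_def by (rule bounded_borel_boundary)
  have I_g: "I u v (\<lambda>z. complex_of_real (g z)) = 0" if u: "u \<in> K" and v: "v \<in> K" for u v
  proof -
    have "I u v (\<lambda>z. of_real (g z) * 1) = I u v (\<lambda>_. 1) - (\<Sum>i\<in>UNIV. \<Sum>j=1..m i. I ((N i ^^ p i j) u) ((N i ^^ p i j) v) (\<lambda>_. 1))"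
      unfolding g_def by (rule boundary_form[OF u v bounded_borel_const, symmetric])
    also have "\<dots> = 0" using z[OF u v] by (simp add: I_one funpow_N_mem u v)
    finally show ?thesis by simp
  qed
  have "I x x (\<lambda>z. of_real (g z) * of_real (g z)) = I x x (\<lambda>z. of_real (g z)) -
      (\<Sum>i\<in>UNIV. \<Sum>j=1..m i. I ((N i ^^ p i j) x) ((N i ^^ p i j) x) (\<lambda>z. of_real (g z)))"
    using boundary_form[OF x x gb, of p m] unfolding g_def[symmetric] by simp
  also have "\<dots> = 0" by (simp add: I_g funpow_N_mem x)
  finally have "(\<integral>z. complex_of_real (g z) * of_real (g z) \<partial>M x) = 0"
    using I_diag[OF x bounded_borel_mult[OF gb gb]] by simp
  then have "complex_of_real (\<integral>z. (g z)\<^sup>2 \<partial>M x) = 0"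
    by (simp only: power2_eq_square of_real_mult integral_complex_of_real[symmetric])
  then have int0: "(\<integral>z. (g z)\<^sup>2 \<partial>M x) = 0" by (simp only: of_real_eq_0_iff)
  have "integrable (M x) (\<lambda>z. complex_of_real (g z) * of_real (g z))"
    by (rule integrable_bounded_borel[OF finite_M[OF x] sets_M bounded_borel_mult[OF gb gb]])
  then have "integrable (M x) (\<lambda>z. Re (complex_of_real (g z) * of_real (g z)))" by (rule integrable_Re)
  then have "integrable (M x) (\<lambda>z. (g z)\<^sup>2)" by (simp add: power2_eq_square)
  then have "AE z in M x. (g z)\<^sup>2 = 0"
    using integral_nonneg_eq_0_iff_AE[of "M x" "\<lambda>z. (g z)\<^sup>2"] int0 by simp
  then have "AE z in M x. z \<in> boundary_Sigma m p"
    using AE_Q[OF x]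
  proof eventually_elim
    fix z assume "(g z)\<^sup>2 = 0" "z \<in> Q"
    then show "z \<in> boundary_Sigma m p" by (simp add: boundary_Sigma_def g_def zc_def)
  qed
  moreover have C: "- boundary_Sigma m p \<in> sets borel" using B by simp
  ultimately have "emeasure (M x) (- boundary_Sigma m p) = 0"
    using AE_iff_measurable[of "- boundary_Sigma m p" "M x" "\<lambda>z. z \<in> boundary_Sigma m p"]
      sets_eq_imp_space_eq[OF sets_M, of x] by (auto simp: sets_M)
  then have "Re (cinner (E (- boundary_Sigma m p) x) x) \<le> 0"
    using emeasure_M[OF x C] by (simp add: ennreal_eq_0_iff)
  then show ?thesis using cinner_E_self[OF C x] by simp
qed

end

lemma boundary_Sigma_closed: "closed (boundary_Sigma m p)"
  unfolding boundary_Sigma_def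
  by (intro closed_Collect_eq continuous_intros)

text \<open>A coordinate of modulus above 1 has a summand that alone exceeds the total; the summand
  j = 1 exists because m i \<ge> 1 and has a positive exponent.\<close>

lemma boundary_Sigma_component_le:
  assumes m: "\<And>i. m i \<ge> 1" and p: "\<And>i j. j \<in> {1..m i} \<Longrightarrow> p i j > 0" and z: "z \<in> boundary_Sigma m p"
  shows "cmod (z $ i) \<le> 1"
proof (rule ccontr)
  assume "\<not> cmod (z $ i) \<le> 1"
  then have "1 < cmod (z $ i)" by simp
  then have "1 < cmod (z $ i) ^ (2 * p i 1)" using p[of 1 i] m[of i] by (intro one_less_power) auto
  also have "\<dots> \<le> (\<Sum>j=1..m i. cmod (z $ i) ^ (2 * p i j))"
    using m[of i] by (intro member_le_sum) auto
  also have "\<dots> \<le> (\<Sum>i\<in>UNIV. \<Sum>j=1..m i. cmod (z $ i) ^ (2 * p i j))"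
    by (rule member_le_sum[of i UNIV "\<lambda>i. \<Sum>j=1..m i. cmod (z $ i) ^ (2 * p i j)"]) (auto intro: sum_nonneg)
  also have "\<dots> = 1" using z by (simp add: boundary_Sigma_def)
  finally show False by simp
qed

lemma bounded_componentwise:
  assumes "\<And>z i. z \<in> Q \<Longrightarrow> cmod (z $ i) \<le> C"
  shows "bounded (Q :: (complex ^ 'n::finite) set)"
proof (rule boundedI)
  fix z :: "complex ^ 'n" assume "z \<in> Q"
  have "norm z \<le> (\<Sum>i\<in>UNIV. norm (z $ i))" unfolding norm_vec_def by (rule L2_set_le_sum) simp
  also have "\<dots> \<le> (\<Sum>i\<in>(UNIV::'n set). C)" by (intro sum_mono assms \<open>z \<in> Q\<close>)
  finally show "norm z \<le> real CARD('n) * C" by simp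
qed

lemma boundary_Sigma_isometry_imp_hereditary:
  fixes S :: "'n::finite \<Rightarrow> 'a::complex_hilbert \<Rightarrow> 'a"
  assumes m: "\<And>i. m i \<ge> 1" and p: "\<And>i j. j \<in> {1..m i} \<Longrightarrow> p i j > 0"
    and iso: "boundary_Sigma_isometry TYPE('k::complex_hilbert) m p S"
  shows "positive_op (hereditary (\<Prod>i\<in>UNIV. (1 - zvar i * wvar i) ^ k i) S)"
    and "hereditary (1 - (\<Sum>i\<in>UNIV. \<Sum>j=1..m i. zvar i ^ p i j * wvar i ^ p i j)) S = (\<lambda>x. 0)"
proof -
  have sub: "commuting_tuple_on UNIV S"
    using iso by (simp add: boundary_Sigma_isometry_def subnormal_def)
  obtain V :: "'a \<Rightarrow> 'k" and K N E where mn: "minimal_normal_extension S V K N"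
    and jE: "joint_spectral_measure K N E" and E0: "\<forall>x\<in>K. E (- boundary_Sigma m p) x = 0"
    using iso unfolding boundary_Sigma_isometry_def by (elim conjE exE, intro that)
  have ext: "normal_extension S V K N" using mn by (simp add: minimal_normal_extension_def)
  interpret subnormal_pvm K N E "boundary_Sigma m p" S V
  proof
    show "boundary_Sigma m p \<in> sets borel" using boundary_Sigma_closed by (rule borel_closed)
    show "bounded (boundary_Sigma m p)"
      by (rule bounded_componentwise) (rule boundary_Sigma_component_le[OF m p])
    show "bounded_clinear (S i)" "S i (S j x) = S j (S i x)" for i j x
      using sub by (auto simp: commuting_tuple_on_def bounded_clinear_iff_bounded_op_on)
    show "bounded_op_on K (N i)" for i using ext by (auto simp: normal_extension_def commuting_tuple_on_def)
  qed (use ext jE E0 in \<open>auto simp: normal_extension_def\<close>)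
  show "positive_op (hereditary (\<Prod>i\<in>UNIV. (1 - zvar i * wvar i) ^ k i) S)"
    by (rule positive_hereditary) (rule boundary_Sigma_component_le[OF m p])
  show "hereditary (1 - (\<Sum>i\<in>UNIV. \<Sum>j=1..m i. zvar i ^ p i j * wvar i ^ p i j)) S = (\<lambda>x. 0)"
    by (rule hereditary_boundary_eq_0) (simp add: boundary_Sigma_def)
qed

subsection \<open>The minimal normal extension and its spectral measure\<close>

lemma (in commuting) mpow_Suc: "mpow T (\<beta>(i := Suc (\<beta> i))) x = mpow T \<beta> (T i x)"
proof -
  have "\<beta>(i := Suc (\<beta> i)) = (\<lambda>l. \<beta> l + (if l = i then 1 else 0))" by auto
  then show ?thesis using mpow_add[of \<beta> "\<lambda>l. if l = i then 1 else 0" x] mpow_single[of i 1 x] by simp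
qed

text \<open>Identities of operators on the ambient space are checked on the spanning set
  \<open>R\<close> and on its orthogonal complement, where the operators constructed above
  vanish.\<close>

lemma total_cinner_eq:
  fixes A B :: "'k::complex_hilbert \<Rightarrow> 'k"
  assumes A: "bounded_clinear A" and B: "bounded_clinear B"
    and R: "\<And>r. r \<in> R \<Longrightarrow> cinner (A r) a = cinner (B r) b"
    and perp: "\<And>u. (\<And>r. r \<in> R \<Longrightarrow> cinner u r = 0) \<Longrightarrow> cinner (A u) a = cinner (B u) b"
  shows "cinner (A y) a = cinner (B y) b"
proof (rule total_induct[where R = R and y = y])
  show "complex_vector.subspace {y. cinner (A y) a = cinner (B y) b}"
    by (rule complex_vector.subspaceI)
      (auto simp: bounded_clinear_zero A B bounded_clinear_add bounded_clinear_scaleC cinner_add_left cinner_scaleC_left)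
  show "closed {y. cinner (A y) a = cinner (B y) b}"
    by (intro closed_Collect_eq continuous_on_cinner bounded_clinear_continuous A B continuous_on_const)
qed (use R perp in blast)+

lemma total_op_eq:
  fixes A B :: "'k::complex_hilbert \<Rightarrow> 'k"
  assumes A: "bounded_clinear A" and B: "bounded_clinear B"
    and R: "\<And>r. r \<in> R \<Longrightarrow> A r = B r"
    and perp: "\<And>u. (\<And>r. r \<in> R \<Longrightarrow> cinner u r = 0) \<Longrightarrow> A u = B u"
  shows "A y = B y"
proof (rule cinner_eqI)
  fix a
  show "cinner (A y) a = cinner (B y) a"
  proof (rule total_cinner_eq[where R = R, OF A B])
    show "cinner (A r) a = cinner (B r) a" if "r \<in> R" for r using R[OF that] by simp
    show "cinner (A u) a = cinner (B u) a" if "\<And>r. r \<in> R \<Longrightarrow> cinner u r = 0" for u using perp[OF that] by simp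
  qed
qed

definition orth :: "'k::complex_hilbert set \<Rightarrow> 'k set" where
  "orth R = {u. \<forall>r\<in>R. cinner u r = 0}"

lemma closed_csubspace_orth: "closed_csubspace (orth R)"
proof -
  have "orth R = (\<Inter>r\<in>R. {u. cinner u r = 0})" by (auto simp: orth_def)
  moreover have "closed (\<Inter>r\<in>R. {u. cinner u r = 0})"
    by (intro closed_INT ballI closed_Collect_eq continuous_on_cinner continuous_on_id continuous_on_const)
  ultimately have "closed (orth R)" by simp
  moreover have "complex_vector.subspace (orth R)"
    by (rule complex_vector.subspaceI) (auto simp: orth_def cinner_add_left cinner_scaleC_left)
  ultimately show ?thesis by (simp add: closed_csubspace_def)
qed

lemma orth_orth_superset: "R \<subseteq> orth (orth R)"
  using cinner_eq_0_commute by (auto simp: orth_def)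

text \<open>Together with \<open>orth_orth_superset\<close>: the double complement is the closed
  linear span, here described without spans or closures.\<close>

lemma orth_orth_minimal:
  assumes X: "closed_csubspace X" and R: "R \<subseteq> X"
  shows "orth (orth R) \<subseteq> X"
proof
  fix x assume x: "x \<in> orth (orth R)"
  obtain u where u: "u \<in> X" "\<And>v. v \<in> X \<Longrightarrow> cinner (x - u) v = 0"
    using orthogonal_projection_exists[of X x] X by (auto simp: closed_csubspace_def)
  have "x - u \<in> orth R" using u(2) R by (auto simp: orth_def)
  then have "cinner x (x - u) = 0" using x by (simp add: orth_def)
  then have "cinner (x - u) x = 0" by (simp only: cinner_eq_0_commute)
  moreover have "cinner (x - u) u = 0" by (rule u(2)[OF u(1)])
  ultimately have "cinner (x - u) (x - u) = 0" by (simp add: cinner_diff_right)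
  then have "x = u" by (simp add: cinner_self)
  then show "x \<in> X" using u(1) by simp
qed

section \<open>The joint spectral measure of commuting normal contractions\<close>

locale normal_contractions =
  fixes N C :: "'n::finite \<Rightarrow> 'k::complex_hilbert \<Rightarrow> 'k"
  assumes N_bounded: "bounded_clinear (N i)" and C_bounded: "bounded_clinear (C i)"
    and adj: "cinner (N i y) z = cinner y (C i z)" and contraction: "norm (N i y) \<le> norm y"
    and NN: "N i (N l y) = N l (N i y)" and NC: "N i (C l y) = C l (N i y)"
    and CC: "C i (C l y) = C l (C i y)"
begin

lemma adj': "cinner (C i y) z = cinner y (N i z)"
  using adj[of i z y] cinner_commute[of "C i y" z] cinner_commute[of y "N i z"] by simp

text \<open>(1 + Re N_i)/2 and (1 + Im N_i)/2, where \<open>C i\<close> is the adjoint and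
  (-\<i>/2)(N_i - C_i) the imaginary part. Contractivity puts them between 0 and 1, as the unit cube
  demands; the sum type indexes these 2n operators.\<close>

definition A :: "'n + 'n \<Rightarrow> 'k \<Rightarrow> 'k" where
  "A s x = (case s of
     Inl i \<Rightarrow> (1 / 2) *\<^sub>C (x + (1 / 2) *\<^sub>C (N i x + C i x))
   | Inr i \<Rightarrow> (1 / 2) *\<^sub>C (x + (- \<i> / 2) *\<^sub>C (N i x - C i x)))"

lemma A_bounded: "bounded_clinear (A s)"
proof (cases s)
  case (Inl i)
  have "A s = (\<lambda>x. (1 / 2) *\<^sub>C (x + (1 / 2) *\<^sub>C (N i x + C i x)))" by (simp add: A_def Inl fun_eq_iff)
  then show ?thesis
    by (simp only:) (intro bounded_clinear_scaleC_right bounded_clinear_plus bounded_clinear_id N_bounded C_bounded)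
next
  case (Inr i)
  have "A s = (\<lambda>x. (1 / 2) *\<^sub>C (x + (- \<i> / 2) *\<^sub>C (N i x - C i x)))" by (simp add: A_def Inr fun_eq_iff)
  then show ?thesis
    by (simp only:) (intro bounded_clinear_scaleC_right bounded_clinear_plus bounded_clinear_minus bounded_clinear_id N_bounded C_bounded)
qed

lemma cinner_A_Inl: "cinner (A (Inl i) x) x = of_real (((norm x)\<^sup>2 + Re (cinner (N i x) x)) / 2)"
  and cinner_A_Inr: "cinner (A (Inr i) x) x = of_real (((norm x)\<^sup>2 + Im (cinner (N i x) x)) / 2)"
proof -
  have c: "cinner (C i x) x = cnj (cinner (N i x) x)"
    unfolding adj' by (rule cinner_commute)
  show "cinner (A (Inl i) x) x = of_real (((norm x)\<^sup>2 + Re (cinner (N i x) x)) / 2)"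
    by (simp add: A_def cinner_scaleC_left cinner_add_left c cinner_self complex_eq_iff)
  show "cinner (A (Inr i) x) x = of_real (((norm x)\<^sup>2 + Im (cinner (N i x) x)) / 2)"
    by (simp add: A_def cinner_scaleC_left cinner_add_left cinner_diff_left c cinner_self complex_eq_iff)
qed

lemma A_effect: "effect (A s)"
  unfolding effect_def
proof (intro conjI allI)
  show "self_adjoint (A s)"
    unfolding self_adjoint_def
    by (cases s) (auto simp: A_bounded, auto simp: A_def cinner_scaleC_left cinner_scaleC_right cinner_add_left
        cinner_add_right cinner_diff_left cinner_diff_right adj adj' algebra_simps)
  fix x
  have "cmod (cinner (N i x) x) \<le> (norm x)\<^sup>2" for i
  proof -
    have "cmod (cinner (N i x) x) \<le> norm (N i x) * norm x" by (rule cinner_Cauchy_Schwarz)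
    also have "\<dots> \<le> norm x * norm x" by (rule mult_right_mono[OF contraction]) simp
    finally show ?thesis by (simp add: power2_eq_square)
  qed
  then have bnd: "\<bar>Re (cinner (N i x) x)\<bar> \<le> (norm x)\<^sup>2" "\<bar>Im (cinner (N i x) x)\<bar> \<le> (norm x)\<^sup>2" for i
    using abs_Re_le_cmod[of "cinner (N i x) x"] abs_Im_le_cmod[of "cinner (N i x) x"] by (auto intro: order_trans)
  have "0 \<le> Re (cinner (A s x) x) \<and> Re (cinner (A s x) x) \<le> (norm x)\<^sup>2"
  proof (cases s)
    case (Inl i)
    then show ?thesis unfolding Inl cinner_A_Inl Re_complex_of_real using bnd(1)[of i] by (auto simp: abs_le_iff)
  next
    case (Inr i)
    then show ?thesis unfolding Inr cinner_A_Inr Re_complex_of_real using bnd(2)[of i] by (auto simp: abs_le_iff)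
  qed
  then show "0 \<le> Re (cinner (A s x) x)" and "Re (cinner (A s x) x) \<le> (norm x)\<^sup>2" by auto
qed

lemma A_comm: "A s (A t x) = A t (A s x)"
  by (cases s; cases t)
    (simp_all add: A_def bounded_clinear_add[OF N_bounded] bounded_clinear_add[OF C_bounded]
      bounded_clinear_diff[OF N_bounded] bounded_clinear_diff[OF C_bounded]
      bounded_clinear_scaleC[OF N_bounded] bounded_clinear_scaleC[OF C_bounded] NN NC CC
      scaleC_add_right complex_vector.scale_right_diff_distrib scaleC_scaleC algebra_simps)

sublocale effects: commuting_effects A
  by standard (rule A_effect, rule A_comm)

text \<open>Inverts the affine normalisation behind \<open>A\<close>, so that image measures live in
  the variables z_i.\<close>

definition \<phi> :: "real ^ ('n + 'n) \<Rightarrow> complex ^ 'n" where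
  "\<phi> t = (\<chi> i. of_real (2 * t $ Inl i - 1) + \<i> * of_real (2 * t $ Inr i - 1))"

lemma \<phi>_measurable: "\<phi> \<in> borel_measurable borel"
  unfolding \<phi>_def[abs_def] by (intro borel_measurable_continuous_onI continuous_intros continuous_on_vec_lambda)

lemma \<phi>_vimage: "B \<in> sets borel \<Longrightarrow> \<phi> -` B \<in> sets borel"
  using measurable_sets[OF \<phi>_measurable, of B] by simp

definition F :: "(complex ^ 'n) set \<Rightarrow> 'k \<Rightarrow> 'k" where
  "F B = effects.E (\<phi> -` B)"

lemma scalar_measure_F: "scalar_measure F x = distr (effects.M x) borel \<phi>"
proof -
  have m: "\<phi> \<in> measurable (effects.M x) borel"
    unfolding measurable_cong_sets[OF effects.sets_M refl] by (rule \<phi>_measurable)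
  have eq: "emeasure (distr (effects.M x) borel \<phi>) B = ennreal (Re (cinner (F B x) x))" if B: "B \<in> sets borel" for B
  proof -
    interpret finite_measure "effects.M x" by (rule effects.finite_M)
    have "emeasure (distr (effects.M x) borel \<phi>) B = emeasure (effects.M x) (\<phi> -` B)"
      using B sets_eq_imp_space_eq[OF effects.sets_M, of x] by (simp add: emeasure_distr[OF m])
    also have "\<dots> = ennreal (measure (effects.M x) (\<phi> -` B))" by (rule emeasure_eq_measure)
    finally show ?thesis by (simp add: F_def effects.measure_M[OF \<phi>_vimage[OF B]])
  qed
  have "distr (effects.M x) borel \<phi> = measure_of UNIV (sets borel) (emeasure (distr (effects.M x) borel \<phi>))"
    using measure_of_of_measure[of "distr (effects.M x) borel \<phi>"] by simp
  also have "\<dots> = scalar_measure F x"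
    unfolding scalar_measure_def
  proof (rule measure_of_eq)
    fix B assume "B \<in> sigma_sets UNIV (sets (borel :: (complex ^ 'n) measure))"
    then have "B \<in> sets borel" using sets.sigma_sets_eq[of "borel :: (complex ^ 'n) measure"] by simp
    then show "emeasure (distr (effects.M x) borel \<phi>) B = ennreal (Re (cinner (F B x) x))" by (rule eq)
  qed simp
  finally show ?thesis by simp
qed

lemma integral_coordinate_F:
  "integrable (scalar_measure F x) (\<lambda>z. z $ i)" "(\<integral>z. z $ i \<partial>scalar_measure F x) = cinner (N i x) x"
proof -
  have m: "\<phi> \<in> measurable (effects.M x) borel"
    unfolding measurable_cong_sets[OF effects.sets_M refl] by (rule \<phi>_measurable)
  have c: "(\<lambda>z :: complex ^ 'n. z $ i) \<in> borel_measurable borel"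
    by (intro borel_measurable_continuous_onI continuous_intros)
  interpret finite_measure "effects.M x" by (rule effects.finite_M)
  have int: "integrable (effects.M x) (\<lambda>t. 2 * t $ s - 1)" for s
    by (intro Bochner_Integration.integrable_diff integrable_mult_right effects.integral_coordinate(1)) simp
  have val: "(\<integral>t. 2 * t $ s - 1 \<partial>effects.M x) = 2 * Re (cinner (A s x) x) - (norm x)\<^sup>2" for s
  proof -
    have "(\<integral>t. 2 * t $ s - 1 \<partial>effects.M x) = 2 * (\<integral>t. t $ s \<partial>effects.M x) - measure (effects.M x) (space (effects.M x))"
      using effects.integral_coordinate(1)[of x s] by simp
    also have "(\<integral>t. t $ s \<partial>effects.M x) = Re (cinner (A s x) x)"
      by (simp only: effects.integral_coordinate(2)[symmetric] Re_complex_of_real)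
    finally show ?thesis
      using effects.measure_M_space[of x] sets_eq_imp_space_eq[OF effects.sets_M, of x] by simp
  qed
  have int2: "integrable (effects.M x) (\<lambda>t. \<phi> t $ i)"
    unfolding \<phi>_def vec_lambda_beta
    by (intro Bochner_Integration.integrable_add integrable_mult_right integrable_of_real int)
  then show "integrable (scalar_measure F x) (\<lambda>z. z $ i)"
    unfolding scalar_measure_F by (subst integrable_distr_eq[OF m c])
  have "(\<integral>z. z $ i \<partial>scalar_measure F x) = (\<integral>t. \<phi> t $ i \<partial>effects.M x)"
    unfolding scalar_measure_F by (rule integral_distr[OF m c])
  also have "\<dots> = (\<integral>t. complex_of_real (2 * t $ Inl i - 1) \<partial>effects.M x) + (\<integral>t. \<i> * complex_of_real (2 * t $ Inr i - 1) \<partial>effects.M x)"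
    unfolding \<phi>_def vec_lambda_beta
    by (intro Bochner_Integration.integral_add integrable_mult_right integrable_of_real int)
  also have "\<dots> = of_real (\<integral>t. 2 * t $ Inl i - 1 \<partial>effects.M x) + \<i> * of_real (\<integral>t. 2 * t $ Inr i - 1 \<partial>effects.M x)"
    by (simp only: integral_mult_right_zero integral_complex_of_real)
  also have "\<dots> = cinner (N i x) x"
    unfolding val cinner_A_Inl cinner_A_Inr by (simp add: complex_eq_iff add_divide_distrib)
  finally show "(\<integral>z. z $ i \<partial>scalar_measure F x) = cinner (N i x) x" .
qed

text \<open>The image of the unit cube under \<open>\<phi>\<close>.\<close>

definition square :: "(complex ^ 'n) set" where
  "square = {z. \<forall>i. \<bar>Re (z $ i)\<bar> \<le> 1 \<and> \<bar>Im (z $ i)\<bar> \<le> 1}"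

lemma square_borel: "square \<in> sets borel"
proof -
  have "square = (\<Inter>i. {z. \<bar>Re (z $ i)\<bar> \<le> 1} \<inter> {z. \<bar>Im (z $ i)\<bar> \<le> 1})" by (auto simp: square_def)
  moreover have "closed (\<Inter>i. {z :: complex ^ 'n. \<bar>Re (z $ i)\<bar> \<le> 1} \<inter> {z. \<bar>Im (z $ i)\<bar> \<le> 1})"
    by (intro closed_INT ballI closed_Int closed_Collect_le continuous_intros)
  ultimately show ?thesis by (simp add: borel_closed)
qed

lemma square_bounded: "bounded square"
proof (rule bounded_componentwise)
  fix z i assume "z \<in> square"
  then have "\<bar>Re (z $ i)\<bar> \<le> 1" "\<bar>Im (z $ i)\<bar> \<le> 1" by (auto simp: square_def)
  then show "cmod (z $ i) \<le> 2" using cmod_le[of "z $ i"] by linarith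
qed

lemma F_off_square: "F (- square) x = 0"
proof -
  have B: "\<phi> -` (- square) \<in> sets borel" by (rule \<phi>_vimage) (use square_borel in simp)
  have sub: "t \<notin> cbox 0 1" if "t \<in> \<phi> -` (- square)" for t
  proof
    assume "t \<in> cbox 0 1"
    then have "0 \<le> t $ s" "t $ s \<le> 1" for s by (auto simp: mem_box_cart)
    then have "\<bar>2 * t $ s - 1\<bar> \<le> 1" for s by (smt (verit))
    then show False using that by (auto simp: square_def \<phi>_def)
  qed
  have "effects.I x x (indicator (\<phi> -` (- square))) = 0"
    using sub by (intro effects.I_off_cube bounded_borel_indicator[OF B]) (auto simp: indicator_def)
  then have "cinner (F (- square) x) x = 0" for x
    using effects.I_off_cube[OF bounded_borel_indicator[OF B], of x x] sub
    by (force simp: F_def effects.cinner_E[OF B] indicator_def)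
  \<comment> \<open>For a projection the diagonal value is the squared norm of the image, so
    vanishing on the diagonal suffices.\<close>
  moreover have "cinner (F (- square) x) (F (- square) x) = cinner (F (- square) x) x"
    using effects.E_Int[OF B B, of x] by (simp add: F_def effects.E_adjoint[OF B, symmetric])
  ultimately show ?thesis by (simp add: cinner_self)
qed

lemma joint_spectral_measure_F:
  assumes inv: "\<And>B x. B \<in> sets borel \<Longrightarrow> x \<in> K \<Longrightarrow> F B x \<in> K"
  shows "joint_spectral_measure K N F"
  unfolding joint_spectral_measure_def projection_valued_measure_def
proof (intro conjI ballI allI impI)
  fix B :: "(complex ^ 'n) set" assume "B \<in> sets borel"
  note B = this \<phi>_vimage[OF this]
  show "bounded_op_on K (F B)"
    unfolding bounded_op_on_def
    using inv[OF B(1)] bounded_clinear_bounded[OF effects.bounded_E[OF B(2)]]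
    by (auto simp: F_def bounded_clinear_add[OF effects.bounded_E[OF B(2)]]
        bounded_clinear_scaleC[OF effects.bounded_E[OF B(2)]])
  show "F B (F B x) = F B x" for x
    using effects.E_Int[OF B(2) B(2), of x] by (simp add: F_def)
  show "cinner (F B x) y = cinner x (F B y)" for x y
    by (simp add: F_def effects.E_adjoint[OF B(2)])
next
  show "F {} x = 0" "F UNIV x = x" for x
    by (simp_all add: F_def effects.E_empty effects.E_UNIV)
next
  fix A B :: "(complex ^ 'n) set" and x assume "A \<in> sets borel" "B \<in> sets borel"
  then show "F (A \<inter> B) x = F A (F B x)"
    by (simp add: F_def vimage_Int effects.E_Int \<phi>_vimage)
next
  fix S :: "nat \<Rightarrow> (complex ^ 'n) set" and x
  assume S: "range S \<subseteq> sets borel" "disjoint_family S"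
  have "disjoint_family (\<lambda>k. \<phi> -` S k)" using S(2) by (auto simp: disjoint_family_on_def)
  moreover have "\<phi> -` S k \<in> sets borel" for k using S(1) by (intro \<phi>_vimage) auto
  ultimately show "(\<lambda>k. F (S k) x) sums F (\<Union>k. S k) x"
    unfolding F_def vimage_UN by (rule effects.E_sums[rotated])
qed (simp_all add: integral_coordinate_F)

text \<open>On \<open>orth R\<close> each \<open>A s\<close> is half the identity, so the moments
  <A^\<alpha> x, u> with \<open>u\<close> in \<open>orth R\<close> and \<open>x\<close> in its
  complement all vanish, and with them the whole functional of the pair \<open>x\<close>,
  \<open>u\<close>.\<close>

lemma F_invariant:
  assumes R: "\<And>i u. u \<in> orth R \<Longrightarrow> N i u = 0" "\<And>i u. u \<in> orth R \<Longrightarrow> C i u = 0"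
    and B: "B \<in> sets borel" and x: "x \<in> orth (orth R)"
  shows "F B x \<in> orth (orth R)"
proof -
  have scale: "c *\<^sub>C u \<in> orth R" if "u \<in> orth R" for c u
    using that by (simp add: orth_def cinner_scaleC_left)
  have A: "A s u \<in> orth R" if "u \<in> orth R" for s u
    using scale[OF that] R[OF that] by (cases s) (simp_all add: A_def)
  have A_pow: "(A s ^^ m) u \<in> orth R" if "u \<in> orth R" for s m u
    using that by (induction m) (auto intro: A)
  have mpow: "fpow D A \<alpha> u \<in> orth R" if "finite D" "u \<in> orth R" for D \<alpha> u
    using that by (induction D rule: finite_induct) (auto simp: effects.fpow_insert intro: A_pow)
  have "cinner (F B x) u = 0" if u: "u \<in> orth R" for u
  proof -
    have "effects.I x u (indicator (\<phi> -` B)) = 0"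
    proof (rule sigma_functional_cube_eq_0[OF effects.sigma_functional_I _ effects.I_off_cube bounded_borel_indicator[OF \<phi>_vimage[OF B]]])
      show "effects.I x u (cube_monom \<alpha>) = 0" for \<alpha>
        using x mpow[of UNIV u \<alpha>] u
        by (simp add: effects.I_cube_monom effects.mpow_adjoint orth_def)
    qed
    then show ?thesis by (simp add: F_def effects.cinner_E[OF \<phi>_vimage[OF B]])
  qed
  then show ?thesis by (simp add: orth_def)
qed

end

lemma hereditary_imp_boundary_Sigma_isometry:
  fixes S :: "'n::finite \<Rightarrow> 'a::complex_hilbert \<Rightarrow> 'a"
  assumes inf: "infinite_dimensional TYPE('k::complex_hilbert)"
    and sep: "separable_space (euclidean :: 'a topology)"
    and S: "commuting_tuple_on UNIV S"
    and pos: "\<And>k :: 'n \<Rightarrow> nat. positive_op (hereditary (\<Prod>i\<in>UNIV. (1 - zvar i * wvar i) ^ k i) S)"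
    and bdry: "hereditary (1 - (\<Sum>i\<in>UNIV. \<Sum>j=1..m i. zvar i ^ p i j * wvar i ^ p i j)) S = (\<lambda>x. 0)"
  shows "boundary_Sigma_isometry TYPE('k) m p S"
proof -
  have bounded: "bounded_clinear (S i)" and comm: "S i (S j x) = S j (S i x)" for i j x
    using S by (auto simp: commuting_tuple_on_def bounded_clinear_iff_bounded_op_on)
  interpret ch: completely_hypercontractive S
  proof
    show "mom (\<lambda>\<alpha>. cinner (mpow S \<alpha> x) (mpow S \<alpha> x)) (\<lambda>i. [:1, -1:] ^ k i) \<in> \<real>\<^sub>\<ge>\<^sub>0" for x k
      using pos[of k] unfolding positive_op_hereditary[OF bounded comm] hform_prod[OF bounded comm]
        pw_def[OF bounded comm, abs_def] by blast
  qed (rule bounded, rule comm)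
  obtain j :: "('n \<Rightarrow> nat) \<Rightarrow> 'a \<Rightarrow> 'k" and N C :: "'n \<Rightarrow> 'k \<Rightarrow> 'k"
    where j: "\<And>\<alpha>. bounded_clinear (j \<alpha>)"
      and jj: "\<And>\<alpha> \<beta> x y. cinner (j \<alpha> x) (j \<beta> y) = cinner (mpow S \<beta> x) (mpow S \<alpha> y)"
      and N: "\<And>i. bounded_clinear (N i)" and C: "\<And>i. bounded_clinear (C i)"
      and Nj: "\<And>i \<alpha> x. N i (j \<alpha> x) = j \<alpha> (S i x)" and Cj: "\<And>i \<alpha> x. C i (j \<alpha> x) = j (\<alpha>(i := Suc (\<alpha> i))) x"
      and contr: "\<And>i y. norm (N i y) \<le> norm y"
      and N0: "\<And>i y. (\<And>\<alpha> x. cinner y (j \<alpha> x) = 0) \<Longrightarrow> N i y = 0"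
      and C0: "\<And>i y. (\<And>\<alpha> x. cinner y (j \<alpha> x) = 0) \<Longrightarrow> C i y = 0"
    using ch.normal_operators[OF inf sep] by blast
  \<comment> \<open>The vectors N^{*\<alpha>} x, whose closed span carries the minimal extension;
    \<open>N\<close> and \<open>C\<close> are explicit on them and vanish on their
    complement.\<close>
  define R where "R = range (\<lambda>(\<alpha>, x). j \<alpha> x)"
  have jR: "j \<alpha> x \<in> R" for \<alpha> x unfolding R_def by (rule range_eqI[of _ _ "(\<alpha>, x)"]) simp
  have R_cases: "\<exists>\<alpha> x. r = j \<alpha> x" if "r \<in> R" for r using that by (auto simp: R_def)
  have perpN: "N i u = 0" and perpC: "C i u = 0" if "\<And>r. r \<in> R \<Longrightarrow> cinner u r = 0" for i u
    using N0[of u i] C0[of u i] that jR by auto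
  \<comment> \<open>The adjoint relation is extended from \<open>R\<close> one argument at a time.
    The extension in the right argument also uses \<open>N_perp\<close>: the range of
    \<open>N i\<close> is orthogonal to the complement of \<open>R\<close>.\<close>
  have adjR: "cinner (N i y) r = cinner y (C i r)" if r: "r \<in> R" for i y r
  proof (rule total_cinner_eq[where R = R and A = "N i" and B = "\<lambda>y. y", OF N bounded_clinear_id])
    obtain \<beta> z where rz: "r = j \<beta> z" using R_cases[OF r] by blast
    show "cinner (N i s) r = cinner s (C i r)" if "s \<in> R" for s
      using R_cases[OF that] by (auto simp: rz Nj Cj jj ch.mpow_Suc)
    show "cinner (N i u) r = cinner u (C i r)" if u: "\<And>r. r \<in> R \<Longrightarrow> cinner u r = 0" for u
      using perpN[OF u] u[OF jR] by (simp add: rz Cj)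
  qed
  have N_perp: "cinner (N i y) u = 0" if u: "\<And>r. r \<in> R \<Longrightarrow> cinner u r = 0" for i y u
  proof -
    have "cinner (N i y) u = cinner 0 u"
    proof (rule total_cinner_eq[where R = R and A = "N i" and B = "\<lambda>y. 0", OF N bounded_clinear_0])
      show "cinner (N i r) u = cinner 0 u" if "r \<in> R" for r
      proof -
        obtain \<alpha> x where r: "r = j \<alpha> x" using R_cases[OF \<open>r \<in> R\<close>] by blast
        show ?thesis
          using u[OF jR[of \<alpha> "S i x"]] cinner_eq_0_commute[of u "j \<alpha> (S i x)"] by (simp add: r Nj)
      qed
      show "cinner (N i v) u = cinner 0 u" if v: "\<And>r. r \<in> R \<Longrightarrow> cinner v r = 0" for v
        using perpN[OF v] by simp
    qed
    then show ?thesis by simp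
  qed
  have adj: "cinner (N i y) z = cinner y (C i z)" for i y z
  proof -
    have "cinner z (N i y) = cinner (C i z) y"
    proof (rule total_cinner_eq[where R = R and A = "\<lambda>y. y" and B = "C i", OF bounded_clinear_id C])
      show "cinner r (N i y) = cinner (C i r) y" if "r \<in> R" for r
        using adjR[OF that, of i y] cinner_commute[of r "N i y"] cinner_commute[of "C i r" y] by simp
      show "cinner u (N i y) = cinner (C i u) y" if u: "\<And>r. r \<in> R \<Longrightarrow> cinner u r = 0" for u
        using perpC[OF u] N_perp[OF u, of i y] cinner_eq_0_commute[of u "N i y"] by simp
    qed
    then show ?thesis using cinner_commute[of "N i y" z] cinner_commute[of y "C i z"] by simp
  qed
  have NN: "N i (N l y) = N l (N i y)" and NC: "N i (C l y) = C l (N i y)" and CC: "C i (C l y) = C l (C i y)" for i l y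
  proof -
    show "N i (N l y) = N l (N i y)"
      by (rule total_op_eq[where R = R, OF bounded_clinear_compose[OF N N] bounded_clinear_compose[OF N N]])
        (auto simp: perpN bounded_clinear_zero[OF N] Nj comm[of i l] dest: R_cases)
    show "N i (C l y) = C l (N i y)"
      by (rule total_op_eq[where R = R, OF bounded_clinear_compose[OF N C] bounded_clinear_compose[OF C N]])
        (auto simp: perpN perpC bounded_clinear_zero[OF N] bounded_clinear_zero[OF C] Nj Cj dest: R_cases)
    \<comment> \<open>Raising two indices commutes, also for \<open>i = l\<close>, where the same
      index is raised twice.\<close>
    have twist: "(\<alpha>(l := Suc (\<alpha> l)))(i := Suc ((\<alpha>(l := Suc (\<alpha> l))) i)) = (\<alpha>(i := Suc (\<alpha> i)))(l := Suc ((\<alpha>(i := Suc (\<alpha> i))) l))" for \<alpha> :: "'n \<Rightarrow> nat"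
      by (auto simp: fun_eq_iff)
    show "C i (C l y) = C l (C i y)"
      by (rule total_op_eq[where R = R, OF bounded_clinear_compose[OF C C] bounded_clinear_compose[OF C C]])
        (auto simp: perpC bounded_clinear_zero[OF C] Cj twist simp del: fun_upd_apply dest: R_cases)
  qed
  interpret nc: normal_contractions N C
    by standard (rule N, rule C, rule adj, rule contr, rule NN, rule NC, rule CC)
  define K where "K = orth (orth R)"
  have K: "closed_csubspace K" unfolding K_def by (rule closed_csubspace_orth)
  then have subK: "complex_vector.subspace K" by (simp add: closed_csubspace_def)
  have RK: "R \<subseteq> K" unfolding K_def by (rule orth_orth_superset)
  have orthN: "N i u = 0" and orthC: "C i u = 0" if "u \<in> orth R" for i u
    using perpN[of u i] perpC[of u i] that by (auto simp: orth_def)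
  have NK: "N i x \<in> K" and CK: "C i x \<in> K" if "x \<in> K" for i x
  proof -
    have "cinner (N i x) u = 0" "cinner (C i x) u = 0" if u: "u \<in> orth R" for u
      by (simp_all add: adj nc.adj' orthN[OF u] orthC[OF u])
    then show "N i x \<in> K" "C i x \<in> K" by (auto simp: K_def orth_def)
  qed
  have opK: "bounded_op_on K T" if T: "bounded_clinear T" and inv: "\<And>x. x \<in> K \<Longrightarrow> T x \<in> K" for T
    unfolding bounded_op_on_def
    using inv bounded_clinear_bounded[OF T] by (auto simp: bounded_clinear_add[OF T] bounded_clinear_scaleC[OF T])
  have adjK: "adj_on K (N i) y = C i y" if "y \<in> K" for i y
    by (rule adj_on_eqI[OF subK CK[OF that]]) (rule adj)
  \<comment> \<open>At exponent 0 the kernel is the inner product of the original space, so this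
    embedding is isometric.\<close>
  define V where "V = j (\<lambda>_. 0)"
  have V_inner: "cinner (V x) (V y) = cinner x y" for x y by (simp add: V_def jj)
  have NV: "N i (V x) = V (S i x)" for i x by (simp add: V_def Nj)
  have VK: "V x \<in> K" for x unfolding V_def using jR RK by auto
  have ext: "normal_extension S V K N"
    unfolding normal_extension_def
  proof (intro conjI allI)
    show "Vector_Spaces.linear scaleC scaleC V"
      unfolding Vector_Spaces.linear_iff
      by (intro conjI allI complex_vector.vector_space_axioms)
        (simp_all add: V_def bounded_clinear_add[OF j] bounded_clinear_scaleC[OF j])
    show "commuting_tuple_on K N"
      unfolding commuting_tuple_on_def using opK[OF N NK] NN by auto
    show "normal_on K (N i)" for i
      unfolding normal_on_def using opK[OF N NK] by (auto simp: adjK NK NC)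
  qed (use K V_inner VK NV in auto)
  have min: "minimal_normal_extension S V K N"
    unfolding minimal_normal_extension_def
  proof (intro conjI ext allI impI)
    fix X assume X: "closed_csubspace X \<and> X \<subseteq> K \<and> range V \<subseteq> X \<and> (\<forall>i. \<forall>x\<in>X. N i x \<in> X \<and> adj_on K (N i) x \<in> X)"
    \<comment> \<open>Each \<open>j \<alpha> x\<close> arises from \<open>V x\<close> by repeated
      adjoints of the \<open>N i\<close>, under which \<open>X\<close> is stable; the induction is
      on the size of \<alpha>.\<close>
    have "j \<alpha> x \<in> X" for \<alpha> x
    proof (induction "\<Sum>i\<in>UNIV. \<alpha> i" arbitrary: \<alpha>)
      case 0
      then have "\<alpha> = (\<lambda>_. 0)" by (auto simp: fun_eq_iff)
      then show ?case using X by (auto simp: V_def)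
    next
      case (Suc n)
      then obtain i where i: "\<alpha> i \<noteq> 0" by (metis nat.distinct(1) sum.neutral)
      define \<beta> where "\<beta> = \<alpha>(i := \<alpha> i - 1)"
      have "(\<Sum>l\<in>UNIV. \<alpha> l) = \<alpha> i + (\<Sum>l\<in>UNIV - {i}. \<alpha> l)" by (rule sum.remove) auto
      moreover have "(\<Sum>l\<in>UNIV. \<beta> l) = (\<alpha> i - 1) + (\<Sum>l\<in>UNIV - {i}. \<alpha> l)"
        unfolding \<beta>_def by (subst sum.remove[of _ i]) (auto intro!: sum.cong)
      ultimately have "n = (\<Sum>l\<in>UNIV. \<beta> l)" using Suc(2) i by simp
      then have jX: "j \<beta> x \<in> X" by (rule Suc(1))
      have "\<alpha> = \<beta>(i := Suc (\<beta> i))" using i by (auto simp: \<beta>_def)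
      then have "j \<alpha> x = C i (j \<beta> x)" by (simp add: Cj)
      also have "\<dots> = adj_on K (N i) (j \<beta> x)" using adjK jX X by (metis subsetD)
      finally show ?case using X jX by simp
    qed
    then have "R \<subseteq> X" by (auto simp: R_def)
    then have "K \<subseteq> X" unfolding K_def using X orth_orth_minimal by blast
    then show "X = K" using X by blast
  qed
  have FK: "nc.F B x \<in> K" if "B \<in> sets borel" "x \<in> K" for B x
    using that unfolding K_def by (intro nc.F_invariant orthN orthC)
  have joint: "joint_spectral_measure K N nc.F" by (rule nc.joint_spectral_measure_F) (rule FK)
  \<comment> \<open>The square serves as bounded carrier until the support is located on the
    boundary.\<close>
  interpret sp: subnormal_pvm K N nc.F nc.square S V
  proof
    show "bounded_op_on K (N i)" for i by (rule opK[OF N NK])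
  qed (auto intro: K joint nc.square_borel nc.square_bounded nc.F_off_square bounded comm VK V_inner NV)
  have Npow: "bounded_clinear (N i ^^ q)" for i q by (rule bounded_clinear_funpow[OF N])
  have K_induct: "P x" if x: "x \<in> K" and P: "complex_vector.subspace {x. P x}" "closed {x. P x}" and R: "\<And>r. r \<in> R \<Longrightarrow> P r" for P x
  proof -
    have "K \<subseteq> {x. P x}"
      unfolding K_def by (rule orth_orth_minimal) (use P R in \<open>auto simp: closed_csubspace_def\<close>)
    then show ?thesis using x by auto
  qed
  \<comment> \<open>Identity (b) for \<open>N\<close> at a pair of vectors. For fixed
    \<open>y\<close> it is a closed linear condition on \<open>x\<close>, and it is symmetric, so it
    spreads from \<open>R\<close> to \<open>K\<close> in each argument in turn.\<close>
  define D where "D x y \<longleftrightarrow> cinner x y = (\<Sum>i\<in>UNIV. \<Sum>l=1..m i. cinner ((N i ^^ p i l) x) ((N i ^^ p i l) y))" for x y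
  have D_sub: "complex_vector.subspace {x. D x y}" "closed {x. D x y}" for y
  proof -
    show "complex_vector.subspace {x. D x y}"
      by (rule complex_vector.subspaceI)
        (auto simp: D_def bounded_clinear_zero[OF Npow] bounded_clinear_add[OF Npow] bounded_clinear_scaleC[OF Npow]
          cinner_add_left cinner_scaleC_left sum.distrib sum_distrib_left)
    show "closed {x. D x y}"
      unfolding D_def
      by (intro closed_Collect_eq continuous_on_sum continuous_on_cinner bounded_clinear_continuous Npow
          continuous_on_id continuous_on_const)
  qed
  have D_sym: "D y x" if "D x y" for x y
  proof -
    have "cinner y x = cnj (cinner x y)" by (rule cinner_commute)
    also have "\<dots> = (\<Sum>i\<in>UNIV. \<Sum>l=1..m i. cnj (cinner ((N i ^^ p i l) x) ((N i ^^ p i l) y)))"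
      using that unfolding D_def by simp
    also have "\<dots> = (\<Sum>i\<in>UNIV. \<Sum>l=1..m i. cinner ((N i ^^ p i l) y) ((N i ^^ p i l) x))"
      by (intro sum.cong refl cinner_commute[symmetric])
    finally show ?thesis unfolding D_def .
  qed
  have N_pow_j: "(N i ^^ q) (j \<alpha> x) = j \<alpha> ((S i ^^ q) x)" for i q \<alpha> x
    by (induction q) (simp_all add: Nj)
  have D_R: "D r s" if rR: "r \<in> R" and sR: "s \<in> R" for r s
  proof -
    obtain \<alpha> x where r: "r = j \<alpha> x" using R_cases[OF rR] by blast
    obtain \<beta> y where s: "s = j \<beta> y" using R_cases[OF sR] by blast
    have swap: "mpow S \<gamma> ((S i ^^ q) z) = (S i ^^ q) (mpow S \<gamma> z)" for \<gamma> i q z by (rule ch.fpow_funpow) simp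
    \<comment> \<open>The kernel trades the pair \<open>j \<alpha> x\<close>,
      \<open>j \<beta> y\<close> for S^\<beta> x, S^\<alpha> y, to which the assumed identity for
      \<open>S\<close> applies.\<close>
    have "hform S (1 - (\<Sum>i\<in>UNIV. \<Sum>j=1..m i. zvar i ^ p i j * wvar i ^ p i j)) (mpow S \<beta> x) (mpow S \<alpha> y) = 0"
      using bdry unfolding hereditary_eq_0_iff[OF bounded comm] by blast
    then show ?thesis
      unfolding hform_boundary[OF bounded comm] by (simp add: D_def r s N_pow_j jj swap)
  qed
  have D_K: "D x y" if x: "x \<in> K" and y: "y \<in> K" for x y
  proof (rule K_induct[OF x D_sub])
    fix r assume r: "r \<in> R"
    have "D y r" by (rule K_induct[OF y D_sub]) (rule D_R[OF _ r])
    then show "D r y" by (rule D_sym)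
  qed
  have "nc.F (- boundary_Sigma m p) x = 0" if "x \<in> K" for x
  proof (rule sp.E_off_boundary[OF _ _ that])
    show "boundary_Sigma m p \<in> sets borel" by (rule borel_closed[OF boundary_Sigma_closed])
    show "cinner x y = (\<Sum>i\<in>UNIV. \<Sum>j=1..m i. cinner ((N i ^^ p i j) x) ((N i ^^ p i j) y))" if "x \<in> K" "y \<in> K" for x y
      using D_K[OF that] by (simp add: D_def)
  qed
  then show ?thesis
    unfolding boundary_Sigma_isometry_def subnormal_def using S ext min joint by blast
qed

theorem proposition4p4:
  fixes S :: "'n::finite \<Rightarrow> 'a::complex_hilbert \<Rightarrow> 'a"
    and m :: "'n \<Rightarrow> nat"
    and p :: "'n \<Rightarrow> nat \<Rightarrow> nat"
  assumes "infinite_dimensional TYPE('a)"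
    and "separable_space (euclidean :: 'a topology)"
    and "infinite_dimensional TYPE('k::complex_hilbert)"
    and "\<And>i. m i \<ge> 1"
    and "\<And>i j. j \<in> {1..m i} \<Longrightarrow> p i j > 0"
    and "commuting_tuple_on UNIV S"
  shows "boundary_Sigma_isometry TYPE('k) m p S \<longleftrightarrow>
           (\<forall>k :: 'n \<Rightarrow> nat.
              positive_op (hereditary (\<Prod>i\<in>UNIV. (1 - zvar i * wvar i) ^ k i) S)) \<and>
           hereditary (1 - (\<Sum>i\<in>UNIV. \<Sum>j=1..m i. zvar i ^ p i j * wvar i ^ p i j)) S = (\<lambda>x. 0)"
proof (intro iffI conjI allI)
  assume iso: "boundary_Sigma_isometry TYPE('k) m p S"
  show "positive_op (hereditary (\<Prod>i\<in>UNIV. (1 - zvar i * wvar i) ^ k i) S)" for k :: "'n \<Rightarrow> nat"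
    by (rule boundary_Sigma_isometry_imp_hereditary(1)[OF assms(4,5) iso])
  show "hereditary (1 - (\<Sum>i\<in>UNIV. \<Sum>j=1..m i. zvar i ^ p i j * wvar i ^ p i j)) S = (\<lambda>x. 0)"
    by (rule boundary_Sigma_isometry_imp_hereditary(2)[OF assms(4,5) iso])
next
  assume "(\<forall>k :: 'n \<Rightarrow> nat. positive_op (hereditary (\<Prod>i\<in>UNIV. (1 - zvar i * wvar i) ^ k i) S)) \<and>
      hereditary (1 - (\<Sum>i\<in>UNIV. \<Sum>j=1..m i. zvar i ^ p i j * wvar i ^ p i j)) S = (\<lambda>x. 0)"
  then show "boundary_Sigma_isometry TYPE('k) m p S"
    by (intro hereditary_imp_boundary_Sigma_isometry[OF assms(3,2,6)]) blast+
qed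

end
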